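(* Let $\phi$ be a Drinfeld $A$-module of rank $r\ge2$ over $F$ and let $0\neq\mathfrak n\in A$. Assume the characteristic $p$ of $F$ does not divide $r$, and let $\mathfrak p\in\mathcal P(\phi)$ be a prime not dividing $\mathfrak n$. Then $\mathfrak p$ splits completely in the Galois extension $F(\phi[\mathfrak n])/F$ if and only if $$a_{\mathfrak p,1}+r\equiv0\pmod{\mathfrak n}\quad\text{and}\quad \mathfrak b_{\mathfrak p,1}\equiv0\pmod{\mathfrak n}.$$
   Context: $A=\mathbb F_q[T]$, $F=\mathbb F_q(T)$, $p=\mathrm{char}\,\mathbb F_q$. Primes of $A$ are nonzero prime ideals identified with monic generators. A Drinfeld $A$-module $\phi$ of rank $r$ over $F$ is a ring homomorphism $A\to F\{\tau\}$ ($\tau c=c^q\tau$) with $\phi_T=T+g_1\tau+\dots+g_r\tau^r$, $g_r\ne0$. For $a\in A$ with $\phi_a=\sum_i c_i\tau^i$, $\phi[a]$ is the set of roots in $F^{\mathrm{alg}}$ of $\phi_a(x)=\sum_i c_ix^{q^i}$, and $F(\phi[a])$ is the splitting field of $\phi_a(x)$ over $F$. $\mathcal P(\phi)$ is the set of primes $\mathfrak p$ with $\mathrm{ord}_\mathfrak p(g_i)\ge0$ for all $i$ and $\mathrm{ord}_\mathfrak p(g_r)=0$; for such $\mathfrak p$ of degree $d$, $\phi\otimes\mathbb F_\mathfrak p$ is the reduced Drinfeld module over $\mathbb F_\mathfrak p=A/\mathfrak p$, $\mathcal E_\mathfrak p=\mathrm{End}_{\mathbb F_\mathfrak p}(\phi\otimes\mathbb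 F_\mathfrak p)$ (centralizer of the image of $A$ in $\mathbb F_\mathfrak p\{\tau\}$), $\pi_\mathfrak p=\tau^d\in\mathcal E_\mathfrak p$, and $P_\mathfrak p(X)=X^r+a_{\mathfrak p,1}X^{r-1}+\dots+a_{\mathfrak p,r}\in A[X]$ is the minimal polynomial of $\pi_\mathfrak p$ over $F$ (it has degree $r$). $A[\pi_\mathfrak p]\subset\mathcal E_\mathfrak p$ are $A$-orders of rank $r$ and $\mathcal E_\mathfrak p/A[\pi_\mathfrak p]\cong A/\mathfrak b_{\mathfrak p,1}\times\cdots\times A/\mathfrak b_{\mathfrak p,r-1}$ with uniquely determined monic $\mathfrak b_{\mathfrak p,1}\mid\cdots\mid\mathfrak b_{\mathfrak p,r-1}$ (the refined index). *)

theory Defs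
  imports "HOL-Computational_Algebra.Computational_Algebra" "HOL-Algebra.Algebraic_Closure_Type"
begin

text \<open>Conventions. F_q is a finite field type 'a, q = (card (UNIV :: 'a set)); A = 'a poly; F = 'a poly fract;
  F^alg = ('a poly fract) alg_closure. Twisted (skew) polynomials sum c_i tau^i are represented
  by ordinary polynomials with coefficient c_i at index i, multiplied with the twisted rule
  tau c = c^q tau. A Drinfeld module phi is given by phi_T.\<close>

definition skew_mult :: "nat \<Rightarrow> 'b::comm_ring_1 poly \<Rightarrow> 'b poly \<Rightarrow> 'b poly" where
  "skew_mult q f g = (\<Sum>i\<le>degree f. monom (coeff f i) i * map_poly (\<lambda>c. c ^ (q ^ i)) g)"

fun skew_pow :: "nat \<Rightarrow> 'b::comm_ring_1 poly \<Rightarrow> nat \<Rightarrow> 'b poly" where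
  "skew_pow q f 0 = 1"
| "skew_pow q f (Suc k) = skew_mult q f (skew_pow q f k)"

text \<open>phi_a = a(phi_T) in F{tau}, for a in A (coefficients of a lie in F_q and commute with tau).\<close>
definition phi_of :: "'a::{finite,field_gcd} poly fract poly \<Rightarrow> 'a poly \<Rightarrow> 'a poly fract poly" where
  "phi_of phiT a = (\<Sum>k\<le>degree a. smult (to_fract [:coeff a k:]) (skew_pow (card (UNIV :: 'a set)) phiT k))"

definition drinfeld_module :: "nat \<Rightarrow> 'a::{finite,field_gcd} poly fract poly \<Rightarrow> bool" where
  "drinfeld_module r phiT \<longleftrightarrow> coeff phiT 0 = to_fract [:0, 1:] \<and> degree phiT = r \<and> r \<ge> 1"

definition p_integral :: "'a::field_gcd poly \<Rightarrow> 'a poly fract \<Rightarrow> bool" where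
  "p_integral p x \<longleftrightarrow> (\<exists>u v. x = Fract u v \<and> v \<noteq> 0 \<and> \<not> p dvd v)"

definition p_unit :: "'a::field_gcd poly \<Rightarrow> 'a poly fract \<Rightarrow> bool" where
  "p_unit p x \<longleftrightarrow> (\<exists>u v. x = Fract u v \<and> v \<noteq> 0 \<and> \<not> p dvd v \<and> \<not> p dvd u)"

definition good_primes :: "nat \<Rightarrow> 'a::{finite,field_gcd} poly fract poly \<Rightarrow> 'a poly set" where
  "good_primes r phiT = {p. prime p \<and> (\<forall>i. p_integral p (coeff phiT i)) \<and> p_unit p (coeff phiT r)}"

text \<open>Reduction mod p: F_p = A/p is represented by the residues y with y mod p = y.\<close>
definition red :: "'a::field_gcd poly \<Rightarrow> 'a poly fract \<Rightarrow> 'a poly" where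
  "red p x = (SOME y. y mod p = y \<and> (\<exists>u v. x = Fract u v \<and> v \<noteq> 0 \<and> \<not> p dvd v \<and> p dvd (y * v - u)))"

definition rmult :: "'a::field_gcd poly \<Rightarrow> nat \<Rightarrow> 'a poly poly \<Rightarrow> 'a poly poly \<Rightarrow> 'a poly poly" where
  "rmult p q f g = map_poly (\<lambda>c. c mod p) (skew_mult q f g)"

fun rpow :: "'a::field_gcd poly \<Rightarrow> nat \<Rightarrow> 'a poly poly \<Rightarrow> nat \<Rightarrow> 'a poly poly" where
  "rpow p q f 0 = 1"
| "rpow p q f (Suc k) = rmult p q f (rpow p q f k)"

definition phi_red :: "'a::{finite,field_gcd} poly \<Rightarrow> 'a poly fract poly \<Rightarrow> 'a poly \<Rightarrow> 'a poly poly" where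
  "phi_red p phiT a = map_poly (red p) (phi_of phiT a)"

definition End_red :: "'a::{finite,field_gcd} poly \<Rightarrow> 'a poly fract poly \<Rightarrow> 'a poly poly set" where
  "End_red p phiT = {f. (\<forall>k. coeff f k mod p = coeff f k) \<and>
     (\<forall>a. rmult p (card (UNIV :: 'a set)) f (phi_red p phiT a) = rmult p (card (UNIV :: 'a set)) (phi_red p phiT a) f)}"

definition frob :: "'a::field_gcd poly \<Rightarrow> 'a poly poly" where
  "frob p = monom 1 (degree p)"

definition eval_frob :: "'a::{finite,field_gcd} poly \<Rightarrow> 'a poly fract poly \<Rightarrow> 'a poly poly \<Rightarrow> 'a poly poly" where
  "eval_frob p phiT c = (\<Sum>k\<le>degree c. rmult p (card (UNIV :: 'a set)) (phi_red p phiT (coeff c k))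
       (rpow p (card (UNIV :: 'a set)) (frob p) k))"

definition A_frob :: "'a::{finite,field_gcd} poly \<Rightarrow> 'a poly fract poly \<Rightarrow> 'a poly poly set" where
  "A_frob p phiT = range (eval_frob p phiT)"

definition frob_charpoly :: "'a::{finite,field_gcd} poly \<Rightarrow> 'a poly fract poly \<Rightarrow> 'a poly poly" where
  "frob_charpoly p phiT = (THE P. lead_coeff P = 1 \<and> eval_frob p phiT P = 0 \<and>
      (\<forall>Q. lead_coeff Q = 1 \<and> eval_frob p phiT Q = 0 \<longrightarrow> degree P \<le> degree Q))"

text \<open>Refined index: E_p / A[pi_p] \<cong> A/b_0 \<times> ... \<times> A/b_(r-2) as A-modules, b monic,
  b_0 | b_1 | ... (0-based indices; b_0 is the paper's b_(p,1)).\<close>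
definition refined_index :: "nat \<Rightarrow> 'a::{finite,field_gcd} poly \<Rightarrow> 'a poly fract poly \<Rightarrow> (nat \<Rightarrow> 'a poly) \<Rightarrow> bool" where
  "refined_index r p phiT b \<longleftrightarrow>
     (\<forall>i<r-1. lead_coeff (b i) = 1) \<and> (\<forall>i. Suc i < r - 1 \<longrightarrow> b i dvd b (Suc i)) \<and>
     (\<exists>h :: 'a poly poly \<Rightarrow> nat \<Rightarrow> 'a poly.
        (\<forall>f\<in>End_red p phiT. \<forall>g\<in>End_red p phiT. \<forall>a. \<forall>i<r-1.
            b i dvd (h (rmult p (card (UNIV :: 'a set)) (phi_red p phiT a) f + g) i - (a * h f i + h g i))) \<and>
        (\<forall>c. \<exists>f\<in>End_red p phiT. \<forall>i<r-1. b i dvd (h f i - c i)) \<and>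
        (\<forall>f\<in>End_red p phiT. f \<in> A_frob p phiT \<longleftrightarrow> (\<forall>i<r-1. b i dvd h f i)))"

definition refined_b1 :: "nat \<Rightarrow> 'a::{finite,field_gcd} poly \<Rightarrow> 'a poly fract poly \<Rightarrow> 'a poly" where
  "refined_b1 r p phiT = (THE \<beta>. \<exists>b. refined_index r p phiT b \<and> b 0 = \<beta>)"

definition emb :: "'a::field_gcd poly fract \<Rightarrow> 'a poly fract alg_closure" where
  "emb x = to_ac x"

definition torsion :: "'a::{finite,field_gcd} poly fract poly \<Rightarrow> 'a poly \<Rightarrow> 'a poly fract alg_closure set" where
  "torsion phiT n = {x. (\<Sum>i\<le>degree (phi_of phiT n). emb (coeff (phi_of phiT n) i) * x ^ ((card (UNIV :: 'a set)) ^ i)) = 0}"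

definition is_subfield :: "'b::field set \<Rightarrow> bool" where
  "is_subfield K \<longleftrightarrow> 0 \<in> K \<and> 1 \<in> K \<and> (\<forall>x\<in>K. \<forall>y\<in>K. x + y \<in> K \<and> x * y \<in> K) \<and>
     (\<forall>x\<in>K. - x \<in> K \<and> inverse x \<in> K)"

definition torsion_field :: "'a::{finite,field_gcd} poly fract poly \<Rightarrow> 'a poly \<Rightarrow> 'a poly fract alg_closure set" where
  "torsion_field phiT n = \<Inter>{K. is_subfield K \<and> range emb \<subseteq> K \<and> torsion phiT n \<subseteq> K}"

definition ext_degree :: "'a::field_gcd poly fract alg_closure set \<Rightarrow> nat" where
  "ext_degree L = (LEAST m. \<exists>S. finite S \<and> S \<subseteq> L \<and> card S = m \<and>
      L \<subseteq> {\<Sum>s\<in>S. emb (c s) * s | c. True})"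

definition A_emb :: "'a::field_gcd poly \<Rightarrow> 'a poly fract alg_closure" where
  "A_emb a = emb (to_fract a)"

definition int_closure :: "'a::field_gcd poly fract alg_closure set \<Rightarrow> 'a poly fract alg_closure set" where
  "int_closure L = {x\<in>L. \<exists>f :: 'a poly poly. lead_coeff f = 1 \<and> poly (map_poly A_emb f) x = 0}"

definition primes_above :: "'a::field_gcd poly fract alg_closure set \<Rightarrow> 'a poly \<Rightarrow> 'a poly fract alg_closure set set" where
  "primes_above L p = {P. let B = int_closure L in
      P \<subseteq> B \<and> 0 \<in> P \<and> (\<forall>x\<in>P. \<forall>y\<in>P. x + y \<in> P) \<and> (\<forall>b\<in>B. \<forall>x\<in>P. b * x \<in> P) \<and>
      P \<noteq> B \<and> (\<forall>x\<in>B. \<forall>y\<in>B. x * y \<in> P \<longrightarrow> x \<in> P \<or> y \<in> P) \<and>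
      P \<inter> range A_emb = A_emb ` {a. p dvd a}}"

definition splits_completely :: "'a::field_gcd poly fract alg_closure set \<Rightarrow> 'a poly \<Rightarrow> bool" where
  "splits_completely L p \<longleftrightarrow> card (primes_above L p) = ext_degree L"

end

theory Submission
  imports "Jordan_Normal_Form.Char_Poly" "HOL-Library.Product_Plus" Defs
begin

text \<open>
  Let pi = tau^d be the Frobenius of the reduction at p, inside the endomorphism ring E. The
  theorem is reduced to the statement that pi - 1 is right divisible by the reduction of phi_n.

  \<^emph>\<open>Arithmetic side.\<close> As the characteristic does not divide r, the derivative of the characteristic
  polynomial of pi is nonzero, so E lies in c^(-1) A[pi] for some c and the elementary divisor theorem
  applies to E over A[pi]. Then n divides b_1 iff pi = a + n gamma with a in A and gamma in E; comparing
  traces, a_1 + r = 0 modulo n amounts to a = 1 modulo n.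

  \<^emph>\<open>Galois side.\<close> If p splits completely, every torsion point is congruent to an element
  of A modulo a prime above p, so all roots of the reduction of phi_n lie in the residue field, and
  right division of pi - 1 by it leaves no remainder. Conversely, if pi - 1 is a multiple, then
  x^(q^d) - x lies in p C for all x in the ring C generated over the local ring A_(p) by the torsion.
  So C / p C is a product of copies of A / p, and Nakayama's lemma shows that the number of primes
  above p is at least the degree of the extension.
\<close>

text \<open>Residues modulo p form no type of their own, so A/p is placed inside the algebraic
  closure of F_q by sending T to a root \<theta> of p; all reduced twisted polynomials then live in
  one ring without zero divisors, where cancellation is possible. Two devices control E. A
  determinant over dual numbers yields, for every \<gamma> in E, the characteristic polynomial P of
  pi together with an expression of \<gamma> P'(pi) as a polynomial in pi. A count of elements of
  bounded degree shows that pi satisfies no relation of degree below r, which makes P unique. On the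
  side of the torsion field the obstacle is that torsion points are integral only over the local
  ring at p. Primes are therefore studied in the ring C first; its quotient by p has no nilpotent
  elements, and this is what forces C to contain the integral closure of A. The hypothesis on the
  characteristic enters twice: P' has top coefficient r, and the two traces differ by r (a - 1).
  That p does not divide n makes reduction injective on the torsion.\<close>

hide_const (open) up_ring.monom up_ring.coeff Polynomials.lead_coeff Polynomials.degree
  Divisibility.prime Module.module.smult

section \<open>Finite fields and the additivity of the q-power map\<close>

lemma card_UNIV_gt_1: "1 < card (UNIV :: 'a::{finite,field} set)"
proof -
  have "card {0, 1::'a} \<le> card (UNIV :: 'a set)" by (rule card_mono) auto
  then show ?thesis by simp
qed

lemma power_card_UNIV_eq_self: "(x::'a::{finite,field}) ^ card (UNIV :: 'a set) = x"
proof (cases "x = 0")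
  case True
  then show ?thesis using card_UNIV_gt_1[where 'a = 'a] by simp
next
  case False
  have "bij_betw ((*) x) (UNIV - {0}) (UNIV - {0})"
    by (rule bij_betw_byWitness[of _ "\<lambda>y. y / x"]) (use False in auto)
  then have "(\<Prod>y\<in>UNIV - {0}. x * y) = (\<Prod>y\<in>UNIV - {0}. y)"
    by (rule prod.reindex_bij_betw)
  then have "x ^ card (UNIV - {0::'a}) = 1"
    by (simp add: prod.distrib)
  then have "x ^ Suc (card (UNIV - {0::'a})) = x" by simp
  moreover have "Suc (card (UNIV - {0::'a})) = card (UNIV :: 'a set)"
    by (rule card_Suc_Diff1) auto
  ultimately show ?thesis by simp
qed

lemma poly_eq_0_if_vanishes:
  fixes f :: "'b::idom poly"
  assumes "finite S" and "\<And>x. x \<in> S \<Longrightarrow> poly f x = 0" and "degree f < card S"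
  shows "f = 0"
proof (rule ccontr)
  assume "f \<noteq> 0"
  then have "card S \<le> card {x. poly f x = 0}" "card {x. poly f x = 0} \<le> degree f"
    using assms by (auto intro!: card_mono poly_roots_finite card_poly_roots_bound)
  then show False using assms(3) by linarith
qed

text \<open>The polynomial (X + 1)^q - X^q - 1 has degree < q and vanishes on the whole field of
  q elements, so the inner binomial coefficients of q are zero in that field.\<close>
lemma of_nat_choose_card_eq_0:
  assumes "0 < i" "i < card (UNIV :: 'a::{finite,field} set)"
  shows "of_nat (card (UNIV :: 'a set) choose i) = (0::'a)"
proof -
  let ?q = "card (UNIV :: 'a set)"
  define f :: "'a poly" where "f = [:1, 1:] ^ ?q - monom 1 ?q - 1"
  have co: "coeff f j = of_nat (?q choose j) - (if j = ?q then 1 else 0) - (if j = 0 then 1 else 0)" for j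
    unfolding f_def by (cases "j \<le> ?q") (auto simp: coeff_linear_poly_power binomial_eq_0 coeff_eq_0 degree_linear_power)
  have "coeff f j = 0" if "j \<ge> ?q" for j
  proof (cases "j = ?q")
    case True then show ?thesis unfolding co using card_UNIV_gt_1[where 'a = 'a] by simp
  next
    case False
    then show ?thesis unfolding co using that by (simp add: binomial_eq_0)
  qed
  moreover have "?q > 0" using card_UNIV_gt_1[where 'a = 'a] by simp
  ultimately have "degree f < ?q"
    by (metis leading_coeff_0_iff degree_0 not_le)
  then have "f = 0"
    by (intro poly_eq_0_if_vanishes[of UNIV])
      (auto simp: f_def poly_monom power_card_UNIV_eq_self algebra_simps)
  then have "coeff f i = 0" by simp
  then show ?thesis unfolding co using assms by simp
qed

text \<open>Every inner binomial coefficient of q vanishes in the finite field, and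
  \<open>char\<close> carries this over to 'b. The hypothesis speaks of natural numbers only, so
  that one statement serves the closures of F_q and of F without a map from the field of
  constants.\<close>

lemma power_card_add:
  fixes x y :: "'b::comm_ring_1"
  assumes char: "\<And>k. of_nat k = (0::'a::{finite,field}) \<Longrightarrow> of_nat k = (0::'b)"
  shows "(x + y) ^ card (UNIV :: 'a set) = x ^ card (UNIV :: 'a set) + y ^ card (UNIV :: 'a set)"
proof -
  let ?q = "card (UNIV :: 'a set)"
  have q: "?q > 0" using card_UNIV_gt_1[where 'a = 'a] by simp
  have "(x + y) ^ ?q = (\<Sum>k\<le>?q. of_nat (?q choose k) * x ^ k * y ^ (?q - k))"
    by (rule binomial_ring)
  also have "\<dots> = (\<Sum>k\<in>{0, ?q}. of_nat (?q choose k) * x ^ k * y ^ (?q - k))"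
  proof (rule sum.mono_neutral_right)
    show "\<forall>i\<in>{..?q} - {0, ?q}. of_nat (?q choose i) * x ^ i * y ^ (?q - i) = 0"
      using char[OF of_nat_choose_card_eq_0[where 'a = 'a]] by auto
  qed auto
  also have "\<dots> = x ^ ?q + y ^ ?q" using q by simp
  finally show ?thesis .
qed

lemma power_card_power_add:
  fixes x y :: "'b::comm_ring_1"
  assumes char: "\<And>k. of_nat k = (0::'a::{finite,field}) \<Longrightarrow> of_nat k = (0::'b)"
  shows "(x + y) ^ (card (UNIV :: 'a set) ^ i) = x ^ (card (UNIV :: 'a set) ^ i) + y ^ (card (UNIV :: 'a set) ^ i)"
  by (induction i) (simp_all add: power_mult power_card_add[OF char] power_Suc2 del: power_Suc)

lemma power_card_power_sum:
  fixes f :: "'i \<Rightarrow> 'b::comm_ring_1"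
  assumes char: "\<And>k. of_nat k = (0::'a::{finite,field}) \<Longrightarrow> of_nat k = (0::'b)"
  shows "(\<Sum>j\<in>J. f j) ^ (card (UNIV :: 'a set) ^ i) = (\<Sum>j\<in>J. f j ^ (card (UNIV :: 'a set) ^ i))"
proof (induction J rule: infinite_finite_induct)
  case (insert a J)
  then show ?case by (simp add: power_card_power_add[OF char])
qed (use card_UNIV_gt_1[where 'a = 'a] in \<open>auto simp: zero_power\<close>)

lemma ac_char: "of_nat k = (0::'a::field) \<Longrightarrow> of_nat k = (0 :: 'a alg_closure)"
  by (metis to_ac_of_nat to_ac_0)


section \<open>Twisted polynomials over the closure of F_q\<close>

lemma coeff_skew_mult:
  assumes "q > 0"
  shows "coeff (skew_mult q f g) k = (\<Sum>i\<le>k. coeff f i * coeff g (k - i) ^ (q ^ i))"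
proof -
  have z: "(0::'a) ^ q ^ i = 0" for i using assms by (simp add: zero_power)
  have "coeff (skew_mult q f g) k = (\<Sum>i\<le>degree f. if i \<le> k then coeff f i * coeff g (k - i) ^ (q ^ i) else 0)"
    unfolding skew_mult_def coeff_sum
    by (intro sum.cong) (auto simp: coeff_monom_mult coeff_map_poly z)
  also have "\<dots> = (\<Sum>i\<in>{..degree f} \<inter> {..k}. coeff f i * coeff g (k - i) ^ (q ^ i))"
    by (subst sum.inter_restrict) (auto intro: sum.cong)
  also have "\<dots> = (\<Sum>i\<le>k. coeff f i * coeff g (k - i) ^ (q ^ i))"
    by (rule sum.mono_neutral_left) (auto, metis coeff_eq_0 mult_zero_left not_le)
  finally show ?thesis .
qed

text \<open>A copy of the polynomial type, so that the skew multiplication becomes an instance of the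
  ring type classes.\<close>

typedef (overloaded) 'a twist = "UNIV :: 'a::{finite,field_gcd} alg_closure poly set"
  by simp

lemma ac_power_add:
  "((x::'a::{finite,field_gcd} alg_closure) + y) ^ (card (UNIV :: 'a set) ^ i) =
    x ^ (card (UNIV :: 'a set) ^ i) + y ^ (card (UNIV :: 'a set) ^ i)"
  by (rule power_card_power_add[OF ac_char])

lemma ac_power_sum:
  "(\<Sum>j\<in>J. f j :: 'a::{finite,field_gcd} alg_closure) ^ (card (UNIV :: 'a set) ^ i) =
    (\<Sum>j\<in>J. f j ^ (card (UNIV :: 'a set) ^ i))"
  by (rule power_card_power_sum[OF ac_char])

lemma sum_triangle:
  fixes t :: "nat \<Rightarrow> nat \<Rightarrow> 'b::comm_monoid_add"
  shows "(\<Sum>i\<le>k. \<Sum>j\<le>i. t j (i - j)) = (\<Sum>j\<le>k. \<Sum>i\<le>k - j. t j i)"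
proof -
  have "(\<Sum>i\<le>k. \<Sum>j\<le>i. t j (i - j)) = (\<Sum>(i, j)\<in>{(i, j). i + j \<le> k}. t i j)"
    by (rule sum.triangle_reindex_eq[symmetric])
  also have "{(i, j). i + j \<le> k} = Sigma {..k} (\<lambda>j. {..k - j})" by auto
  also have "(\<Sum>(i, j)\<in>Sigma {..k} (\<lambda>j. {..k - j}). t i j) = (\<Sum>j\<le>k. \<Sum>i\<le>k - j. t j i)"
    by (rule sum.Sigma[symmetric]) auto
  finally show ?thesis .
qed

text \<open>Besides reindexing a triangular sum, this takes the q^i-th power of the inner sum term
  by term. That is a fact of characteristic p, hence the restriction to coefficients in the closure
  of F_q.\<close>

lemma skew_mult_assoc_ac:
  fixes f g h :: "'a::{finite,field_gcd} alg_closure poly"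
  defines "q \<equiv> card (UNIV :: 'a set)"
  shows "skew_mult q (skew_mult q f g) h = skew_mult q f (skew_mult q g h)"
proof (rule poly_eqI)
  fix k
  have q: "q > 0" using card_UNIV_gt_1[where 'a = 'a] by (simp add: q_def)
  let ?t = "\<lambda>j i. coeff f j * coeff g i ^ (q ^ j) * coeff h (k - j - i) ^ (q ^ (j + i))"
  have "coeff (skew_mult q (skew_mult q f g) h) k = (\<Sum>i\<le>k. \<Sum>j\<le>i. ?t j (i - j))"
    by (auto simp: coeff_skew_mult[OF q] sum_distrib_right intro!: sum.cong)
  also have "\<dots> = (\<Sum>j\<le>k. \<Sum>i\<le>k - j. ?t j i)"
    by (rule sum_triangle)
  also have "\<dots> = coeff (skew_mult q f (skew_mult q g h)) k"
    unfolding coeff_skew_mult[OF q]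
    by (intro sum.cong refl)
      (simp add: q_def ac_power_sum sum_distrib_left power_mult_distrib power_mult[symmetric] power_add mult.assoc mult.commute)
  finally show "coeff (skew_mult q (skew_mult q f g) h) k = coeff (skew_mult q f (skew_mult q g h)) k" .
qed

lemma twist_eq_iff: "f = g \<longleftrightarrow> Rep_twist f = Rep_twist g"
  by (simp add: Rep_twist_inject)

instantiation twist :: ("{finite,field_gcd}") "{zero,one,plus,minus,uminus,times}"
begin
definition "0 = Abs_twist 0"
definition "1 = Abs_twist 1"
definition "f + g = Abs_twist (Rep_twist f + Rep_twist g)"
definition "f - g = Abs_twist (Rep_twist f - Rep_twist g)"
definition "- f = Abs_twist (- Rep_twist f)"
definition "f * g = Abs_twist (skew_mult (card (UNIV :: 'a set)) (Rep_twist f) (Rep_twist g))"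
instance ..
end

lemma Rep_twist_simps:
  "Rep_twist 0 = 0"
  "Rep_twist 1 = 1"
  "Rep_twist (f + g) = Rep_twist f + Rep_twist g"
  "Rep_twist (f - g) = Rep_twist f - Rep_twist g"
  "Rep_twist (- f) = - Rep_twist f"
  "Rep_twist (f * g :: 'a::{finite,field_gcd} twist) =
     skew_mult (card (UNIV :: 'a set)) (Rep_twist f) (Rep_twist g)"
  by (simp_all add: zero_twist_def one_twist_def plus_twist_def minus_twist_def uminus_twist_def
      times_twist_def Abs_twist_inverse)

instance twist :: ("{finite,field_gcd}") ring_1
proof
  have q: "card (UNIV :: 'a set) > 0" using card_UNIV_gt_1[where 'a = 'a] by simp
  fix a b c :: "'a twist"
  show "a * b * c = a * (b * c)" by (simp add: twist_eq_iff Rep_twist_simps skew_mult_assoc_ac)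
  show "a + b + c = a + (b + c)" by (simp add: twist_eq_iff Rep_twist_simps add.assoc)
  show "a + b = b + a" by (simp add: twist_eq_iff Rep_twist_simps add.commute)
  show "0 + a = a" by (simp add: twist_eq_iff Rep_twist_simps)
  show "- a + a = 0" by (simp add: twist_eq_iff Rep_twist_simps)
  show "a - b = a + - b" by (simp add: twist_eq_iff Rep_twist_simps)
  show "(a + b) * c = a * c + b * c"
    by (simp add: twist_eq_iff Rep_twist_simps poly_eq_iff coeff_skew_mult[OF q] algebra_simps sum.distrib)
  show "a * (b + c) = a * b + a * c"
    by (simp add: twist_eq_iff Rep_twist_simps poly_eq_iff coeff_skew_mult[OF q] ac_power_add
        algebra_simps sum.distrib)
  show "1 * a = a"
    by (simp add: twist_eq_iff Rep_twist_simps poly_eq_iff coeff_skew_mult[OF q] of_bool_def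
        if_distrib[of "\<lambda>x. x * _"] sum.delta cong: if_cong)
  have "(\<Sum>i\<le>n. coeff f i * coeff 1 (n - i) ^ (card (UNIV :: 'a set)) ^ i) = coeff f n"
    for f :: "'a alg_closure poly" and n
  proof -
    have "(\<Sum>i\<le>n. coeff f i * coeff 1 (n - i) ^ (card (UNIV :: 'a set)) ^ i) =
      (\<Sum>i\<le>n. if i = n then coeff f i else 0)"
      using q by (intro sum.cong) (auto simp: zero_power)
    then show ?thesis by simp
  qed
  then show "a * 1 = a"
    by (simp add: twist_eq_iff Rep_twist_simps poly_eq_iff coeff_skew_mult[OF q])
  show "(0::'a twist) \<noteq> 1" by (simp add: twist_eq_iff Rep_twist_simps)
qed

definition tcoeff :: "'a::{finite,field_gcd} twist \<Rightarrow> nat \<Rightarrow> 'a alg_closure" where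
  "tcoeff f = coeff (Rep_twist f)"

definition tmonom :: "'a::{finite,field_gcd} alg_closure \<Rightarrow> nat \<Rightarrow> 'a twist" where
  "tmonom c i = Abs_twist (monom c i)"

definition tdeg :: "'a::{finite,field_gcd} twist \<Rightarrow> nat" where
  "tdeg f = degree (Rep_twist f)"

lemma twist_eqI: "(\<And>k. tcoeff f k = tcoeff g k) \<Longrightarrow> f = g"
  by (simp add: tcoeff_def twist_eq_iff poly_eq_iff)

lemma tcoeff_simps [simp]:
  "tcoeff 0 k = 0"
  "tcoeff 1 k = (if k = 0 then 1 else 0)"
  "tcoeff (f + g) k = tcoeff f k + tcoeff g k"
  "tcoeff (f - g) k = tcoeff f k - tcoeff g k"
  "tcoeff (- f) k = - tcoeff f k"
  "tcoeff (tmonom c i) k = (if i = k then c else 0)"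
  "tcoeff (Abs_twist h) k = coeff h k"
  by (simp_all add: tcoeff_def Rep_twist_simps tmonom_def Abs_twist_inverse)

lemma tcoeff_mult:
  "tcoeff (f * g :: 'a::{finite,field_gcd} twist) k =
    (\<Sum>i\<le>k. tcoeff f i * tcoeff g (k - i) ^ (card (UNIV :: 'a set) ^ i))"
  using card_UNIV_gt_1[where 'a = 'a] by (simp add: tcoeff_def Rep_twist_simps coeff_skew_mult)

lemma tcoeff_sum: "tcoeff (\<Sum>i\<in>I. f i) k = (\<Sum>i\<in>I. tcoeff (f i) k)"
  by (induction I rule: infinite_finite_induct) auto

lemma tcoeff_above_tdeg: "k > tdeg f \<Longrightarrow> tcoeff f k = 0"
  by (simp add: tcoeff_def tdeg_def coeff_eq_0)

lemma tdeg_le: "(\<And>k. k > n \<Longrightarrow> tcoeff f k = 0) \<Longrightarrow> tdeg f \<le> n"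
  by (simp add: tcoeff_def tdeg_def degree_le)

lemma tcoeff_tdeg_eq_0_iff: "tcoeff f (tdeg f) = 0 \<longleftrightarrow> f = 0"
  by (simp add: tcoeff_def tdeg_def twist_eq_iff Rep_twist_simps)

lemma twist_decomp: "f = (\<Sum>i\<le>tdeg f. tmonom (tcoeff f i) i)"
  by (rule twist_eqI) (auto simp: tcoeff_sum tcoeff_above_tdeg)

lemma tmonom_mult:
  "tmonom a i * tmonom b j = (tmonom (a * b ^ (card (UNIV :: 'a::{finite,field_gcd} set) ^ i)) (i + j) :: 'a twist)"
proof (rule twist_eqI)
  fix k
  have q: "card (UNIV :: 'a set) > 0" using card_UNIV_gt_1[where 'a = 'a] by simp
  have "tcoeff (tmonom a i * tmonom b j :: 'a twist) k =
    (\<Sum>l\<le>k. if l = i then if k - l = j then a * b ^ (card (UNIV :: 'a set) ^ i) else 0 else 0)"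
    unfolding tcoeff_mult using q by (intro sum.cong) (auto simp: zero_power)
  then show "tcoeff (tmonom a i * tmonom b j) k =
    tcoeff (tmonom (a * b ^ (card (UNIV :: 'a set) ^ i)) (i + j) :: 'a twist) k"
    by auto
qed

lemma tmonom_add: "tmonom (a + b) i = tmonom a i + tmonom b i"
  by (rule twist_eqI) simp

lemma tmonom_0 [simp]: "tmonom 0 i = 0"
  by (rule twist_eqI) simp

lemma tmonom_sum: "tmonom (\<Sum>j\<in>J. f j) i = (\<Sum>j\<in>J. tmonom (f j) i)"
  by (rule twist_eqI) (simp add: tcoeff_sum)

lemma tmonom_1_0 [simp]: "tmonom 1 0 = 1"
  by (rule twist_eqI) simp

lemma tmonom_eq_0_iff [simp]: "tmonom c i = 0 \<longleftrightarrow> c = 0"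
  by (metis tcoeff_simps(1,6) tmonom_0)

lemma tdeg_mult_le: "tdeg (f * g) \<le> tdeg f + tdeg g"
proof (rule tdeg_le)
  fix k assume k: "k > tdeg f + tdeg g"
  have "tcoeff f i * tcoeff g (k - i) ^ (card (UNIV :: 'a set) ^ i) = 0" if "i \<le> k" for i
  proof (cases "i > tdeg f")
    case False
    then have "k - i > tdeg g" using k by simp
    then show ?thesis using card_UNIV_gt_1[where 'a = 'a] by (simp add: tcoeff_above_tdeg zero_power)
  qed (simp add: tcoeff_above_tdeg)
  then show "tcoeff (f * g) k = 0" unfolding tcoeff_mult by (simp add: sum.neutral)
qed

lemma tcoeff_mult_tdeg:
  "tcoeff (f * g :: 'a::{finite,field_gcd} twist) (tdeg f + tdeg g) =
    tcoeff f (tdeg f) * tcoeff g (tdeg g) ^ (card (UNIV :: 'a set) ^ tdeg f)"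
proof -
  have "(\<Sum>i\<le>tdeg f + tdeg g. tcoeff f i * tcoeff g (tdeg f + tdeg g - i) ^ (card (UNIV :: 'a set) ^ i)) =
    (\<Sum>i\<le>tdeg f + tdeg g. if i = tdeg f then tcoeff f i * tcoeff g (tdeg g) ^ (card (UNIV :: 'a set) ^ i) else 0)"
  proof (intro sum.cong refl)
    fix i
    show "tcoeff f i * tcoeff g (tdeg f + tdeg g - i) ^ (card (UNIV :: 'a set) ^ i) =
      (if i = tdeg f then tcoeff f i * tcoeff g (tdeg g) ^ (card (UNIV :: 'a set) ^ i) else 0)"
      using card_UNIV_gt_1[where 'a = 'a]
      by (cases i "tdeg f" rule: linorder_cases) (auto simp: tcoeff_above_tdeg zero_power)
  qed
  then show ?thesis unfolding tcoeff_mult by simp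
qed

text \<open>The leading coefficient of a product is the product of the leading coefficients, one of
  them raised to a power of q, so it cannot vanish. Cancelling tau^d, or the image of a nonzero
  element of A, on either side rests on this.\<close>

instance twist :: ("{finite,field_gcd}") ring_1_no_zero_divisors
proof
  fix f g :: "'a twist"
  assume "f \<noteq> 0" "g \<noteq> 0"
  then have "tcoeff (f * g) (tdeg f + tdeg g) \<noteq> 0"
    unfolding tcoeff_mult_tdeg by (simp add: tcoeff_tdeg_eq_0_iff)
  then show "f * g \<noteq> 0" by auto
qed

lemma tdeg_mult: "f \<noteq> 0 \<Longrightarrow> g \<noteq> 0 \<Longrightarrow> tdeg (f * g) = tdeg f + tdeg g"
proof (rule antisym[OF tdeg_mult_le])
  assume "f \<noteq> 0" "g \<noteq> 0"
  then have "tcoeff (f * g) (tdeg f + tdeg g) \<noteq> 0"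
    unfolding tcoeff_mult_tdeg by (simp add: tcoeff_tdeg_eq_0_iff)
  then show "tdeg f + tdeg g \<le> tdeg (f * g)"
    by (meson not_le tcoeff_above_tdeg)
qed

lemma tdeg_add_le: "tdeg f \<le> n \<Longrightarrow> tdeg g \<le> n \<Longrightarrow> tdeg (f + g) \<le> n"
  by (simp add: tdeg_def Rep_twist_simps degree_add_le)

lemma tdeg_sum_le: "(\<And>i. i \<in> I \<Longrightarrow> tdeg (f i) \<le> n) \<Longrightarrow> tdeg (\<Sum>i\<in>I. f i) \<le> n"
proof (induction I rule: infinite_finite_induct)
  case (insert i I)
  then show ?case by (simp add: tdeg_add_le)
qed (simp_all add: tdeg_def Rep_twist_simps)

lemma tdeg_tmonom_le: "tdeg (tmonom c i) \<le> i"
  by (simp add: tdeg_def tmonom_def Abs_twist_inverse degree_monom_le)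

lemma tdeg_0 [simp]: "tdeg 0 = 0" by (simp add: tdeg_def Rep_twist_simps)

lemma tdeg_1 [simp]: "tdeg 1 = 0" by (simp add: tdeg_def Rep_twist_simps)

lemma tdeg_power: "tdeg (f ^ n) = n * tdeg f"
proof (cases "f = 0")
  case True then show ?thesis by (cases n) auto
next
  case False then show ?thesis by (induction n) (auto simp: tdeg_mult)
qed

section \<open>Polynomials acting on modules\<close>

text \<open>The target may be noncommutative. As a bare predicate the notion can be iterated:
  constants extend to A by the image of T, and A extends to A[X] by the Frobenius, with
  \<open>peval\<close> used both times.\<close>

definition is_rhom :: "('s::comm_ring_1 \<Rightarrow> 'r::ring_1) \<Rightarrow> bool" where
  "is_rhom c \<longleftrightarrow> c 1 = 1 \<and> (\<forall>x y. c (x + y) = c x + c y) \<and> (\<forall>x y. c (x * y) = c x * c y)"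

definition peval :: "('s::comm_ring_1 \<Rightarrow> 'r::ring_1) \<Rightarrow> 'r \<Rightarrow> 's poly \<Rightarrow> 'r" where
  "peval c x P = (\<Sum>i\<le>degree P. c (coeff P i) * x ^ i)"

lemma is_rhomD:
  assumes "is_rhom c"
  shows "c 1 = 1" "c (x + y) = c x + c y" "c (x * y) = c x * c y" "c 0 = 0" "c (- x) = - c x"
    "c (x - y) = c x - c y" "c (of_nat n) = of_nat n" "c (x ^ n) = c x ^ n"
proof -
  show 1: "c 1 = 1" "\<And>x y. c (x + y) = c x + c y" "\<And>x y. c (x * y) = c x * c y"
    using assms by (auto simp: is_rhom_def)
  show 0: "c 0 = 0" using 1(2)[of 0 0] by simp
  show m: "c (- x) = - c x" for x using 1(2)[of x "- x"] 0 by (simp add: add_eq_0_iff)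
  show "c (x - y) = c x - c y" using 1(2)[of x "- y"] m[of y] by simp
  show "c (of_nat n) = of_nat n" by (induction n) (auto simp: 1 0)
  show "c (x ^ n) = c x ^ n" by (induction n) (auto simp: 1)
qed

lemma is_rhom_sum: "is_rhom c \<Longrightarrow> c (\<Sum>i\<in>I. f i) = (\<Sum>i\<in>I. c (f i))"
  by (induction I rule: infinite_finite_induct) (auto simp: is_rhomD)

lemma peval_eq_sum:
  assumes "is_rhom c" "\<And>i. i \<ge> n \<Longrightarrow> coeff P i = 0"
  shows "peval c x P = (\<Sum>i<n. c (coeff P i) * x ^ i)"
proof -
  have "peval c x P = (\<Sum>i<max n (Suc (degree P)). c (coeff P i) * x ^ i)"
    unfolding peval_def by (rule sum.mono_neutral_left)
      (auto simp: coeff_eq_0 is_rhomD[OF assms(1)])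
  also have "\<dots> = (\<Sum>i<n. c (coeff P i) * x ^ i)"
    by (rule sum.mono_neutral_right) (auto simp: assms(2) is_rhomD[OF assms(1)] not_less)
  finally show ?thesis .
qed

lemma peval_const: "is_rhom c \<Longrightarrow> peval c x [:a:] = c a"
  by (simp add: peval_def)

lemma peval_0: "is_rhom c \<Longrightarrow> peval c x 0 = 0"
  by (simp add: peval_def is_rhomD)

lemma peval_pCons: 
  assumes "is_rhom c" and "\<And>s. c s * x = x * c s"
  shows "peval c x (pCons a P) = c a + x * peval c x P"
proof -
  have "peval c x (pCons a P) = (\<Sum>i<Suc (Suc (degree P)). c (coeff (pCons a P) i) * x ^ i)"
    by (rule peval_eq_sum[OF assms(1)])
      (metis Suc_le_eq degree_pCons_le coeff_eq_0 le_less_trans)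
  also have "\<dots> = c a + (\<Sum>i<Suc (degree P). c (coeff P i) * x ^ Suc i)"
    by (subst sum.lessThan_Suc_shift) simp
  also have "(\<Sum>i<Suc (degree P). c (coeff P i) * x ^ Suc i) = x * (\<Sum>i<Suc (degree P). c (coeff P i) * x ^ i)"
    by (simp only: sum_distrib_left power_Suc mult.assoc[symmetric] assms(2))
  also have "(\<Sum>i<Suc (degree P). c (coeff P i) * x ^ i) = peval c x P"
    by (rule peval_eq_sum[OF assms(1), symmetric]) (simp add: coeff_eq_0)
  finally show ?thesis .
qed

lemma peval_add:
  assumes "is_rhom c"
  shows "peval c x (P + R) = peval c x P + peval c x R"
proof -
  let ?n = "Suc (max (degree P) (degree R))"
  have "peval c x (P + R) = (\<Sum>i<?n. c (coeff (P + R) i) * x ^ i)"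
    by (rule peval_eq_sum[OF assms]) (simp add: coeff_eq_0)
  also have "\<dots> = (\<Sum>i<?n. c (coeff P i) * x ^ i) + (\<Sum>i<?n. c (coeff R i) * x ^ i)"
    by (simp only: coeff_add is_rhomD[OF assms] distrib_right sum.distrib)
  also have "(\<Sum>i<?n. c (coeff P i) * x ^ i) = peval c x P"
    by (rule peval_eq_sum[OF assms, symmetric]) (simp add: coeff_eq_0)
  also have "(\<Sum>i<?n. c (coeff R i) * x ^ i) = peval c x R"
    by (rule peval_eq_sum[OF assms, symmetric]) (simp add: coeff_eq_0)
  finally show ?thesis .
qed

lemma peval_smult: 
  assumes "is_rhom c"
  shows "peval c x (smult a P) = c a * peval c x P"
proof -
  have "peval c x (smult a P) = (\<Sum>i<Suc (degree P). c (coeff (smult a P) i) * x ^ i)"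
    by (rule peval_eq_sum[OF assms]) (simp add: coeff_eq_0)
  also have "\<dots> = c a * (\<Sum>i<Suc (degree P). c (coeff P i) * x ^ i)"
    by (simp add: is_rhomD[OF assms] sum_distrib_left mult.assoc distrib_left)
  also have "(\<Sum>i<Suc (degree P). c (coeff P i) * x ^ i) = peval c x P"
    by (rule peval_eq_sum[OF assms, symmetric]) (simp add: coeff_eq_0)
  finally show ?thesis .
qed

lemma is_rhom_peval:
  assumes c: "is_rhom c" and comm: "\<And>s. c s * x = x * c s"
  shows "is_rhom (peval c x)"
proof -
  have "peval c x (P * R) = peval c x P * peval c x R" for P R
  proof (induction P)
    case 0 then show ?case by (simp add: peval_0[OF c])
  next
    case (pCons a P)
    have "peval c x (pCons a P * R) = c a * peval c x R + x * (peval c x P * peval c x R)"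
      by (simp add: mult_pCons_left peval_add[OF c] peval_smult[OF c] peval_pCons[OF c comm] 
          pCons.IH is_rhomD[OF c])
    then show ?case by (simp add: peval_pCons[OF c comm] algebra_simps)
  qed
  moreover have "peval c x 1 = 1" by (simp add: peval_def is_rhomD[OF c])
  ultimately show ?thesis using peval_add[OF c] by (auto simp: is_rhom_def)
qed

lemma peval_X: "is_rhom c \<Longrightarrow> peval c x [:0, 1:] = x"
  by (simp add: peval_def is_rhomD)

lemma peval_commute:
  assumes "is_rhom c" "\<And>s. c s * y = y * c s" "x * y = y * x"
  shows "peval c x P * y = y * peval c x P"
proof -
  have "x ^ i * y = y * x ^ i" for i
  proof (induction i)
    case (Suc i)
    have "x ^ Suc i * y = x * (x ^ i * y)" by (simp add: mult.assoc)
    also have "\<dots> = x * y * x ^ i" by (simp add: Suc mult.assoc)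
    also have "\<dots> = y * x ^ Suc i" by (simp add: assms(3) mult.assoc)
    finally show ?case .
  qed simp
  then have "c s * x ^ i * y = y * (c s * x ^ i)" for s i
    by (metis assms(2) mult.assoc)
  then show ?thesis unfolding peval_def by (simp add: sum_distrib_left sum_distrib_right)
qed

section \<open>Modules given by an action, and the determinant trick\<close>

definition is_act :: "('s::comm_ring_1 \<Rightarrow> 'm::ab_group_add \<Rightarrow> 'm) \<Rightarrow> bool" where
  "is_act act \<longleftrightarrow> (\<forall>x y m. act (x + y) m = act x m + act y m) \<and>
     (\<forall>x m m'. act x (m + m') = act x m + act x m') \<and>
     (\<forall>x y m. act (x * y) m = act x (act y m)) \<and> (\<forall>m. act 1 m = m)"

lemma is_actD:
  assumes "is_act act"
  shows "act (x + y) m = act x m + act y m" "act x (m + m') = act x m + act x m'"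
    "act (x * y) m = act x (act y m)" "act 1 m = m" "act 0 m = 0" "act x 0 = 0"
    "act (- x) m = - act x m"
proof -
  show 1: "\<And>x y m. act (x + y) m = act x m + act y m" "\<And>x m m'. act x (m + m') = act x m + act x m'"
    "\<And>x y m. act (x * y) m = act x (act y m)" "\<And>m. act 1 m = m"
    using assms by (auto simp: is_act_def)
  show 0: "\<And>m. act 0 m = 0" using 1(1)[of 0 0] by simp
  show "act x 0 = 0" using 1(2)[of x 0 0] by simp
  show "act (- x) m = - act x m" using 1(1)[of x "- x" m] 0 by (simp add: add_eq_0_iff)
qed

lemma is_act_sum:
  assumes "is_act act"
  shows "act (\<Sum>i\<in>I. f i) m = (\<Sum>i\<in>I. act (f i) m)" "act x (\<Sum>i\<in>I. g i) = (\<Sum>i\<in>I. act x (g i))"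
  by (induction I rule: infinite_finite_induct) (auto simp: is_actD[OF assms])

text \<open>A module over S with a linear endomorphism u is a module over S[X], with X acting as u.
  Three such extensions in a row produce the ring of scalars of the determinant argument
  below.\<close>

definition pact :: "('s::comm_ring_1 \<Rightarrow> 'm::ab_group_add \<Rightarrow> 'm) \<Rightarrow> ('m \<Rightarrow> 'm) \<Rightarrow> 's poly \<Rightarrow> 'm \<Rightarrow> 'm" where
  "pact act u P m = (\<Sum>i\<le>degree P. act (coeff P i) ((u ^^ i) m))"

lemma pact_eq_sum:
  assumes "is_act act" "\<And>i. i \<ge> n \<Longrightarrow> coeff P i = 0"
  shows "pact act u P m = (\<Sum>i<n. act (coeff P i) ((u ^^ i) m))"
proof -
  have "pact act u P m = (\<Sum>i<max n (Suc (degree P)). act (coeff P i) ((u ^^ i) m))"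
    unfolding pact_def by (rule sum.mono_neutral_left)
      (auto simp: coeff_eq_0 is_actD[OF assms(1)])
  also have "\<dots> = (\<Sum>i<n. act (coeff P i) ((u ^^ i) m))"
    by (rule sum.mono_neutral_right) (auto simp: assms(2) is_actD[OF assms(1)] not_less)
  finally show ?thesis .
qed

lemma is_act_pact:
  assumes act: "is_act act" and add: "\<And>m m'. u (m + m') = u m + u m'"
    and comm: "\<And>s m. u (act s m) = act s (u m)"
  shows "is_act (pact act u)"
proof -
  have add_pow: "(u ^^ i) (m + m') = (u ^^ i) m + (u ^^ i) m'" for i m m'
    by (induction i) (auto simp: add)
  have u0: "u 0 = 0" using add[of 0 0] by simp
  have u_sum: "u (\<Sum>i\<in>I. f i) = (\<Sum>i\<in>I. u (f i))" for f :: "nat \<Rightarrow> _" and I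
    by (induction I rule: infinite_finite_induct) (auto simp: add u0)
  have padd: "pact act u (P + R) m = pact act u P m + pact act u R m" for P R m
  proof -
    let ?n = "Suc (max (degree P) (degree R))"
    have "pact act u (P + R) m = (\<Sum>i<?n. act (coeff (P + R) i) ((u ^^ i) m))"
      by (rule pact_eq_sum[OF act]) (simp add: coeff_eq_0)
    also have "\<dots> = (\<Sum>i<?n. act (coeff P i) ((u ^^ i) m)) + (\<Sum>i<?n. act (coeff R i) ((u ^^ i) m))"
      by (simp only: coeff_add is_actD[OF act] sum.distrib)
    also have "(\<Sum>i<?n. act (coeff P i) ((u ^^ i) m)) = pact act u P m"
      by (rule pact_eq_sum[OF act, symmetric]) (simp add: coeff_eq_0)
    also have "(\<Sum>i<?n. act (coeff R i) ((u ^^ i) m)) = pact act u R m"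
      by (rule pact_eq_sum[OF act, symmetric]) (simp add: coeff_eq_0)
    finally show ?thesis .
  qed
  have pmadd: "pact act u P (m + m') = pact act u P m + pact act u P m'" for P m m'
    by (simp add: pact_def add_pow is_actD[OF act] sum.distrib)
  have smult: "pact act u (smult a P) m = act a (pact act u P m)" for a P m
  proof -
    have "pact act u (smult a P) m = (\<Sum>i<Suc (degree P). act (coeff (smult a P) i) ((u ^^ i) m))"
      by (rule pact_eq_sum[OF act]) (simp add: coeff_eq_0)
    also have "\<dots> = act a (\<Sum>i<Suc (degree P). act (coeff P i) ((u ^^ i) m))"
      by (simp add: is_actD[OF act] is_act_sum[OF act])
    also have "(\<Sum>i<Suc (degree P). act (coeff P i) ((u ^^ i) m)) = pact act u P m"
      by (rule pact_eq_sum[OF act, symmetric]) (simp add: coeff_eq_0)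
    finally show ?thesis .
  qed
  have cons: "pact act u (pCons a P) m = act a m + u (pact act u P m)" for a P m
  proof -
    have "pact act u (pCons a P) m = (\<Sum>i<Suc (Suc (degree P)). act (coeff (pCons a P) i) ((u ^^ i) m))"
      by (rule pact_eq_sum[OF act])
        (metis Suc_le_eq degree_pCons_le coeff_eq_0 le_less_trans)
    also have "\<dots> = act a m + u (\<Sum>i<Suc (degree P). act (coeff P i) ((u ^^ i) m))"
      by (subst sum.lessThan_Suc_shift) (simp add: u_sum comm add)
    also have "(\<Sum>i<Suc (degree P). act (coeff P i) ((u ^^ i) m)) = pact act u P m"
      by (rule pact_eq_sum[OF act, symmetric]) (simp add: coeff_eq_0)
    finally show ?thesis .
  qed
  have "pact act u (P * R) m = pact act u P (pact act u R m)" for P R m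
  proof (induction P)
    case 0 then show ?case by (simp add: pact_def is_actD[OF act])
  next
    case (pCons a P)
    then show ?case
      by (simp add: mult_pCons_left padd smult cons is_actD[OF act])
  qed
  moreover have "pact act u 1 m = m" for m by (simp add: pact_def is_actD[OF act])
  ultimately show ?thesis by (auto simp: is_act_def padd pmadd)
qed

text \<open>Multiplying the relations by the adjugate matrix leaves the determinant on the diagonal
  and zero elsewhere. The \<open>e j\<close> are arbitrary elements of the module.\<close>

lemma det_kills:
  assumes act: "is_act act" and B: "B \<in> carrier_mat n n"
    and kills: "\<And>i. i < n \<Longrightarrow> (\<Sum>j<n. act (B $$ (i, j)) (e j)) = 0" and l: "l < n"
  shows "act (det B) (e l) = 0"
proof -
  note adj = adj_mat[OF B]
  have entry: "(\<Sum>i<n. adj_mat B $$ (l, i) * B $$ (i, j)) = (if l = j then det B else 0)" if "j < n" for j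
  proof -
    have "(adj_mat B * B) $$ (l, j) = (\<Sum>i<n. adj_mat B $$ (l, i) * B $$ (i, j))"
      using adj(1) B l that by (simp add: scalar_prod_def atLeast0LessThan)
    then show ?thesis unfolding adj(3) using l that by (cases "l = j") auto
  qed
  have "0 = (\<Sum>i<n. act (adj_mat B $$ (l, i)) (\<Sum>j<n. act (B $$ (i, j)) (e j)))"
    by (simp add: kills is_actD[OF act])
  also have "\<dots> = (\<Sum>i<n. \<Sum>j<n. act (adj_mat B $$ (l, i) * B $$ (i, j)) (e j))"
    by (simp add: is_act_sum[OF act] is_actD[OF act])
  also have "\<dots> = (\<Sum>j<n. act (\<Sum>i<n. adj_mat B $$ (l, i) * B $$ (i, j)) (e j))"
    by (subst sum.swap) (simp add: is_act_sum[OF act])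
  also have "\<dots> = (\<Sum>j<n. if l = j then act (det B) (e l) else 0)"
    by (intro sum.cong) (auto simp: entry is_actD[OF act])
  also have "\<dots> = act (det B) (e l)" using l by simp
  finally show ?thesis by simp
qed

text \<open>Cayley-Hamilton for an endomorphism described on a family of elements that may be
  dependent: over S[X] the matrix X - N annihilates the family, so its determinant does.\<close>

lemma char_poly_kills:
  assumes act: "is_act act" and add: "\<And>m m'. u (m + m') = u m + u m'"
    and comm: "\<And>s m. u (act s m) = act s (u m)"
    and N: "N \<in> carrier_mat n n"
    and u: "\<And>i. i < n \<Longrightarrow> u (e i) = (\<Sum>j<n. act (N $$ (i, j)) (e j))" and l: "l < n"
  shows "pact act u (char_poly N) (e l) = 0"
  unfolding char_poly_def
proof (rule det_kills[OF is_act_pact[OF act add comm] _ _ l])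
  note pa = is_act_pact[of act u, OF act add comm]
  show "char_poly_matrix N \<in> carrier_mat n n" using N by simp
  fix i assume i: "i < n"
  have entry: "char_poly_matrix N $$ (i, j) = [:0, 1:] * (if i = j then 1 else 0) + [:- N $$ (i, j):]"
    if "j < n" for j using N i that by (simp add: char_poly_matrix_def)
  have X: "pact act u [:0, 1:] m = u m" for m by (simp add: pact_def is_actD[OF act])
  have C: "pact act u [:s:] m = act s m" for s m by (simp add: pact_def)
  have "(\<Sum>j<n. pact act u (char_poly_matrix N $$ (i, j)) (e j)) =
    (\<Sum>j<n. (if i = j then u (e j) else 0) - act (N $$ (i, j)) (e j))"
  proof (intro sum.cong refl)
    fix j assume "j \<in> {..<n}"
    then have j: "j < n" by simp
    show "pact act u (char_poly_matrix N $$ (i, j)) (e j) =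
      (if i = j then u (e j) else 0) - act (N $$ (i, j)) (e j)"
      unfolding entry[OF j] is_actD(1)[OF pa] is_actD(3)[OF pa] C is_actD(7)[OF act]
      using add[of 0 0] by (simp add: X is_actD(4,5)[OF pa])
  qed
  also have "\<dots> = u (e i) - (\<Sum>j<n. act (N $$ (i, j)) (e j))"
    using i by (simp add: sum_subtractf)
  finally show "(\<Sum>j<n. pact act u (char_poly_matrix N $$ (i, j)) (e j)) = 0"
    using u[OF i] by simp
qed

section \<open>Residue fields\<close>

interpretation ac_hom: field_hom to_ac
  by unfold_locales auto

interpretation ac_poly_hom: map_poly_inj_idom_hom to_ac ..

text \<open>For a root \<theta> of p this is the reduction from A to A/p, realised inside the
  closure of F_q; its range is the residue field.\<close>

definition ev :: "'a::{finite,field_gcd} alg_closure \<Rightarrow> 'a poly \<Rightarrow> 'a alg_closure" where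
  "ev \<theta> a = poly (map_poly to_ac a) \<theta>"

lemma ev_simps [simp]:
  "ev \<theta> 0 = 0" "ev \<theta> 1 = 1" "ev \<theta> (a + b) = ev \<theta> a + ev \<theta> b" "ev \<theta> (a * b) = ev \<theta> a * ev \<theta> b"
  "ev \<theta> (- a) = - ev \<theta> a" "ev \<theta> (a - b) = ev \<theta> a - ev \<theta> b" "ev \<theta> (a ^ n) = ev \<theta> a ^ n"
  "ev \<theta> [:x:] = to_ac x" "ev \<theta> (smult x a) = to_ac x * ev \<theta> a" "ev \<theta> [:0, 1:] = \<theta>"
  by (simp_all add: ev_def ac_hom.map_poly_hom_smult ac_poly_hom.hom_mult ac_poly_hom.hom_power
      ac_poly_hom.hom_uminus ac_poly_hom.hom_minus hom_distribs)

lemma ev_sum: "ev \<theta> (\<Sum>i\<in>I. f i) = (\<Sum>i\<in>I. ev \<theta> (f i))"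
  by (induction I rule: infinite_finite_induct) auto

lemma card_polys_less:
  "finite {a :: 'a::{finite,field_gcd} poly. \<forall>i\<ge>n. coeff a i = 0}"
  "card {a :: 'a::{finite,field_gcd} poly. \<forall>i\<ge>n. coeff a i = 0} = card (UNIV :: 'a set) ^ n"
proof -
  let ?S = "{a :: 'a poly. \<forall>i\<ge>n. coeff a i = 0}"
  have bij: "bij_betw (\<lambda>a. restrict (coeff a) {..<n}) ?S (PiE {..<n} (\<lambda>_. UNIV))"
  proof (rule bij_betwI')
    fix a b assume ab: "a \<in> ?S" "b \<in> ?S"
    show "(restrict (coeff a) {..<n} = restrict (coeff b) {..<n}) = (a = b)"
    proof
      assume eq: "restrict (coeff a) {..<n} = restrict (coeff b) {..<n}"
      show "a = b"
      proof (rule poly_eqI)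
        fix i show "coeff a i = coeff b i"
          using ab fun_cong[OF eq, of i] by (cases "i < n") (auto simp: not_less)
      qed
    qed simp
  next
    fix g :: "nat \<Rightarrow> 'a" assume g: "g \<in> PiE {..<n} (\<lambda>_. UNIV)"
    have "restrict (coeff (\<Sum>i<n. monom (g i) i)) {..<n} = g"
      by (rule ext) (use g in \<open>auto simp: coeff_sum PiE_def extensional_def\<close>)
    moreover have "(\<Sum>i<n. monom (g i) i) \<in> ?S" by (auto simp: coeff_sum)
    ultimately show "\<exists>a\<in>?S. g = restrict (coeff a) {..<n}"
      by (intro bexI[of _ "\<Sum>i<n. monom (g i) i"]) simp_all
  qed auto
  have "finite (PiE {..<n} (\<lambda>_. UNIV :: 'a set))" by (intro finite_PiE) auto
  then show "finite ?S" using bij_betw_finite[OF bij] by simp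
  show "card ?S = card (UNIV :: 'a set) ^ n"
    using bij_betw_same_card[OF bij] by (simp add: card_PiE)
qed

locale residue_field =
  fixes p :: "'a::{finite,field_gcd} poly" and \<theta> :: "'a alg_closure" and q :: nat
  assumes q_card: "q = card (UNIV :: 'a set)" and prime_p: "prime p" and ev_p: "ev \<theta> p = 0"
begin

abbreviation "d \<equiv> degree p"
abbreviation "KK \<equiv> range (ev \<theta>)"

lemma q_gt_1: "q > 1" and q_pos: "q > 0"
  using card_UNIV_gt_1[where 'a = 'a] q_card by auto

lemmas pow_sum = ac_power_sum[where 'a = 'a, folded q_card]
lemmas card_polys = card_polys_less[where 'a = 'a, folded q_card]
lemmas power_q_self = power_card_UNIV_eq_self[where 'a = 'a, folded q_card]
lemmas tmonom_mult_q = tmonom_mult[where 'a = 'a, folded q_card]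
lemmas tcoeff_mult_q = tcoeff_mult[where 'a = 'a, folded q_card]

lemma p_nonzero: "p \<noteq> 0" and d_pos: "d > 0"
proof -
  show "p \<noteq> 0" using prime_p by auto
  then show "d > 0" using prime_p by (metis is_unit_iff_degree not_prime_unit neq0_conv)
qed

lemma ev_eq_0_iff: "ev \<theta> a = 0 \<longleftrightarrow> p dvd a"
proof
  assume "p dvd a"
  then show "ev \<theta> a = 0" using ev_p by (auto elim!: dvdE)
next
  assume a: "ev \<theta> a = 0"
  show "p dvd a"
  proof (rule ccontr)
    assume "\<not> p dvd a"
    then have "coprime p a" using prime_p prime_imp_coprime by blast
    then obtain x y where "x * p + y * a = 1"
      by (metis bezout_coefficients_fst_snd coprime_imp_gcd_eq_1)
    then have "ev \<theta> (x * p + y * a) = 1" by simp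
    then show False using a ev_p by simp
  qed
qed

lemma ev_eq_iff: "ev \<theta> a = ev \<theta> b \<longleftrightarrow> p dvd a - b"
  using ev_eq_0_iff[of "a - b"] by simp

lemma ev_mod [simp]: "ev \<theta> (a mod p) = ev \<theta> a"
  unfolding ev_eq_iff by (metis mod_eq_dvd_iff mod_mod_trivial)

lemma mod_p_eq_iff: "a mod p = a \<longleftrightarrow> (\<forall>i\<ge>d. coeff a i = 0)"
proof
  assume "a mod p = a"
  then have "a = 0 \<or> degree a < d" using degree_mod_less[OF p_nonzero, of a] by auto
  then show "\<forall>i\<ge>d. coeff a i = 0" by (auto intro: coeff_eq_0)
next
  assume "\<forall>i\<ge>d. coeff a i = 0"
  then have "a = 0 \<or> degree a < d" by (meson leading_coeff_0_iff not_le)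
  then show "a mod p = a" by (auto simp: mod_poly_less)
qed

lemma ev_inj_reduced: "a mod p = a \<Longrightarrow> b mod p = b \<Longrightarrow> ev \<theta> a = ev \<theta> b \<longleftrightarrow> a = b"
  unfolding ev_eq_iff by (metis mod_eq_dvd_iff)

lemma KK_eq: "KK = ev \<theta> ` {a. \<forall>i\<ge>d. coeff a i = 0}"
proof -
  have "ev \<theta> a \<in> ev \<theta> ` {a. a mod p = a}" for a
    using ev_mod[of a] by (metis (mono_tags, lifting) imageI mem_Collect_eq mod_mod_trivial)
  then show ?thesis unfolding mod_p_eq_iff[symmetric] by auto
qed

lemma finite_KK: "finite KK" and card_KK: "card KK = q ^ d"
proof -
  have "inj_on (ev \<theta>) {a. \<forall>i\<ge>d. coeff a i = 0}"
    unfolding mod_p_eq_iff[symmetric] by (auto intro!: inj_onI simp: ev_inj_reduced)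
  then show "finite KK" "card KK = q ^ d"
    unfolding KK_eq by (simp_all add: card_image card_polys)
qed

lemma KK_closed:
  "0 \<in> KK" "1 \<in> KK" "x \<in> KK \<Longrightarrow> y \<in> KK \<Longrightarrow> x * y \<in> KK" "to_ac c \<in> KK"
proof -
  show "0 \<in> KK" using rangeI[of "ev \<theta>" 0] by simp
  show "1 \<in> KK" using rangeI[of "ev \<theta>" 1] by simp
  show "to_ac c \<in> KK" using rangeI[of "ev \<theta>" "[:c:]"] by simp
  assume "x \<in> KK" "y \<in> KK"
  then obtain a b where "x = ev \<theta> a" "y = ev \<theta> b" by blast
  then show "x * y \<in> KK" using rangeI[of "ev \<theta>" "a * b"] by simp
qed

lemma KK_inverse: "x \<in> KK \<Longrightarrow> x \<noteq> 0 \<Longrightarrow> \<exists>y\<in>KK. x * y = 1"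
proof -
  assume "x \<in> KK" "x \<noteq> 0"
  then obtain a where a: "x = ev \<theta> a" "\<not> p dvd a" using ev_eq_0_iff by auto
  then have "coprime p a" using prime_p prime_imp_coprime by blast
  then obtain u v where "u * p + v * a = 1"
    by (metis bezout_coefficients_fst_snd coprime_imp_gcd_eq_1)
  then have "ev \<theta> (u * p + v * a) = 1" by simp
  then have "x * ev \<theta> v = 1" using ev_p a by (simp add: mult.commute)
  then show ?thesis by blast
qed

lemma KK_power: assumes "x \<in> KK" shows "x ^ (q ^ d) = x"
proof (cases "x = 0")
  case True then show ?thesis using q_pos by (simp add: zero_power)
next
  case False
  obtain y where y: "y \<in> KK" "x * y = 1" using KK_inverse[OF assms False] by blast
  note cl = KK_closed(3)
  have "bij_betw ((*) x) (KK - {0}) (KK - {0})"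
    by (rule bij_betw_byWitness[of _ "\<lambda>z. z * y"])
      (use False y assms cl in \<open>auto simp: mult.assoc mult.commute mult.left_commute\<close>)
  then have "(\<Prod>y\<in>KK - {0}. x * y) = (\<Prod>y\<in>KK - {0}. y)"
    by (rule prod.reindex_bij_betw)
  moreover have "(\<Prod>y\<in>KK - {0}. y) \<noteq> 0" using finite_KK by simp
  ultimately have "x ^ card (KK - {0}) = 1"
    by (simp add: prod.distrib)
  then have "x ^ Suc (card (KK - {0})) = x" by simp
  moreover have "0 \<in> KK" by (rule KK_closed)
  then have "Suc (card (KK - {0})) = card KK"
    by (rule card_Suc_Diff1[OF finite_KK])
  ultimately show ?thesis unfolding card_KK by simp
qed

text \<open>An element outside \<open>KK\<close> would be one root too many for X^(q^d) - X.\<close>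

lemma KK_iff: "x \<in> KK \<longleftrightarrow> x ^ (q ^ d) = x"
proof
  assume "x ^ (q ^ d) = x"
  show "x \<in> KK"
  proof (rule ccontr)
    assume "x \<notin> KK"
    have Q: "q ^ d > 1" using q_gt_1 d_pos by (rule one_less_power)
    let ?f = "monom 1 (q ^ d) - [:0, 1:] :: 'a alg_closure poly"
    have "degree ?f \<le> q ^ d" using Q by (intro degree_diff_le) (auto simp: degree_monom_le)
    moreover have "card (insert x KK) = Suc (q ^ d)"
      using \<open>x \<notin> KK\<close> finite_KK card_KK by simp
    ultimately have "?f = 0"
      by (intro poly_eq_0_if_vanishes[of "insert x KK"])
        (use finite_KK KK_power \<open>x ^ (q ^ d) = x\<close> in \<open>auto simp: poly_monom\<close>)
    then have "coeff ?f 1 = 0" by simp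
    then show False using Q q_gt_1 d_pos by (auto split: if_splits)
  qed
qed (rule KK_power)

lemma Fq_iff: "x \<in> range to_ac \<longleftrightarrow> x ^ q = x" for x :: "'a alg_closure"
proof
  assume "x ^ q = x"
  show "x \<in> range to_ac"
  proof (rule ccontr)
    assume "x \<notin> range to_ac"
    let ?f = "monom 1 q - [:0, 1:] :: 'a alg_closure poly"
    have "degree ?f \<le> q" using q_gt_1 by (intro degree_diff_le) (auto simp: degree_monom_le)
    moreover have "card (insert x (range to_ac)) = Suc q"
      using \<open>x \<notin> range to_ac\<close> card_image[OF inj_to_ac[where 'a = 'a]] finite_imageI[of "UNIV :: 'a set" to_ac]
      by (simp add: q_card)
    ultimately have "?f = 0"
      by (intro poly_eq_0_if_vanishes[of "insert x (range to_ac)"])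
        (use \<open>x ^ q = x\<close> in \<open>auto simp: poly_monom to_ac_power[symmetric] power_q_self simp del: to_ac_power\<close>)
    then have "coeff ?f 1 = 0" by simp
    then show False using q_gt_1 by auto
  qed
next
  assume "x \<in> range to_ac"
  then show "x ^ q = x" by (metis imageE power_q_self to_ac_power)
qed

text \<open>The trace form on the residue field, normalised to be 1 at 1. The exponents run over
  1..d rather than 0..d-1, which makes no difference on the residue field.\<close>
lemma ex_trace:
  "\<exists>D. (\<exists>c\<in>KK. \<forall>x\<in>KK. to_ac (D x :: 'a) = (\<Sum>l=1..d. (c * x) ^ (q ^ l))) \<and> D 1 = 1 \<and> D 0 = 0"
proof -
  let ?tr = "\<lambda>x::'a alg_closure. \<Sum>l=1..d. x ^ (q ^ l)"
  \<comment> \<open>The q-th power shifts the exponents by one, and \<open>KK_power\<close> turns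
    the last term back into the first, so the trace is fixed by the Frobenius of F_q.\<close>
  have tr_Fq: "?tr x \<in> range to_ac" if "x \<in> KK" for x
  proof -
    have "?tr x ^ (q ^ 1) = (\<Sum>l=1..d. (x ^ (q ^ l)) ^ (q ^ 1))"
      by (rule pow_sum)
    also have "\<dots> = (\<Sum>l=1..d. x ^ (q ^ Suc l))"
      by (simp add: power_mult[symmetric] mult.commute)
    also have "\<dots> = (\<Sum>l=Suc 1..Suc d. x ^ (q ^ l))"
      by (rule sum.shift_bounds_cl_Suc_ivl[symmetric])
    also have "\<dots> = (\<Sum>l=Suc 1..d. x ^ (q ^ l)) + x ^ (q ^ Suc d)"
      using d_pos by (intro sum.cl_ivl_Suc[THEN trans]) auto
    also have "x ^ (q ^ Suc d) = (x ^ (q ^ d)) ^ (q ^ 1)"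
      by (simp add: power_mult[symmetric] mult.commute)
    also have "\<dots> = x ^ (q ^ 1)" using KK_power[OF that] by simp
    also have "(\<Sum>l=Suc 1..d. x ^ (q ^ l)) + x ^ (q ^ 1) = ?tr x"
      using d_pos by (subst sum.atLeast_Suc_atMost[of 1 d]) auto
    finally show ?thesis unfolding Fq_iff by simp
  qed
  \<comment> \<open>On \<open>KK\<close> the trace is the q-th power of an additive polynomial of
    degree q^(d-1), too small to vanish at all q^d elements.\<close>
  have "\<exists>x\<in>KK. ?tr x \<noteq> 0"
  proof (rule ccontr)
    assume neg: "\<not> ?thesis"
    let ?f = "\<Sum>l<d. monom 1 (q ^ l) :: 'a alg_closure poly"
    have "poly ?f x = 0" if "x \<in> KK" for x
    proof -
      have x: "x ^ q ^ d = x" using KK_power[OF that] .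
      have "?tr x = (\<Sum>l<d. x ^ (q ^ Suc l))"
        by (simp add: sum.atLeast1_atMost_eq)
      also have "\<dots> = (\<Sum>l<d. x ^ (q ^ l)) ^ (q ^ 1)"
        unfolding pow_sum by (simp add: power_mult[symmetric] mult.commute)
      finally have "(\<Sum>l<d. x ^ (q ^ l)) ^ (q ^ 1) = 0" using neg that by auto
      then show ?thesis by (simp add: poly_sum poly_monom)
    qed
    moreover have "degree ?f < q ^ d"
    proof (rule degree_sum_less)
      fix l assume "l \<in> {..<d}"
      then have "q ^ l < q ^ d" using q_gt_1 by (simp add: power_strict_increasing)
      then show "degree (monom (1::'a alg_closure) (q ^ l)) < q ^ d" by (simp add: degree_monom_eq)
    qed (use q_pos in auto)
    ultimately have "?f = 0"
      using card_KK finite_KK by (intro poly_eq_0_if_vanishes[of KK]) auto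
    then have "coeff ?f 1 = 0" by simp
    moreover have "coeff ?f 1 = (\<Sum>l<d. if l = 0 then 1 else 0)"
      unfolding coeff_sum using q_gt_1 by (intro sum.cong) auto
    ultimately show False using d_pos by simp
  qed
  then obtain x where x: "x \<in> KK" "?tr x \<noteq> 0" by blast
  from tr_Fq[OF x(1)] obtain a where a: "?tr x = to_ac a" by blast
  with x have "a \<noteq> 0" by auto
  \<comment> \<open>Division by the trace a, an element of F_q, gives an element of trace 1. Hence D
    1 = 1, which will keep monic polynomials monic when D is applied to their coefficients.\<close>
  define l where "l = x * to_ac (inverse a)"
  have ia: "to_ac (inverse a) \<in> KK" by (rule KK_closed)
  note cl = KK_closed(3)
  have l: "l \<in> KK" unfolding l_def using x ia cl by blast
  have ip: "to_ac (inverse a) ^ (q ^ i) = to_ac (inverse a)" for i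
    by (induction i) (simp_all add: power_mult to_ac_power[symmetric] power_q_self 
        del: to_ac_power to_ac_inverse)
  have "?tr l = (\<Sum>i=1..d. x ^ (q ^ i) * to_ac (inverse a))"
    unfolding l_def power_mult_distrib ip ..
  also have "\<dots> = ?tr x * to_ac (inverse a)" by (simp add: sum_distrib_right)
  also have "\<dots> = 1" using a \<open>a \<noteq> 0\<close> by simp
  finally have l1: "?tr l = 1" .
  have "\<exists>D. \<forall>x. (x \<in> KK \<longrightarrow> to_ac (D x) = ?tr (l * x)) "
    using tr_Fq cl[OF l] by (intro choice) (metis imageE)
  then obtain D where D: "\<And>x. x \<in> KK \<Longrightarrow> to_ac (D x) = ?tr (l * x)" by blast
  have "1 \<in> KK" "0 \<in> KK" by (rule KK_closed)+
  then have "to_ac (D 1) = to_ac 1" "to_ac (D 0) = to_ac 0"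
    using D l1 q_pos by (simp_all add: zero_power)
  then have "D 1 = 1" "D 0 = 0" by simp_all
  with D l show ?thesis by blast
qed

end

lemma ex_residue_field:
  assumes "prime (p :: 'a::{finite,field_gcd} poly)"
  shows "\<exists>\<theta>. residue_field p \<theta> (card (UNIV :: 'a set))"
proof -
  have "degree p \<noteq> 0" using assms by (metis is_unit_iff_degree not_prime_0 not_prime_unit)
  then have "degree (map_poly to_ac p) > 0" by simp
  then obtain \<theta> where "poly (map_poly to_ac p) \<theta> = 0"
    using alg_closed_imp_poly_has_root by blast
  then have "residue_field p \<theta> (card (UNIV :: 'a set))" using assms by unfold_locales (auto simp: ev_def)
  then show ?thesis ..
qed

section \<open>Endomorphisms of the reduced module\<close>

definition cst :: "'a::{finite,field_gcd} \<Rightarrow> 'a twist" where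
  "cst a = tmonom (to_ac a) 0"

lemma tmonom_mult_0: "tmonom a 0 * tmonom b i = tmonom (a * b) i"
  by (simp add: tmonom_mult)

lemma is_rhom_cst: "is_rhom cst"
  by (simp add: is_rhom_def cst_def tmonom_add tmonom_mult_0)

lemma tcoeff_tmonom_mult:
  "tcoeff (tmonom c i * f :: 'a::{finite,field_gcd} twist) k =
    (if i \<le> k then c * tcoeff f (k - i) ^ (card (UNIV :: 'a set) ^ i) else 0)"
proof -
  have "tcoeff (tmonom c i * f) k = 
    (\<Sum>j\<le>k. if j = i then c * tcoeff f (k - i) ^ (card (UNIV :: 'a set) ^ i) else 0)"
    unfolding tcoeff_mult by (intro sum.cong) auto
  then show ?thesis by simp
qed

lemma tcoeff_mult_tmonom_1:
  "tcoeff (f * tmonom 1 i :: 'a::{finite,field_gcd} twist) k = (if i \<le> k then tcoeff f (k - i) else 0)"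
proof -
  have q: "card (UNIV :: 'a set) > 0" using card_UNIV_gt_1[where 'a = 'a] by simp
  have "tcoeff (f * tmonom 1 i) k = (\<Sum>j\<le>k. if i \<le> k \<and> j = k - i then tcoeff f (k - i) else 0)"
    unfolding tcoeff_mult using q by (intro sum.cong) (auto simp: zero_power)
  then show ?thesis by auto
qed

lemma cst_power_q: "to_ac (a::'a::{finite,field_gcd}) ^ (card (UNIV :: 'a set) ^ i) = to_ac a"
  by (induction i) (simp_all add: power_mult to_ac_power[symmetric] power_card_UNIV_eq_self del: to_ac_power)

lemma cst_commute: "cst a * f = f * cst a"
proof (rule twist_eqI)
  fix k
  have q: "card (UNIV :: 'a set) > 0" using card_UNIV_gt_1[where 'a = 'a] by simp
  have "tcoeff (f * cst a) k = (\<Sum>j\<le>k. if j = k then tcoeff f k * to_ac a else 0)"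
    unfolding tcoeff_mult using q
    by (intro sum.cong) (auto simp: cst_def cst_power_q zero_power)
  then show "tcoeff (cst a * f) k = tcoeff (f * cst a) k"
    by (simp add: cst_def tcoeff_tmonom_mult)
qed

lemma pact_commute:
  assumes "\<And>m m'. v (m + m') = v m + v m'" "\<And>s m. v (act s m) = act s (v m)"
    "\<And>m. v (u m) = u (v m)"
  shows "v (pact act u P m) = pact act u P (v m)"
proof -
  have v0: "v 0 = 0" using assms(1)[of 0 0] by simp
  have v_sum: "v (\<Sum>i\<in>I. f i) = (\<Sum>i\<in>I. v (f i))" for f :: "nat \<Rightarrow> _" and I
    by (induction I rule: infinite_finite_induct) (auto simp: assms v0)
  have "v ((u ^^ i) m) = (u ^^ i) (v m)" for i by (induction i) (auto simp: assms)
  then show ?thesis by (simp add: pact_def v_sum assms)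
qed

lemma pact_const: "pact act u [:s:] m = act s m"
  by (simp add: pact_def)

lemma pact_X: "is_act act \<Longrightarrow> pact act u [:0, 1:] m = u m"
  by (simp add: pact_def is_actD)

lemma pact_pCons:
  assumes act: "is_act act" and add: "\<And>m m'. u (m + m') = u m + u m'"
    and comm: "\<And>s m. u (act s m) = act s (u m)"
  shows "pact act u (pCons a P) m = act a m + u (pact act u P m)"
proof -
  note pa = is_act_pact[of act u, OF act add comm]
  have "pCons a P = [:a:] + [:0, 1:] * P" by simp
  then show ?thesis
    by (simp only: is_actD(1,3)[OF pa] pact_const pact_X[OF act])
qed

text \<open>\<Phi> is the reduction of phi_T; its constant coefficient \<theta> is the image of T in
  the residue field.\<close>

locale reduced_module = residue_field p \<theta> q
  for p :: "'a::{finite,field_gcd} poly" and \<theta> q +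
  fixes \<Phi> :: "'a twist" and r :: nat
  assumes \<Phi>_0: "tcoeff \<Phi> 0 = \<theta>" and \<Phi>_deg: "tdeg \<Phi> = r" and r_pos: "r \<ge> 1"
    and \<Phi>_KK: "\<And>k. tcoeff \<Phi> k \<in> KK"
begin

abbreviation "fr \<equiv> tmonom (1 :: 'a alg_closure) d"

lemma fr_nonzero: "fr \<noteq> 0" by simp

text \<open>Passing tau^d over a coefficient raises it to the power q^d, and \<open>KK\<close>
  consists of the fixed points of this power.\<close>

lemma fr_commute_iff: "f * fr = fr * f \<longleftrightarrow> (\<forall>k. tcoeff f k \<in> KK)"
proof
  assume *: "f * fr = fr * f"
  show "\<forall>k. tcoeff f k \<in> KK"
  proof
    fix k
    have "tcoeff (f * fr) (k + d) = tcoeff (fr * f) (k + d)" using * by simp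
    then show "tcoeff f k \<in> KK"
      by (simp add: KK_iff tcoeff_mult_tmonom_1 tcoeff_tmonom_mult q_card)
  qed
next
  assume *: "\<forall>k. tcoeff f k \<in> KK"
  show "f * fr = fr * f"
  proof (rule twist_eqI)
    fix k
    show "tcoeff (f * fr) k = tcoeff (fr * f) k"
      using KK_power[of "tcoeff f (k - d)"] * 
      by (auto simp: tcoeff_mult_tmonom_1 tcoeff_tmonom_mult q_card)
  qed
qed

text \<open>Commuting with tau^d means having coefficients in the residue field. Commuting with
  \<Phi> means commuting with the whole image of A, because constants from F_q are central.\<close>

definition EE :: "'a twist set" where
  "EE = {f. f * \<Phi> = \<Phi> * f \<and> f * fr = fr * f}"

definition Ev :: "'a poly \<Rightarrow> 'a twist" where
  "Ev = peval cst \<Phi>"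

lemma Ev_hom: "is_rhom Ev"
  unfolding Ev_def by (rule is_rhom_peval[OF is_rhom_cst cst_commute])

lemmas Ev_simps = is_rhomD[OF Ev_hom]

lemma Ev_X: "Ev [:0, 1:] = \<Phi>"
  unfolding Ev_def by (rule peval_X[OF is_rhom_cst])

lemma Ev_const: "Ev [:a:] = cst a"
  unfolding Ev_def by (rule peval_const[OF is_rhom_cst])

lemma \<Phi>_fr: "\<Phi> * fr = fr * \<Phi>"
  unfolding fr_commute_iff using \<Phi>_KK by blast

lemma Ev_commute: "f \<in> EE \<Longrightarrow> Ev a * f = f * Ev a"
  unfolding Ev_def EE_def by (intro peval_commute[OF is_rhom_cst cst_commute]) auto

lemma EE_comm_\<Phi>: "f \<in> EE \<Longrightarrow> f * \<Phi> = \<Phi> * f" and EE_comm_fr: "f \<in> EE \<Longrightarrow> f * fr = fr * f"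
  by (auto simp: EE_def)

lemma EE_closed:
  "f \<in> EE \<Longrightarrow> g \<in> EE \<Longrightarrow> f + g \<in> EE" "f \<in> EE \<Longrightarrow> g \<in> EE \<Longrightarrow> f - g \<in> EE"
  "f \<in> EE \<Longrightarrow> g \<in> EE \<Longrightarrow> f * g \<in> EE" "fr \<in> EE" "1 \<in> EE" "0 \<in> EE" "f \<in> EE \<Longrightarrow> - f \<in> EE"
proof -
  assume f: "f \<in> EE"
  then show "- f \<in> EE" by (simp add: EE_def)
  assume g: "g \<in> EE"
  show "f + g \<in> EE" "f - g \<in> EE" using f g by (auto simp: EE_def algebra_simps)
  have "f * g * x = x * (f * g)" if "f * x = x * f" "g * x = x * g" for x
    by (metis that mult.assoc)
  then show "f * g \<in> EE" using f g by (auto simp: EE_def)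
qed (auto simp: EE_def \<Phi>_fr)

lemma EE_power: "f \<in> EE \<Longrightarrow> f ^ n \<in> EE"
  by (induction n) (auto intro: EE_closed)

lemma EE_sum: "(\<And>i. i \<in> I \<Longrightarrow> f i \<in> EE) \<Longrightarrow> (\<Sum>i\<in>I. f i) \<in> EE"
  by (induction I rule: infinite_finite_induct) (auto intro: EE_closed)

lemma \<Phi>_EE: "\<Phi> \<in> EE" using \<Phi>_fr by (simp add: EE_def)

lemma cst_EE: "cst a \<in> EE" by (simp add: EE_def cst_commute)

lemma Ev_EE: "Ev a \<in> EE"
  unfolding Ev_def peval_def by (intro EE_sum EE_closed EE_power cst_EE \<Phi>_EE)

lemma evP_hom: "f \<in> EE \<Longrightarrow> is_rhom (peval Ev f)"
  by (rule is_rhom_peval[OF Ev_hom Ev_commute])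

lemma evP_EE: "f \<in> EE \<Longrightarrow> peval Ev f P \<in> EE"
  unfolding peval_def by (intro EE_sum EE_closed EE_power Ev_EE)

section \<open>A module over (A/p)[T] with r generators\<close>

abbreviation C :: "'a poly \<Rightarrow> 'a twist" where "C a \<equiv> tmonom (ev \<theta> a) 0"

text \<open>Scalars act from the left and T from the right through \<Phi>, so that the two commute.
  The scalars are written as elements of A but act through their residues \<open>C a\<close>, which
  are not the \<open>Ev a\<close>. The point of using (A/p)[T] is the number r of generators; over A
  alone it would be r d.\<close>

definition act1 :: "'a poly poly \<Rightarrow> 'a twist \<Rightarrow> 'a twist" where
  "act1 = pact (\<lambda>a m. C a * m) (\<lambda>m. m * \<Phi>)"

lemma act0: "is_act (\<lambda>a m. C a * m)"
  by (simp add: is_act_def tmonom_add distrib_left distrib_right mult.assoc[symmetric] tmonom_mult_0)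

lemma act1: "is_act act1"
  unfolding act1_def by (rule is_act_pact[OF act0]) (auto simp: algebra_simps)

lemma act1_const: "act1 [:a:] m = C a * m" by (simp add: act1_def pact_def)

lemma act1_X: "act1 [:0, 1:] m = m * \<Phi>" unfolding act1_def by (rule pact_X[OF act0])

lemma act1_eq_sum:
  assumes "\<And>j. j \<ge> J \<Longrightarrow> coeff c j = 0"
  shows "act1 c m = (\<Sum>j<J. C (coeff c j) * (m * \<Phi> ^ j))"
proof -
  have "((\<lambda>m. m * \<Phi>) ^^ j) m = m * \<Phi> ^ j" for j
    by (induction j) (auto simp: mult.assoc power_commutes)
  then show ?thesis unfolding act1_def using pact_eq_sum[OF act0 assms] by simp
qed

definition generated :: "'a twist \<Rightarrow> bool" where
  "generated f \<longleftrightarrow> (\<exists>c. f = (\<Sum>j<r. act1 (c j) (tmonom 1 j)))"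

lemma generated_add: "generated f \<Longrightarrow> generated g \<Longrightarrow> generated (f + g)"
proof -
  assume "generated f" "generated g"
  then obtain c c' where "f = (\<Sum>j<r. act1 (c j) (tmonom 1 j))" "g = (\<Sum>j<r. act1 (c' j) (tmonom 1 j))"
    unfolding generated_def by blast
  then have "f + g = (\<Sum>j<r. act1 (c j + c' j) (tmonom 1 j))"
    by (simp add: is_actD[OF act1] sum.distrib)
  then show ?thesis unfolding generated_def by (intro exI[of _ "\<lambda>j. c j + c' j"])
qed

lemma generated_act1: "generated f \<Longrightarrow> generated (act1 b f)"
proof -
  assume "generated f"
  then obtain c where "f = (\<Sum>j<r. act1 (c j) (tmonom 1 j))"
    unfolding generated_def by blast
  then have "act1 b f = (\<Sum>j<r. act1 (b * c j) (tmonom 1 j))"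
    by (simp add: is_actD[OF act1] is_act_sum[OF act1])
  then show ?thesis unfolding generated_def by (intro exI[of _ "\<lambda>j. b * c j"])
qed

lemma generated_tmonom_less: "j < r \<Longrightarrow> generated (tmonom 1 j)"
proof -
  assume "j < r"
  then have "tmonom 1 j = (\<Sum>i<r. act1 (if i = j then 1 else 0) (tmonom 1 i))"
    by (simp add: if_distrib[of act1] if_distrib[of "\<lambda>f. f _"] is_actD[OF act1] cong: if_cong)
  then show ?thesis unfolding generated_def by (intro exI[of _ "\<lambda>i. if i = j then 1 else 0"])
qed

lemma generated_0: "generated 0"
  unfolding generated_def by (intro exI[of _ "\<lambda>_. 0"]) (simp add: is_actD[OF act1])

lemma generated_sum: "(\<And>i. i \<in> I \<Longrightarrow> generated (f i)) \<Longrightarrow> generated (\<Sum>i\<in>I. f i)"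
  by (induction I rule: infinite_finite_induct) (auto intro: generated_add generated_0)

lemma generated_scale: "x \<in> KK \<Longrightarrow> generated f \<Longrightarrow> generated (tmonom x 0 * f)"
  using generated_act1[of f "[:a:]" for a] by (auto simp: act1_const)

lemma KK_power_closed: "x \<in> KK \<Longrightarrow> x ^ n \<in> KK"
  by (induction n) (auto intro: KK_closed simp del: image_iff)

text \<open>The product of tau^(k-r) and \<Phi> has as leading term a nonzero element of the residue
  field times tau^k. Its other terms, and tau^(k-r) itself, have smaller exponents.\<close>

lemma generated_tmonom: "generated (tmonom 1 k)"
proof (induction k rule: less_induct)
  case (less k)
  show ?case
  proof (cases "k < r")
    case False
    then have k: "k \<ge> r" by simp
    let ?x = "\<lambda>i. tcoeff \<Phi> i ^ (q ^ (k - r))"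
    have xK: "?x i \<in> KK" for i using \<Phi>_KK KK_power_closed by blast
    have "tmonom 1 (k - r) * \<Phi> = (\<Sum>i\<le>r. tmonom 1 (k - r) * tmonom (tcoeff \<Phi> i) i)"
      by (subst twist_decomp) (simp add: \<Phi>_deg sum_distrib_left)
    also have "\<dots> = (\<Sum>i\<le>r. tmonom (?x i) 0 * tmonom 1 (k - r + i))"
      by (simp add: tmonom_mult_q tmonom_mult_0)
    also have "\<dots> = (\<Sum>i<r. tmonom (?x i) 0 * tmonom 1 (k - r + i)) + tmonom (?x r) 0 * tmonom 1 k"
      using k by (simp add: lessThan_Suc_atMost[symmetric])
    finally have eq': "tmonom 1 (k - r) * \<Phi> =
      (\<Sum>i<r. tmonom (?x i) 0 * tmonom 1 (k - r + i)) + tmonom (?x r) 0 * tmonom 1 k" .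
    have m1: "tmonom (- 1) 0 = (- 1 :: 'a twist)" by (rule twist_eqI) simp
    have eq: "tmonom (?x r) 0 * tmonom 1 k =
      tmonom 1 (k - r) * \<Phi> + (\<Sum>i<r. tmonom (- 1) 0 * (tmonom (?x i) 0 * tmonom 1 (k - r + i)))"
      unfolding eq' m1 by (simp add: sum_negf)
    have "\<Phi> \<noteq> 0" using \<Phi>_deg r_pos by auto
    then have "?x r \<noteq> 0" using tcoeff_tdeg_eq_0_iff[of \<Phi>] \<Phi>_deg by simp
    then obtain y where y: "y \<in> KK" "?x r * y = 1" using KK_inverse[OF xK] by blast
    have "generated (tmonom 1 (k - r) * \<Phi>)"
      using generated_act1[OF less.IH, of "k - r" "[:0, 1:]"] k r_pos by (simp add: act1_X)
    moreover have "- 1 \<in> KK" using rangeI[of "ev \<theta>" "- 1"] by simp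
    ultimately have "generated (tmonom (?x r) 0 * tmonom 1 k)"
      unfolding eq using less.IH xK k
      by (intro generated_add generated_sum generated_scale) auto
    then have "generated (tmonom y 0 * (tmonom (?x r) 0 * tmonom 1 k))"
      using y generated_scale by blast
    also have "tmonom y 0 * (tmonom (?x r) 0 * tmonom 1 k) = tmonom 1 k"
      using y by (simp add: tmonom_mult_0 mult.commute)
    finally show ?thesis .
  qed (rule generated_tmonom_less)
qed

lemma generated_KK:
  assumes "\<And>k. tcoeff f k \<in> KK"
  shows "generated f"
proof -
  have "f = (\<Sum>i\<le>tdeg f. tmonom (tcoeff f i) 0 * tmonom 1 i)"
    by (subst twist_decomp) (simp add: tmonom_mult_0)
  also have "generated \<dots>" using assms by (intro generated_sum generated_scale generated_tmonom) auto
  finally show ?thesis .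
qed

lemma generated_commuting: "f * fr = fr * f \<Longrightarrow> generated f"
  using generated_KK fr_commute_iff by blast

text \<open>Multiplying the relation for d - l by tau^l on the left conjugates its coefficients and
  completes tau^(d - l) to tau^d, which can be cancelled; the conjugates add up to the trace.\<close>
lemma trace_descent:
  assumes "\<And>i. i \<in> I \<Longrightarrow> x i \<in> KK" "\<And>i. i \<in> I \<Longrightarrow> h i * fr = fr * h i"
    and rel: "\<And>l. (\<Sum>i\<in>I. tmonom (x i) 0 * (tmonom 1 l * h i)) = 0"
    and c: "c \<in> KK" and D: "\<And>x. x \<in> KK \<Longrightarrow> to_ac (D x) = (\<Sum>l=1..d. (c * x) ^ (q ^ l))"
  shows "(\<Sum>i\<in>I. cst (D (x i)) * h i) = 0"
proof -
  have conj: "(\<Sum>i\<in>I. tmonom ((c * x i) ^ (q ^ l)) 0 * h i) = 0" if l: "l \<le> d" for l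
  proof -
    have "0 = tmonom 1 l * (tmonom c 0 * (\<Sum>i\<in>I. tmonom (x i) 0 * (tmonom 1 (d - l) * h i)))"
      by (simp add: rel)
    also have "\<dots> = (\<Sum>i\<in>I. tmonom 1 l * tmonom c 0 * tmonom (x i) 0 * tmonom 1 (d - l) * h i)"
      by (simp add: sum_distrib_left mult.assoc)
    also have "\<dots> = (\<Sum>i\<in>I. tmonom ((c * x i) ^ (q ^ l)) 0 * (fr * h i))"
      using l by (simp add: tmonom_mult_q power_mult_distrib mult.assoc[symmetric])
    also have "\<dots> = (\<Sum>i\<in>I. tmonom ((c * x i) ^ (q ^ l)) 0 * h i) * fr"
      using assms(2) by (simp add: sum_distrib_right mult.assoc)
    finally have "(\<Sum>i\<in>I. tmonom ((c * x i) ^ (q ^ l)) 0 * h i) * fr = 0" by (rule sym)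
    then show ?thesis using fr_nonzero by simp
  qed
  have "(\<Sum>i\<in>I. cst (D (x i)) * h i) = (\<Sum>i\<in>I. \<Sum>l=1..d. tmonom ((c * x i) ^ (q ^ l)) 0 * h i)"
    by (intro sum.cong refl) (simp add: cst_def D assms(1) tmonom_sum sum_distrib_right)
  also have "\<dots> = (\<Sum>l=1..d. \<Sum>i\<in>I. tmonom ((c * x i) ^ (q ^ l)) 0 * h i)"
    by (rule sum.swap)
  also have "\<dots> = 0" using conj by (intro sum.neutral) auto
  finally show ?thesis .
qed


text \<open>The twisted polynomials with coefficients in the residue field are generated over
  A[T] by the powers of tau below r (A on the left, T through Phi on the right). The determinant
  trick, applied over dual numbers (t acts with square zero) to right multiplication by
  beta + t gamma, gives the characteristic polynomial and its derivative at once; the trace then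
  brings the coefficients down to A.\<close>
theorem char_poly_and_derivative:
  assumes b: "\<beta> \<in> EE" and c: "\<gamma> \<in> EE" and comm: "\<beta> * \<gamma> = \<gamma> * \<beta>"
  shows "\<exists>m g. degree m = r \<and> coeff m r = 1 \<and> peval Ev \<beta> m = 0 \<and>
    \<gamma> * peval Ev \<beta> (pderiv m) = peval Ev \<beta> g"
proof -
  define a0 :: "'a poly \<Rightarrow> 'a twist \<times> 'a twist \<Rightarrow> 'a twist \<times> 'a twist" where
    "a0 = (\<lambda>a z. (C a * fst z, C a * snd z))"
  define uT :: "'a twist \<times> 'a twist \<Rightarrow> 'a twist \<times> 'a twist" where "uT = (\<lambda>z. (fst z * \<Phi>, snd z * \<Phi>))"
  \<comment> \<open>A pair (m0, m1) stands for m0 + t m1 with t^2 = 0. Then \<open>ut\<close> is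
    multiplication by t, and \<open>uX\<close> is right multiplication by \<beta> + t
    \<gamma>.\<close>
  define ut :: "'a twist \<times> 'a twist \<Rightarrow> 'a twist \<times> 'a twist" where "ut = (\<lambda>z. (0, fst z))"
  define uX where "uX = (\<lambda>z. (fst z * \<beta>, snd z * \<beta> + fst z * \<gamma>))"
  define a1 where "a1 = pact a0 uT"
  define a2 where "a2 = pact a1 ut"
  define a3 where "a3 = pact a2 uX"
  have A0: "is_act a0"
    unfolding is_act_def a0_def
    by (auto simp: prod_eq_iff tmonom_add distrib_left distrib_right mult.assoc[symmetric] tmonom_mult_0)
  have addT: "uT (z + z') = uT z + uT z'" for z z' by (simp add: uT_def distrib_right)
  have addt: "ut (z + z') = ut z + ut z'" for z z' by (simp add: ut_def)
  have addX: "uX (z + z') = uX z + uX z'" for z z' by (simp add: uX_def algebra_simps)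
  have T0: "uT (a0 s z) = a0 s (uT z)" for s z by (simp add: uT_def a0_def mult.assoc)
  have t0: "ut (a0 s z) = a0 s (ut z)" for s z by (simp add: ut_def a0_def)
  have tT: "ut (uT z) = uT (ut z)" for z by (simp add: ut_def uT_def)
  have X0: "uX (a0 s z) = a0 s (uX z)" for s z by (simp add: uX_def a0_def mult.assoc distrib_left)
  have XT: "uX (uT z) = uT (uX z)" for z
    using EE_comm_\<Phi>[OF b] EE_comm_\<Phi>[OF c] by (simp add: uX_def uT_def mult.assoc distrib_right)
  have Xt: "uX (ut z) = ut (uX z)" for z by (simp add: uX_def ut_def)
  have A1: "is_act a1" unfolding a1_def by (rule is_act_pact[of a0 uT, OF A0 addT T0])
  have t1: "ut (a1 s z) = a1 s (ut z)" for s z unfolding a1_def by (rule pact_commute[of ut a0 uT, OF addt t0 tT])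
  have X1: "uX (a1 s z) = a1 s (uX z)" for s z unfolding a1_def by (rule pact_commute[of uX a0 uT, OF addX X0 XT])
  have A2: "is_act a2" unfolding a2_def by (rule is_act_pact[of a1 ut, OF A1 addt t1])
  have X2: "uX (a2 s z) = a2 s (uX z)" for s z unfolding a2_def by (rule pact_commute[of uX a1 ut, OF addX X1 Xt])
  have A3: "is_act a3" unfolding a3_def by (rule is_act_pact[of a2 uX, OF A2 addX X2])
  have a1_pair: "a1 P z = (act1 P (fst z), act1 P (snd z))" for P z
  proof -
    have pw: "(uT ^^ i) z = (((\<lambda>m. m * \<Phi>) ^^ i) (fst z), ((\<lambda>m. m * \<Phi>) ^^ i) (snd z))" for i
      by (induction i) (auto simp: uT_def)
    show ?thesis unfolding a1_def act1_def pact_def pw a0_def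
      by (simp add: prod_eq_iff fst_sum snd_sum)
  qed
  \<comment> \<open>As t^2 = 0, only the two lowest coefficients in t act.\<close>
  have a2_pair: "a2 P (m0, m1) = (act1 (coeff P 0) m0, act1 (coeff P 0) m1 + act1 (coeff P 1) m0)" for P m0 m1
  proof -
    obtain x P1 where P: "P = pCons x P1" by (rule pCons_cases)
    obtain y P2 where P1: "P1 = pCons y P2" by (rule pCons_cases)
    show ?thesis unfolding P P1 a2_def
      unfolding pact_pCons[of a1 ut, OF A1 addt t1] a1_pair by (simp add: ut_def)
  qed
  have gen: "\<exists>cf. \<forall>i. tmonom 1 i * f = (\<Sum>j<r. act1 (cf i j) (tmonom 1 j))" if "f \<in> EE" for f
  proof -
    have "generated (tmonom 1 i * f)" for i
    proof (rule generated_commuting)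
      have "tmonom 1 i * fr = fr * tmonom (1 :: 'a alg_closure) i" by (simp add: tmonom_mult add.commute)
      then show "tmonom 1 i * f * fr = fr * (tmonom 1 i * f)"
        using EE_comm_fr[OF that] by (metis mult.assoc)
    qed
    then have "\<forall>i. \<exists>cf. tmonom 1 i * f = (\<Sum>j<r. act1 (cf j) (tmonom 1 j))"
      unfolding generated_def by blast
    then show ?thesis by (rule choice)
  qed
  obtain cb where cb: "\<And>i. tmonom 1 i * \<beta> = (\<Sum>j<r. act1 (cb i j) (tmonom 1 j))" using gen[OF b] by blast
  obtain cc where cc: "\<And>i. tmonom 1 i * \<gamma> = (\<Sum>j<r. act1 (cc i j) (tmonom 1 j))" using gen[OF c] by blast
  \<comment> \<open>Row i holds the coordinates of tau^i (\<beta> + t \<gamma>), so N describes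
    \<open>uX\<close> on the family \<open>e\<close>.\<close>
  define N where "N = mat r r (\<lambda>(i, j). [:cb i j, cc i j:])"
  define e :: "nat \<Rightarrow> 'a twist \<times> 'a twist" where "e = (\<lambda>i. (tmonom 1 i, 0))"
  have N: "N \<in> carrier_mat r r" by (simp add: N_def)
  define P where "P = char_poly N"
  have degP: "degree P = r" "coeff P r = 1" unfolding P_def using degree_monic_char_poly[OF N] by auto
  have kill_lt: "a3 P (e l) = 0" if "l < r" for l
    unfolding a3_def P_def
  proof (rule char_poly_kills[of a2 uX, OF A2 addX X2 N _ that])
    fix i assume i: "i < r"
    have "(\<Sum>j<r. a2 (N $$ (i, j)) (e j)) =
      (\<Sum>j<r. (act1 (cb i j) (tmonom 1 j), act1 (cc i j) (tmonom 1 j)))"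
      using i by (intro sum.cong) (auto simp: N_def e_def a2_pair is_actD[OF act1])
    also have "\<dots> = uX (e i)"
      by (simp add: prod_eq_iff fst_sum snd_sum uX_def e_def cb cc)
    finally show "uX (e i) = (\<Sum>j<r. a2 (N $$ (i, j)) (e j))" by simp
  qed
  \<comment> \<open>Every power of tau is a combination of the first r, and the operator given by P
    commutes with scalars.\<close>
  have kill: "a3 P (tmonom 1 l, 0) = 0" for l
  proof -
    obtain cf where cf: "tmonom 1 l = (\<Sum>j<r. act1 (cf j) (tmonom 1 j))"
      using generated_tmonom[of l] unfolding generated_def by blast
    have "a3 [:[:cf j:]:] (e j) = (act1 (cf j) (tmonom 1 j), 0)" for j
      unfolding a3_def pact_const a2_pair e_def by (simp add: is_actD[OF act1])
    then have "(tmonom 1 l, 0) = (\<Sum>j<r. a3 [:[:cf j:]:] (e j))"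
      by (simp add: prod_eq_iff fst_sum snd_sum cf[symmetric])
    then have "a3 P (tmonom 1 l, 0) = (\<Sum>j<r. a3 [:[:cf j:]:] (a3 P (e j)))"
      by (simp only: is_act_sum[OF A3] is_actD(3)[OF A3, symmetric] mult.commute)
    also have "\<dots> = 0" using kill_lt by (simp add: is_actD[OF A3])
    finally show ?thesis .
  qed
  \<comment> \<open>Since \<beta> and \<gamma> commute, the i-th power of \<beta> + t \<gamma> has
    the t-part i \<beta>^(i-1) \<gamma>. This is the source of the derivative.\<close>
  have uX_pow: "(uX ^^ i) (m, 0) = (m * \<beta> ^ i, m * (of_nat i * \<beta> ^ (i - 1) * \<gamma>))" for i m
  proof (induction i)
    case (Suc i)
    have key: "of_nat i * \<beta> ^ (i - 1) * \<gamma> * \<beta> = of_nat i * \<beta> ^ i * \<gamma>"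
    proof (cases i)
      case (Suc i')
      have "\<beta> ^ i' * \<gamma> * \<beta> = \<beta> ^ i' * (\<beta> * \<gamma>)" by (simp only: mult.assoc comm)
      also have "\<dots> = \<beta> ^ Suc i' * \<gamma>" by (simp only: power_Suc2 mult.assoc)
      finally show ?thesis unfolding Suc by (simp only: diff_Suc_1 mult.assoc)
    qed simp
    have "(uX ^^ Suc i) (m, 0) = (m * \<beta> ^ i * \<beta>, m * (of_nat i * \<beta> ^ (i - 1) * \<gamma>) * \<beta> + m * \<beta> ^ i * \<gamma>)"
      by (simp add: Suc.IH) (simp add: uX_def)
    also have "m * (of_nat i * \<beta> ^ (i - 1) * \<gamma>) * \<beta> = m * (of_nat i * \<beta> ^ i * \<gamma>)"
      by (simp only: mult.assoc[of m] key)
    also have "m * (of_nat i * \<beta> ^ i * \<gamma>) + m * \<beta> ^ i * \<gamma> = m * (of_nat (Suc i) * \<beta> ^ (Suc i - 1) * \<gamma>)"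
      by (simp add: distrib_left distrib_right mult.assoc)
    finally show ?case by (simp only: power_Suc2 mult.assoc)
  qed simp
  \<comment> \<open>A common bound for the T-degrees of all coefficients, so that both relations
    become sums over one rectangle of indices.\<close>
  define J where "J = Suc (Max ((\<lambda>i. max (degree (coeff (coeff P i) 0)) (degree (coeff (coeff P i) 1))) ` {..r}))"
  have J: "coeff (coeff (coeff P i) 0) j = 0" "coeff (coeff (coeff P i) 1) j = 0" if "i \<le> r" "j \<ge> J" for i j
  proof -
    have "max (degree (coeff (coeff P i) 0)) (degree (coeff (coeff P i) 1)) < J"
      unfolding J_def less_Suc_eq_le using that by (intro Max_ge) auto
    then show "coeff (coeff (coeff P i) 0) j = 0" "coeff (coeff (coeff P i) 1) j = 0"
      using that by (auto intro: coeff_eq_0)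
  qed
  define h where "h = (\<lambda>(i, j). \<beta> ^ i * \<Phi> ^ j)"
  define h' where "h' = (\<lambda>(i, j). of_nat i * \<beta> ^ (i - 1) * \<gamma> * \<Phi> ^ j)"
  define x where "x = (\<lambda>(i, j). ev \<theta> (coeff (coeff (coeff P i) 0) j))"
  define y where "y = (\<lambda>(i, j). ev \<theta> (coeff (coeff (coeff P i) 1) j))"
  let ?I = "{..r} \<times> {..<J}"
  have sum0: "act1 (coeff (coeff P i) 0) (tmonom 1 l * f) =
    (\<Sum>j<J. tmonom (x (i, j)) 0 * (tmonom 1 l * (f * \<Phi> ^ j)))" if "i \<le> r" for i l f
    using that J by (subst act1_eq_sum[of J]) (auto simp: x_def mult.assoc)
  have sum1: "act1 (coeff (coeff P i) 1) (tmonom 1 l * f) =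
    (\<Sum>j<J. tmonom (y (i, j)) 0 * (tmonom 1 l * (f * \<Phi> ^ j)))" if "i \<le> r" for i l f
    using that J by (subst act1_eq_sum[of J]) (auto simp: y_def mult.assoc)
  have P_sum: "(\<Sum>i\<le>r. a2 (coeff P i) ((uX ^^ i) (tmonom 1 l, 0))) = 0" for l
    using kill[of l] unfolding a3_def pact_def degP by simp
  \<comment> \<open>The first component of \<open>P_sum\<close> is the equation of \<beta>; the
    second one, in \<open>rel1\<close>, is its derivative in the direction of \<gamma>. Both hold
    after inserting any power of tau, as the descent by the trace requires.\<close>
  have rel0: "(\<Sum>i\<in>?I. tmonom (x i) 0 * (tmonom 1 l * h i)) = 0" for l
  proof -
    have "(\<Sum>i\<in>?I. tmonom (x i) 0 * (tmonom 1 l * h i)) =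
      (\<Sum>i\<le>r. \<Sum>j<J. tmonom (x (i, j)) 0 * (tmonom 1 l * (\<beta> ^ i * \<Phi> ^ j)))"
      unfolding h_def sum.cartesian_product by (intro sum.cong) auto
    also have "\<dots> = (\<Sum>i\<le>r. act1 (coeff (coeff P i) 0) (tmonom 1 l * \<beta> ^ i))"
      by (intro sum.cong refl sum0[symmetric]) auto
    also have "\<dots> = fst (\<Sum>i\<le>r. a2 (coeff P i) ((uX ^^ i) (tmonom 1 l, 0)))"
      by (simp add: fst_sum uX_pow a2_pair)
    finally show ?thesis by (simp add: P_sum)
  qed
  have rel1: "(\<Sum>i\<in>?I. tmonom (x i) 0 * (tmonom 1 l * h' i)) +
    (\<Sum>i\<in>?I. tmonom (y i) 0 * (tmonom 1 l * h i)) = 0" for l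
  proof -
    have "(\<Sum>i\<in>?I. tmonom (x i) 0 * (tmonom 1 l * h' i)) + (\<Sum>i\<in>?I. tmonom (y i) 0 * (tmonom 1 l * h i)) =
      (\<Sum>i\<le>r. \<Sum>j<J. tmonom (x (i, j)) 0 * (tmonom 1 l * (of_nat i * \<beta> ^ (i - 1) * \<gamma> * \<Phi> ^ j))) +
      (\<Sum>i\<le>r. \<Sum>j<J. tmonom (y (i, j)) 0 * (tmonom 1 l * (\<beta> ^ i * \<Phi> ^ j)))"
      unfolding h_def h'_def sum.cartesian_product by (intro arg_cong2[of _ _ _ _ "(+)"] sum.cong) auto
    also have "\<dots> = (\<Sum>i\<le>r. act1 (coeff (coeff P i) 0) (tmonom 1 l * (of_nat i * \<beta> ^ (i - 1) * \<gamma>))) +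
      (\<Sum>i\<le>r. act1 (coeff (coeff P i) 1) (tmonom 1 l * \<beta> ^ i))"
      by (intro arg_cong2[of _ _ _ _ "(+)"] sum.cong refl sum0[symmetric] sum1[symmetric]) auto
    also have "\<dots> = snd (\<Sum>i\<le>r. a2 (coeff P i) ((uX ^^ i) (tmonom 1 l, 0)))"
      by (simp add: snd_sum uX_pow a2_pair sum.distrib)
    finally show ?thesis by (simp add: P_sum)
  qed
  obtain D :: "'a alg_closure \<Rightarrow> 'a" and k where k: "k \<in> KK"
    and D: "\<And>x. x \<in> KK \<Longrightarrow> to_ac (D x) = (\<Sum>l=1..d. (k * x) ^ (q ^ l))" and D1: "D 1 = 1" "D 0 = 0"
    using ex_trace by blast
  have of_nat_EE: "of_nat i \<in> EE" for i by (induction i) (auto intro: EE_closed)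
  have hE: "h i \<in> EE" "h' i \<in> EE" for i
    unfolding h_def h'_def by (auto split: prod.split intro!: EE_closed EE_power b c \<Phi>_EE of_nat_EE)
  have xyK: "x i \<in> KK" "y i \<in> KK" for i unfolding x_def y_def by (auto split: prod.split)
  have R0: "(\<Sum>i\<in>?I. cst (D (x i)) * h i) = 0"
    by (rule trace_descent[OF _ _ rel0 k D]) (use xyK hE EE_comm_fr in auto)
  have R1: "(\<Sum>i\<in>?I. cst (D (x i)) * h' i) + (\<Sum>i\<in>?I. cst (D (y i)) * h i) = 0"
  proof -
    \<comment> \<open>\<open>trace_descent\<close> takes a single family, so the two sums are joined
      over a disjoint union of index sets.\<close>
    let ?x = "case_sum x y" and ?h = "case_sum h' h"
    have fin: "finite ?I" by simp
    have "(\<Sum>i\<in>?I <+> ?I. cst (D (?x i)) * ?h i) = 0"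
    proof (rule trace_descent[OF _ _ _ k D])
      fix l show "(\<Sum>i\<in>?I <+> ?I. tmonom (?x i) 0 * (tmonom 1 l * ?h i)) = 0"
        using rel1[of l] by (simp add: sum.Plus[OF fin fin])
    qed (use xyK hE EE_comm_fr in \<open>auto split: sum.split\<close>)
    then show ?thesis by (simp add: sum.Plus[OF fin fin])
  qed
  \<comment> \<open>The normalised trace, applied to coefficients, leads from (A/p)[T] back to
    F_q[T] = A.\<close>
  define dm where "dm = (\<lambda>c. map_poly (\<lambda>a. D (ev \<theta> a)) c)"
  have dm_co: "coeff (dm c) j = D (ev \<theta> (coeff c j))" for c j
    unfolding dm_def by (rule coeff_map_poly) (simp add: D1)
  define m where "m = (\<Sum>i\<le>r. monom (dm (coeff (coeff P i) 0)) i)"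
  define g where "g = (\<Sum>i\<le>r. monom (dm (coeff (coeff P i) 1)) i)"
  have m_co: "coeff m i = (if i \<le> r then dm (coeff (coeff P i) 0) else 0)" for i
    unfolding m_def by (simp add: coeff_sum)
  have g_co: "coeff g i = (if i \<le> r then dm (coeff (coeff P i) 1) else 0)" for i
    unfolding g_def by (simp add: coeff_sum)
  have "coeff m r = 1"
  proof (rule poly_eqI)
    fix j show "coeff (coeff m r) j = coeff 1 j" by (simp add: m_co degP dm_co D1)
  qed
  moreover have "degree m \<le> r" by (rule degree_le) (simp add: m_co)
  ultimately have mr: "degree m = r" "coeff m r = 1"
    by (auto intro!: antisym le_degree)
  have Ev0: "Ev (coeff m i) = (\<Sum>j<J. cst (D (x (i, j))) * \<Phi> ^ j)" if "i \<le> r" for i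
    unfolding Ev_def using that J
    by (subst peval_eq_sum[OF is_rhom_cst, of J]) (auto simp: m_co dm_co D1 x_def)
  have Ev1: "Ev (coeff g i) = (\<Sum>j<J. cst (D (y (i, j))) * \<Phi> ^ j)" if "i \<le> r" for i
    unfolding Ev_def using that J
    by (subst peval_eq_sum[OF is_rhom_cst, of J]) (auto simp: g_co dm_co D1 y_def)
  have flip: "(\<Sum>j<J. cst (z j) * \<Phi> ^ j) * f = (\<Sum>j<J. cst (z j) * (f * \<Phi> ^ j))" if "f \<in> EE" for z f
  proof -
    have "\<Phi> ^ j * f = f * \<Phi> ^ j" for j
      by (rule power_commuting_commutes) (use EE_comm_\<Phi>[OF that] in simp)
    then show ?thesis by (simp add: sum_distrib_right mult.assoc)
  qed
  have "peval Ev \<beta> m = (\<Sum>i\<le>r. Ev (coeff m i) * \<beta> ^ i)" by (simp add: peval_def mr)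
  also have "\<dots> = (\<Sum>i\<le>r. \<Sum>j<J. cst (D (x (i, j))) * (\<beta> ^ i * \<Phi> ^ j))"
    by (intro sum.cong refl) (simp add: Ev0 flip EE_power b)
  also have "\<dots> = (\<Sum>i\<in>?I. cst (D (x i)) * h i)"
    unfolding h_def sum.cartesian_product by (intro sum.cong) auto
  finally have m0: "peval Ev \<beta> m = 0" using R0 by simp
  have "peval Ev \<beta> g = (\<Sum>i<Suc r. Ev (coeff g i) * \<beta> ^ i)"
    by (rule peval_eq_sum[OF Ev_hom]) (simp add: g_co)
  also have "\<dots> = (\<Sum>i\<le>r. \<Sum>j<J. cst (D (y (i, j))) * (\<beta> ^ i * \<Phi> ^ j))"
    unfolding lessThan_Suc_atMost by (intro sum.cong refl) (simp add: Ev1 flip EE_power b)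
  also have "\<dots> = (\<Sum>i\<in>?I. cst (D (y i)) * h i)"
    unfolding h_def sum.cartesian_product by (intro sum.cong) auto
  finally have g1: "peval Ev \<beta> g = (\<Sum>i\<in>?I. cst (D (y i)) * h i)" .
  have "peval Ev \<beta> (pderiv m) = (\<Sum>i<r. Ev (coeff (pderiv m) i) * \<beta> ^ i)"
    by (rule peval_eq_sum[OF Ev_hom]) (simp add: coeff_pderiv coeff_eq_0 mr)
  also have "\<dots> = (\<Sum>i<r. of_nat (Suc i) * Ev (coeff m (Suc i)) * \<beta> ^ i)"
    by (simp add: coeff_pderiv Ev_simps del: of_nat_Suc)
  also have "\<dots> = (\<Sum>i\<le>r. of_nat i * Ev (coeff m i) * \<beta> ^ (i - 1))"
    by (simp add: lessThan_Suc_atMost[symmetric] sum.lessThan_Suc_shift del: of_nat_Suc sum.lessThan_Suc)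
  finally have "\<gamma> * peval Ev \<beta> (pderiv m) = (\<Sum>i\<le>r. \<gamma> * (of_nat i * Ev (coeff m i) * \<beta> ^ (i - 1)))"
    by (simp add: sum_distrib_left)
  also have "\<dots> = (\<Sum>i\<le>r. Ev (coeff m i) * (of_nat i * \<beta> ^ (i - 1) * \<gamma>))"
  proof (intro sum.cong refl)
    fix i
    have "of_nat i * \<beta> ^ (i - 1) * \<gamma> = \<gamma> * (of_nat i * \<beta> ^ (i - 1))"
      by (metis comm mult.assoc mult_of_nat_commute power_commuting_commutes)
    moreover have "\<gamma> * (of_nat i * Ev (coeff m i) * \<beta> ^ (i - 1)) = Ev (coeff m i) * (\<gamma> * (of_nat i * \<beta> ^ (i - 1)))"
      by (metis Ev_commute[OF c] mult.assoc mult_of_nat_commute)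
    ultimately show "\<gamma> * (of_nat i * Ev (coeff m i) * \<beta> ^ (i - 1)) = Ev (coeff m i) * (of_nat i * \<beta> ^ (i - 1) * \<gamma>)"
      by simp
  qed
  also have "\<dots> = (\<Sum>i\<le>r. \<Sum>j<J. cst (D (x (i, j))) * (of_nat i * \<beta> ^ (i - 1) * \<gamma> * \<Phi> ^ j))"
    by (intro sum.cong refl) (simp add: Ev0 flip EE_closed EE_power of_nat_EE b c)
  also have "\<dots> = (\<Sum>i\<in>?I. cst (D (x i)) * h' i)"
    unfolding h'_def sum.cartesian_product by (intro sum.cong) auto
  also have "\<dots> = - peval Ev \<beta> g" using R1 unfolding g1 by (simp add: add_eq_0_iff2)
  also have "\<dots> = peval Ev \<beta> (- g)" by (simp add: is_rhomD[OF evP_hom[OF b]])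
  finally have "\<gamma> * peval Ev \<beta> (pderiv m) = peval Ev \<beta> (- g)" .
  with mr m0 show ?thesis by blast
qed

end

lemma tdeg_add_eq_right: "tdeg f < tdeg g \<Longrightarrow> tdeg (f + g) = tdeg g"
  by (simp add: tdeg_def Rep_twist_simps degree_add_eq_right)

lemma tdeg_tmonom: "c \<noteq> 0 \<Longrightarrow> tdeg (tmonom c i) = i"
  by (simp add: tdeg_def tmonom_def Abs_twist_inverse degree_monom_eq)

section \<open>The degree of relations of the Frobenius over A\<close>

context reduced_module begin

abbreviation evP :: "'a poly poly \<Rightarrow> 'a twist" where "evP \<equiv> peval Ev fr"

lemmas evP_simps = is_rhomD[OF evP_hom[OF EE_closed(4)]]

lemma evP_const: "evP [:a:] = Ev a" by (rule peval_const[OF Ev_hom])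

lemma evP_smult: "evP (smult a P) = Ev a * evP P" by (rule peval_smult[OF Ev_hom])

lemma evP_pCons: "evP (pCons a P) = Ev a + fr * evP P"
  by (rule peval_pCons[OF Ev_hom Ev_commute[OF EE_closed(4)]])

lemma evP_X: "evP [:0, 1:] = fr" by (rule peval_X[OF Ev_hom])

lemma Ev_pCons: "Ev (pCons a b) = cst a + \<Phi> * Ev b"
  unfolding Ev_def by (rule peval_pCons[OF is_rhom_cst cst_commute])

lemma tdeg_Ev: "a \<noteq> 0 \<Longrightarrow> Ev a \<noteq> 0 \<and> tdeg (Ev a) = r * degree a"
proof (induction a)
  case (pCons a b)
  show ?case
  proof (cases "b = 0")
    case True
    then have "a \<noteq> 0" using pCons by simp
    then show ?thesis using True by (simp add: Ev_const cst_def tdeg_tmonom)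
  next
    case False
    have "\<Phi> \<noteq> 0" using \<Phi>_deg r_pos by auto
    then have "tdeg (\<Phi> * Ev b) = r + r * degree b" using pCons.IH[OF False] False by (simp add: tdeg_mult \<Phi>_deg)
    moreover have "tdeg (cst a) \<le> 0" unfolding cst_def by (rule tdeg_tmonom_le)
    ultimately have "tdeg (Ev (pCons a b)) = r + r * degree b"
      unfolding Ev_pCons using r_pos by (subst tdeg_add_eq_right) auto
    moreover from this have "Ev (pCons a b) \<noteq> 0" using r_pos by auto
    ultimately show ?thesis using False by simp
  qed
qed simp

lemma Ev_eq_0_iff [simp]: "Ev a = 0 \<longleftrightarrow> a = 0"
  using tdeg_Ev[of a] Ev_simps(4) by blast

lemma tcoeff_mult_0: "tcoeff (f * g) 0 = tcoeff f 0 * tcoeff g 0"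
  by (simp add: tcoeff_mult)

lemma tcoeff_Ev_0: "tcoeff (Ev a) 0 = ev \<theta> a"
proof (induction a)
  case (pCons a b)
  have "pCons a b = [:a:] + [:0, 1:] * b" by simp
  then have "ev \<theta> (pCons a b) = to_ac a + \<theta> * ev \<theta> b" by (metis ev_simps(3,4,8,10))
  then show ?case using pCons by (simp add: Ev_pCons tcoeff_mult_0 \<Phi>_0 cst_def)
qed (simp add: Ev_simps)

text \<open>Multiples of tau^d have no constant term, so the constant coefficient of the expansion
  is the residue of the lowest digit, and a digit of degree below d with residue 0 is 0. After
  cancelling tau^d the argument repeats.\<close>

lemma digits_eq_0:
  assumes "\<And>l i. i \<ge> d \<Longrightarrow> coeff (coeff P l) i = 0" and "evP P = 0"
  shows "P = 0"
  using assms
proof (induction P)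
  case (pCons a P)
  have "tcoeff (Ev a + fr * evP P) 0 = 0" using pCons.prems(2) by (simp add: evP_pCons)
  then have "ev \<theta> a = 0" using d_pos by (simp add: tcoeff_Ev_0 tcoeff_tmonom_mult)
  moreover have "a mod p = a" unfolding mod_p_eq_iff using pCons.prems(1)[of _ 0] by simp
  ultimately have a: "a = 0" using ev_inj_reduced[of a 0] by simp
  then have "evP P = 0" using pCons.prems(2) fr_nonzero by (simp add: evP_pCons Ev_simps)
  moreover have "coeff (coeff P l) i = 0" if "i \<ge> d" for l i using pCons.prems(1)[OF that, of "Suc l"] by simp
  ultimately have "P = 0" using pCons.IH by blast
  with a show ?case by simp
qed simp

text \<open>Pseudo-division by P0 multiplies by a power of its leading coefficient that depends on
  the degree of the dividend. Reducing by the monic m first brings this degree below r, so that one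
  factor \<open>lead_coeff P0 ^ r\<close> serves all P, as the counting below requires.\<close>

lemma relation_reduce:
  assumes m: "degree m = r" "coeff m r = 1" "evP m = 0" and P0: "P0 \<noteq> 0" "evP P0 = 0"
  shows "\<exists>P'. (\<forall>i\<ge>degree P0. coeff P' i = 0) \<and> evP P' = Ev (lead_coeff P0 ^ r) * evP P"
proof -
  have below: "coeff S i = 0" if "S = 0 \<or> degree S < n" "i \<ge> n" for S :: "'a poly poly" and n i
    using that by (auto intro: coeff_eq_0)
  obtain Q1 R1 where d1: "pseudo_divmod P m = (Q1, R1)" by fastforce
  have "m \<noteq> 0" using m by auto
  from pseudo_divmod[OF this d1] have P: "P = m * Q1 + R1" and R1: "R1 = 0 \<or> degree R1 < r"
    using m by auto
  obtain Q2 R2 where d2: "pseudo_divmod R1 P0 = (Q2, R2)" by fastforce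
  let ?k = "Suc (degree R1) - degree P0"
  from pseudo_divmod[OF P0(1) d2]
  have R1_eq: "smult (lead_coeff P0 ^ ?k) R1 = P0 * Q2 + R2" and R2: "R2 = 0 \<or> degree R2 < degree P0"
    by auto
  have k: "?k \<le> r" using R1 r_pos by auto
  have "evP (smult (lead_coeff P0 ^ (r - ?k)) R2) = Ev (lead_coeff P0 ^ (r - ?k)) * (Ev (lead_coeff P0 ^ ?k) * evP R1)"
    using arg_cong[OF R1_eq, of evP] by (simp add: evP_simps evP_smult P0)
  also have "\<dots> = Ev (lead_coeff P0 ^ r) * evP R1"
    using k by (simp add: Ev_simps mult.assoc[symmetric] power_add[symmetric])
  also have "evP R1 = evP P" unfolding P by (simp add: evP_simps m)
  finally have "evP (smult (lead_coeff P0 ^ (r - ?k)) R2) = Ev (lead_coeff P0 ^ r) * evP P" .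
  moreover have "\<forall>i\<ge>degree P0. coeff (smult (lead_coeff P0 ^ (r - ?k)) R2) i = 0"
    using below[OF R2] by simp
  ultimately show ?thesis by blast
qed

text \<open>A relation of degree s leaves room for about q^((s/r) x) elements of A[pi] of degree at most
  x, whereas the expansions in powers of pi with digits of degree < d already give about q^x.\<close>
theorem relation_degree:
  assumes P0: "P0 \<noteq> 0" "evP P0 = 0"
  shows "r \<le> degree P0"
proof -
  obtain m g where m: "degree m = r" "coeff m r = 1" "evP m = 0"
    using char_poly_and_derivative[OF EE_closed(4) EE_closed(4) refl] by blast
  define s where "s = degree P0"
  define c where "c = lead_coeff P0 ^ r"
  have c0: "c \<noteq> 0" using P0 by (simp add: c_def)
  obtain red where red: "\<And>P i. i \<ge> s \<Longrightarrow> coeff (red P) i = 0" "\<And>P. evP (red P) = Ev c * evP P"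
    using relation_reduce[OF m P0] unfolding s_def c_def by metis
  \<comment> \<open>The slack that decides the comparison of tau-degrees: \<open>degree c\<close>
    accounts for the factor c, and d exceeds the largest degree d - 1 of a digit.\<close>
  define K where "K = degree c + d"
  have bound: "d * (r * t) \<le> (K + d * t) * s" for t
  proof -
    define J where "J = K + d * t"
    define j where "j = r * t"
    have J_pos: "J > 0" unfolding J_def K_def using d_pos by simp
    define low :: "nat \<Rightarrow> 'a poly set" where "low n = {a. \<forall>i\<ge>n. coeff a i = 0}" for n
    define dig where "dig z = (\<Sum>l<j. monom (z l) l)" for z :: "nat \<Rightarrow> 'a poly"
    \<comment> \<open>An expansion is recorded by the coefficients of its reduced form modulo T^J.
      If two expansions have the same record, c times their difference is a multiple of T^J, and its
      tau-degree is too small for that unless it is 0.\<close>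
    define F where "F z = restrict (\<lambda>i. coeff (red (dig z)) i mod monom 1 J) {..<s}" for z
    have dig_co: "coeff (dig z) l = (if l < j then z l else 0)" for z l
      unfolding dig_def by (simp add: coeff_sum)
    have "inj_on F (PiE {..<j} (\<lambda>_. low d))"
    proof (rule inj_onI)
      fix z z' assume z: "z \<in> PiE {..<j} (\<lambda>_. low d)" "z' \<in> PiE {..<j} (\<lambda>_. low d)" and eq: "F z = F z'"
      define D where "D = dig z - dig z'"
      have D_co: "coeff (coeff D l) i = 0" if "i \<ge> d" for l i
      proof (cases "l < j")
        case True
        then have "z l \<in> low d" "z' l \<in> low d" using z by auto
        then show ?thesis using that by (simp add: D_def dig_co low_def)
      qed (simp add: D_def dig_co)
      have "\<forall>i. \<exists>g. coeff (red (dig z) - red (dig z')) i = monom 1 J * g"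
      proof
        fix i
        show "\<exists>g. coeff (red (dig z) - red (dig z')) i = monom 1 J * g"
        proof (cases "i < s")
          case True
          then have "coeff (red (dig z)) i mod monom 1 J = coeff (red (dig z')) i mod monom 1 J"
            using fun_cong[OF eq, of i] by (simp add: F_def)
          then have "monom 1 J dvd coeff (red (dig z)) i - coeff (red (dig z')) i" by (simp add: mod_eq_dvd_iff)
          then show ?thesis by auto
        next
          case False then show ?thesis using red(1) by (intro exI[of _ 0]) simp
        qed
      qed
      then obtain g where g: "\<And>i. coeff (red (dig z) - red (dig z')) i = monom 1 J * g i" by metis
      define G where "G = (\<Sum>i<s. monom (g i) i)"
      have "red (dig z) - red (dig z') = smult (monom 1 J) G"
      proof (rule poly_eqI)
        fix i show "coeff (red (dig z) - red (dig z')) i = coeff (smult (monom 1 J) G) i"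
        proof (cases "i < s")
          case True then show ?thesis unfolding g by (simp add: G_def coeff_sum)
        next
          case False
          then show ?thesis using red(1)[of i] by (simp add: G_def coeff_sum)
        qed
      qed
      then have "evP (red (dig z) - red (dig z')) = Ev (monom 1 J) * evP G" by (simp add: evP_smult)
      then have key: "Ev c * evP D = Ev (monom 1 J) * evP G"
        by (simp add: evP_simps red D_def algebra_simps)
      have "evP D = 0"
      proof (rule ccontr)
        assume ne: "evP D \<noteq> 0"
        have J0: "monom 1 J \<noteq> (0 :: 'a poly)" by simp
        have "evP G \<noteq> 0" using key ne c0 by auto
        then have "r * J \<le> tdeg (Ev (monom 1 J) * evP G)"
          using tdeg_Ev[OF J0] by (simp add: tdeg_mult degree_monom_eq)
        also have "\<dots> = r * degree c + tdeg (evP D)"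
          unfolding key[symmetric] using tdeg_Ev[OF c0] ne by (simp add: tdeg_mult)
        also have "tdeg (evP D) \<le> r * (d - 1) + j * d"
        proof -
          have "evP D = (\<Sum>l<j. Ev (coeff D l) * fr ^ l)"
            by (rule peval_eq_sum[OF Ev_hom]) (simp add: D_def dig_co)
          also have "tdeg \<dots> \<le> r * (d - 1) + j * d"
          proof (rule tdeg_sum_le)
            fix l assume l: "l \<in> {..<j}"
            have "degree (coeff D l) \<le> d - 1" using D_co d_pos by (intro degree_le) auto
            then have "tdeg (Ev (coeff D l)) \<le> r * (d - 1)"
              using tdeg_Ev[of "coeff D l"] by (cases "coeff D l = 0") (auto simp: Ev_simps)
            moreover have "tdeg (fr ^ l) \<le> j * d" using l by (simp add: tdeg_power tdeg_tmonom)
            ultimately show "tdeg (Ev (coeff D l) * fr ^ l) \<le> r * (d - 1) + j * d"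
              using tdeg_mult_le[of "Ev (coeff D l)" "fr ^ l"] by linarith
          qed
          finally show ?thesis .
        qed
        finally have "r * J \<le> r * degree c + (r * (d - 1) + r * t * d)" by (simp add: j_def)
        moreover have "r * J = r * degree c + (r * d + r * t * d)" by (simp add: J_def K_def algebra_simps)
        moreover have "r * (d - 1) < r * d" using r_pos d_pos by simp
        ultimately show False by linarith
      qed
      then have "D = 0" using digits_eq_0 D_co by blast
      then have "z l = z' l" if "l < j" for l
        using that dig_co[of z l] dig_co[of z' l] by (simp add: D_def)
      then show "z = z'" using z by (intro PiE_ext) auto
    qed
    moreover have "F ` PiE {..<j} (\<lambda>_. low d) \<subseteq> PiE {..<s} (\<lambda>_. low J)"
    proof -
      have "a mod monom 1 J \<in> low J" for a :: "'a poly"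
      proof -
        have "a mod monom 1 J = 0 \<or> degree (a mod monom 1 J) < J"
          using degree_mod_less[of "monom (1::'a) J" a] by (simp add: degree_monom_eq)
        then show ?thesis by (auto simp: low_def intro: coeff_eq_0)
      qed
      then show ?thesis by (auto simp: F_def)
    qed
    moreover have "finite (PiE {..<s} (\<lambda>_. low J))"
      by (intro finite_PiE) (auto simp: low_def card_polys)
    ultimately have "card (PiE {..<j} (\<lambda>_. low d)) \<le> card (PiE {..<s} (\<lambda>_. low J))"
      by (rule card_inj_on_le)
    then have "(q ^ d) ^ j \<le> (q ^ J) ^ s" by (simp add: card_PiE low_def card_polys)
    then have "q ^ (d * j) \<le> q ^ (J * s)" by (simp add: power_mult)
    then show ?thesis unfolding j_def J_def using power_increasing_iff[OF q_gt_1] by blast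
  qed
  show ?thesis
  proof (rule ccontr)
    assume "\<not> ?thesis"
    then have "s + 1 \<le> r" by (simp add: s_def)
    \<comment> \<open>For s < r the bound simplifies to d t \<le> K s, which this choice of t
      contradicts.\<close>
    define t where "t = K * s + 1"
    have "d * ((s + 1) * t) \<le> d * (r * t)" using \<open>s + 1 \<le> r\<close> by (intro mult_le_mono order_refl)
    also have "\<dots> \<le> K * s + d * t * s" using bound[of t] by (simp add: algebra_simps)
    finally have "d * t \<le> K * s" by (simp add: algebra_simps)
    moreover have "t \<le> d * t" using d_pos by simp
    ultimately show False by (simp add: t_def)
  qed
qed

lemma evP_inj:
  assumes "\<And>i. i \<ge> r \<Longrightarrow> coeff P i = 0" "evP P = 0"
  shows "P = 0"
proof (rule ccontr)
  assume "P \<noteq> 0"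
  then show False using relation_degree[OF \<open>P \<noteq> 0\<close> assms(2)] assms(1)[of "degree P"] by simp
qed

section \<open>The characteristic polynomial of the Frobenius and the conductor of A[pi]\<close>

definition is_cp :: "'a poly poly \<Rightarrow> bool" where
  "is_cp m \<longleftrightarrow> degree m = r \<and> coeff m r = 1 \<and> evP m = 0"

lemma ex_is_cp: "\<exists>m. is_cp m"
  unfolding is_cp_def using char_poly_and_derivative[OF EE_closed(4) EE_closed(4) refl] by blast

lemma is_cp_unique: assumes "is_cp m" "is_cp m'" shows "m = m'"
proof -
  have "coeff (m - m') i = 0" if "i \<ge> r" for i
    using assms that by (cases "i = r") (auto simp: is_cp_def coeff_eq_0)
  moreover have "evP (m - m') = 0" using assms by (simp add: is_cp_def evP_simps)
  ultimately have "m - m' = 0" by (rule evP_inj)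
  then show ?thesis by simp
qed

lemma integral_element:
  assumes "\<gamma> \<in> EE"
  shows "\<exists>m. degree m = r \<and> coeff m r = 1 \<and> peval Ev \<gamma> m = 0"
  using char_poly_and_derivative[OF assms assms refl] by blast

text \<open>If R is a monic equation of degree r for \<gamma>, then n^r R((X - a)/n) is one for pi
  and hence the characteristic polynomial. Its coefficient at X^(r-1) is n times that of R, minus r
  a.\<close>

lemma cp_coeff_shift:
  assumes m: "is_cp m" and c: "\<gamma> \<in> EE" and fr: "fr = Ev a + Ev n * \<gamma>"
  shows "n dvd coeff m (r - 1) + of_nat r * a"
proof -
  obtain R where R: "degree R = r" "coeff R r = 1" "peval Ev \<gamma> R = 0"
    using integral_element[OF c] by blast
  \<comment> \<open>This is n^r R((X - a)/n) with the denominators multiplied out.\<close>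
  define S where "S = (\<Sum>i\<le>r. smult (n ^ (r - i) * coeff R i) ([:- a, 1:] ^ i))"
  have co: "coeff ([:- a, 1:] ^ i) k = (if k \<le> i then of_nat (i choose k) * (- a) ^ (i - k) else 0)" for i k
    by (auto simp: coeff_linear_poly_power intro!: coeff_eq_0 simp: degree_linear_power)
  have lin: "evP [:- a, 1:] = Ev n * \<gamma>"
  proof -
    have "[:- a, 1:] = [:0, 1:] - [:a:]" by simp
    then have "evP [:- a, 1:] = fr - Ev a" by (simp only: evP_simps evP_X evP_const)
    then show ?thesis using fr by simp
  qed
  have pow: "(Ev n * \<gamma>) ^ i = Ev (n ^ i) * \<gamma> ^ i" for i
  proof (induction i)
    case (Suc i)
    have "(Ev n * \<gamma>) ^ Suc i = Ev n * (\<gamma> * Ev (n ^ i)) * \<gamma> ^ i" by (simp add: Suc mult.assoc)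
    also have "\<dots> = Ev n * (Ev (n ^ i) * \<gamma>) * \<gamma> ^ i" by (simp only: Ev_commute[OF c])
    finally show ?case by (simp add: Ev_simps mult.assoc)
  qed (simp add: Ev_simps)
  have "evP S = (\<Sum>i\<le>r. Ev (n ^ (r - i) * coeff R i) * (Ev n * \<gamma>) ^ i)"
    unfolding S_def by (simp add: is_rhom_sum[OF evP_hom[OF EE_closed(4)]] evP_smult evP_simps lin del: peval_commute)
  also have "\<dots> = (\<Sum>i\<le>r. Ev (n ^ r) * (Ev (coeff R i) * \<gamma> ^ i))"
  proof (intro sum.cong refl)
    fix i assume "i \<in> {..r}"
    then have "n ^ r = n ^ (r - i) * n ^ i" by (simp add: power_add[symmetric])
    then have "n ^ (r - i) * coeff R i * n ^ i = n ^ r * coeff R i" by (simp add: mult.commute mult.left_commute)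
    then have "Ev (n ^ (r - i) * coeff R i) * Ev (n ^ i) = Ev (n ^ r) * Ev (coeff R i)"
      by (simp only: Ev_simps(3)[symmetric])
    then show "Ev (n ^ (r - i) * coeff R i) * (Ev n * \<gamma>) ^ i = Ev (n ^ r) * (Ev (coeff R i) * \<gamma> ^ i)"
      by (simp only: pow mult.assoc[symmetric])
  qed
  also have "\<dots> = Ev (n ^ r) * peval Ev \<gamma> R" by (simp add: peval_def R sum_distrib_left)
  finally have S0: "evP S = 0" using R by simp
  have S_co: "coeff S k = (\<Sum>i\<le>r. n ^ (r - i) * coeff R i * (if k \<le> i then of_nat (i choose k) * (- a) ^ (i - k) else 0))" for k
    unfolding S_def by (simp add: coeff_sum co)
  have S_top: "coeff S r = 1"
  proof -
    have "coeff S r = (\<Sum>i\<le>r. if i = r then 1 else 0)"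
      unfolding S_co by (intro sum.cong) (auto simp: R)
    then show ?thesis by simp
  qed
  have "degree S \<le> r" by (rule degree_le) (auto simp: S_co intro!: sum.neutral)
  then have "degree S = r" using S_top by (intro antisym le_degree) auto
  then have "S = m" using S_top S0 m is_cp_unique by (auto simp: is_cp_def)
  have "coeff S (r - 1) = (\<Sum>i\<in>{r - 1, r}. n ^ (r - i) * coeff R i * (if r - 1 \<le> i then of_nat (i choose (r - 1)) * (- a) ^ (i - (r - 1)) else 0))"
    unfolding S_co by (rule sum.mono_neutral_right) auto
  also have "\<dots> = n * coeff R (r - 1) - of_nat r * a"
    using r_pos R by (cases r) auto
  finally have "coeff m (r - 1) + of_nat r * a = n * coeff R (r - 1)" using \<open>S = m\<close> by simp
  then show ?thesis by simp
qed

lemma evP_reduce: "\<exists>R. (\<forall>i\<ge>r. coeff R i = 0) \<and> evP R = evP P"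
proof -
  obtain m where m: "degree m = r" "coeff m r = 1" "evP m = 0" using ex_is_cp unfolding is_cp_def by blast
  have "m \<noteq> 0" using m by auto
  from relation_reduce[OF m this m(3), of P] show ?thesis using m by (simp add: Ev_simps)
qed

text \<open>With y = m'(pi), every \<gamma> y lies in A[pi]. As y is integral and nonzero, some
  nonzero b in A is a multiple of y inside A[pi], and then b \<gamma> lies in A[pi] as well. The
  coefficient r of m' is what makes y nonzero.\<close>

lemma ex_conductor:
  assumes "of_nat r \<noteq> (0::'a)"
  shows "\<exists>c. c \<noteq> 0 \<and> (\<forall>\<gamma>\<in>EE. \<exists>P. (\<forall>i\<ge>r. coeff P i = 0) \<and> Ev c * \<gamma> = evP P)"
proof -
  obtain m where m: "is_cp m" using ex_is_cp by blast
  define y where "y = evP (pderiv m)"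
  have "coeff (pderiv m) (r - 1) \<noteq> 0"
  proof -
    have "coeff (pderiv m) (r - 1) = of_nat r"
      using m r_pos by (simp add: coeff_pderiv is_cp_def)
    moreover have "coeff (of_nat r :: 'a poly) 0 = of_nat r" by (simp add: of_nat_poly)
    ultimately show ?thesis using assms by (metis coeff_0)
  qed
  then have "pderiv m \<noteq> 0" by auto
  moreover have "coeff (pderiv m) i = 0" if "i \<ge> r" for i
    using m that by (simp add: coeff_pderiv is_cp_def coeff_eq_0)
  ultimately have y0: "y \<noteq> 0" unfolding y_def using evP_inj by blast
  have yE: "y \<in> EE" unfolding y_def by (rule evP_EE[OF EE_closed(4)])
  obtain R where R: "degree R = r" "coeff R r = 1" "peval Ev y R = 0" using integral_element[OF yE] by blast
  note yh = is_rhomD[OF evP_hom[OF yE]]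
  \<comment> \<open>Factors X can be removed from the equation of y because y is no zero divisor;
    what remains has a nonzero constant term.\<close>
  have "\<exists>R'. R' \<noteq> 0 \<and> peval Ev y R' = 0 \<and> coeff R' 0 \<noteq> 0"
    if "R \<noteq> 0" "peval Ev y R = 0" for R using that
  proof (induction R)
    case (pCons b S)
    show ?case
    proof (cases "b = 0")
      case True
      then have "S \<noteq> 0" "y * peval Ev y S = 0" 
        using pCons.prems peval_pCons[OF Ev_hom Ev_commute[OF yE], of b S] by (auto simp: Ev_simps)
      then show ?thesis using pCons.IH y0 by auto
    next
      case False then show ?thesis using pCons.prems by (intro exI[of _ "pCons b S"]) auto
    qed
  qed simp
  moreover have "R \<noteq> 0" using R by auto
  ultimately obtain R' where R': "peval Ev y R' = 0" "coeff R' 0 \<noteq> 0" using R by blast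
  obtain b S where bS: "R' = pCons b S" by (rule pCons_cases)
  then have b: "b \<noteq> 0" "Ev b = - (y * peval Ev y S)"
    using R' peval_pCons[OF Ev_hom Ev_commute[OF yE], of b S] by (auto simp: add_eq_0_iff2)
  define Z where "Z = (\<Sum>i\<le>degree S. smult (coeff S i) (pderiv m ^ i))"
  have Z: "peval Ev y S = evP Z"
  proof -
    have "evP Z = (\<Sum>i\<le>degree S. Ev (coeff S i) * y ^ i)"
      unfolding Z_def by (simp add: is_rhom_sum[OF evP_hom[OF EE_closed(4)]] evP_smult evP_simps y_def)
    then show ?thesis by (simp only: peval_def[of Ev y])
  qed
  have "\<exists>P. (\<forall>i\<ge>r. coeff P i = 0) \<and> Ev b * \<gamma> = evP P" if "\<gamma> \<in> EE" for \<gamma>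
  proof -
    note cE = that
    \<comment> \<open>The polynomial obtained here depends on \<gamma> at first; uniqueness of the
      characteristic polynomial identifies it with m, so that y is the same for all
      \<gamma>.\<close>
    obtain m' g where mg: "is_cp m'" "\<gamma> * evP (pderiv m') = evP g"
      using char_poly_and_derivative[OF EE_closed(4) cE] EE_comm_fr[OF cE] unfolding is_cp_def by auto
    then have mg: "\<gamma> * y = evP g" unfolding y_def using is_cp_unique[OF m mg(1)] by simp
    have "Ev b * \<gamma> = \<gamma> * Ev b" by (rule Ev_commute[OF that])
    also have "\<dots> = - (\<gamma> * y * evP Z)" unfolding b Z by (simp add: mult.assoc)
    also have "\<dots> = evP (- (g * Z))" unfolding mg by (simp add: evP_simps)
    finally have e: "Ev b * \<gamma> = evP (- (g * Z))" .
    obtain P where "\<forall>i\<ge>r. coeff P i = 0" "evP P = evP (- (g * Z))" using evP_reduce by blast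
    then show ?thesis using e by (intro exI[of _ P]) simp
  qed
  with b show ?thesis by blast
qed

text \<open>In lowest terms w'/c', Bezout makes \<open>Ev c'\<close> a divisor of 1. Its tau-degree
  is then 0, so c' is a constant. Thus E/A has no torsion, and forgetting the coordinate of 1 will
  lose exactly A.\<close>

lemma Ev_saturated:
  assumes g: "g \<in> EE" and c: "c \<noteq> 0" and eq: "Ev c * g = Ev w"
  shows "\<exists>b. g = Ev b"
proof -
  define k where "k = gcd c w"
  have k0: "k \<noteq> 0" using c by (simp add: k_def)
  obtain c' w' where cw: "c = k * c'" "w = k * w'" and cop: "coprime c' w'"
    using gcd_coprime_exists[of c w] k0 unfolding k_def by (metis mult.commute)
  have c': "c' \<noteq> 0" using c cw by auto
  have "Ev k * (Ev c' * g) = Ev k * Ev w'" using eq by (simp add: cw Ev_simps mult.assoc)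
  then have eq': "Ev c' * g = Ev w'" using k0 by simp
  obtain x y where xy: "x * c' + y * w' = 1"
    by (metis bezout_coefficients_fst_snd coprime_imp_gcd_eq_1 cop)
  have "Ev c' * (Ev x + Ev y * g) = Ev (x * c') + Ev y * (Ev c' * g)"
  proof -
    have 1: "Ev c' * Ev x = Ev (x * c')" "Ev c' * Ev y = Ev y * Ev c'"
      by (simp_all only: Ev_simps(3)[symmetric] mult.commute)
    have "Ev c' * (Ev y * g) = Ev y * (Ev c' * g)"
      by (simp only: mult.assoc[symmetric] 1)
    then show ?thesis using 1 by (simp add: distrib_left)
  qed
  also have "\<dots> = Ev (x * c' + y * w')" by (simp add: eq' Ev_simps)
  finally have u: "Ev c' * (Ev x + Ev y * g) = 1" by (simp add: xy Ev_simps)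
  then have "Ev x + Ev y * g \<noteq> 0" by auto
  then have "tdeg (Ev c') + tdeg (Ev x + Ev y * g) = 0"
    using c' tdeg_mult[of "Ev c'" "Ev x + Ev y * g"] by (simp add: u)
  then have "degree c' = 0" using tdeg_Ev[OF c'] r_pos by simp
  then have "is_unit c'" using c' by (simp add: is_unit_iff_degree)
  then obtain e where "1 = c' * e" by (rule dvdE)
  then have "g = Ev (e * c') * g" by (simp add: mult.commute Ev_simps)
  also have "\<dots> = Ev (e * w')" by (simp add: Ev_simps mult.assoc eq')
  finally show ?thesis by blast
qed

end

section \<open>Elementary divisors and the refined index\<close>

definition vecs :: "nat \<Rightarrow> (nat \<Rightarrow> 'b::zero) set" where
  "vecs N = {v. \<forall>i\<ge>N. v i = 0}"

definition submod :: "(nat \<Rightarrow> 'b::comm_ring_1) set \<Rightarrow> bool" where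
  "submod K \<longleftrightarrow> (\<lambda>_. 0) \<in> K \<and> (\<forall>v\<in>K. \<forall>w\<in>K. \<forall>a. (\<lambda>i. a * v i + w i) \<in> K)"

definition unimod :: "nat \<Rightarrow> ((nat \<Rightarrow> 'b::comm_ring_1) \<Rightarrow> nat \<Rightarrow> 'b) \<Rightarrow> bool" where
  "unimod N U \<longleftrightarrow> (\<forall>v w a. U (\<lambda>i. a * v i + w i) = (\<lambda>i. a * U v i + U w i)) \<and>
     bij_betw U (vecs N) (vecs N)"

lemma unimodD:
  assumes "unimod N U"
  shows "U (\<lambda>i. a * v i + w i) = (\<lambda>i. a * U v i + U w i)" "U (\<lambda>_. 0) = (\<lambda>_. 0)"
    "U (\<lambda>i. a * v i) = (\<lambda>i. a * U v i)"
    "v \<in> vecs N \<Longrightarrow> U v \<in> vecs N" "v \<in> vecs N \<Longrightarrow> \<exists>u\<in>vecs N. U u = v"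
    "v \<in> vecs N \<Longrightarrow> w \<in> vecs N \<Longrightarrow> U v = U w \<Longrightarrow> v = w"
proof -
  show 1: "\<And>v w a. U (\<lambda>i. a * v i + w i) = (\<lambda>i. a * U v i + U w i)"
    using assms by (auto simp: unimod_def)
  show 0: "U (\<lambda>_. 0) = (\<lambda>_. 0)"
  proof
    fix i show "U (\<lambda>_. 0) i = 0" using fun_cong[OF 1[of 1 "\<lambda>_. 0" "\<lambda>_. 0"], of i] by simp
  qed
  show "U (\<lambda>i. a * v i) = (\<lambda>i. a * U v i)" using 1[of a v "\<lambda>_. 0"] 0 by simp
  have "bij_betw U (vecs N) (vecs N)" using assms by (auto simp: unimod_def)
  then have im: "U ` vecs N = vecs N" and inj: "inj_on U (vecs N)" by (auto simp: bij_betw_def)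
  show "v \<in> vecs N \<Longrightarrow> U v \<in> vecs N" using im by blast
  show "v \<in> vecs N \<Longrightarrow> \<exists>u\<in>vecs N. U u = v" using im by (metis imageE)
  show "v \<in> vecs N \<Longrightarrow> w \<in> vecs N \<Longrightarrow> U v = U w \<Longrightarrow> v = w" using inj by (auto simp: inj_on_def)
qed

lemma unimod_id: "unimod N (\<lambda>v. v)"
  by (auto simp: unimod_def bij_betw_def)

lemma unimod_comp: "unimod N U \<Longrightarrow> unimod N U' \<Longrightarrow> unimod N (\<lambda>v. U (U' v))"
  unfolding unimod_def using bij_betw_trans[of U' "vecs N" "vecs N" U "vecs N"] by (auto simp: comp_def)

text \<open>Among all coordinate changes and all elements of K, take a nonzero first coordinate b of
  least size. It divides every coordinate of every element of K, so one axis can be split off, which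
  leaves a submodule of smaller rank. That K contains c times everything guarantees such a b at each
  stage.\<close>

lemma smith_normal_form:
  fixes K :: "(nat \<Rightarrow> 'b::euclidean_ring) set"
  assumes "K \<subseteq> vecs N" "submod K" "c \<noteq> 0" "\<And>v. v \<in> vecs N \<Longrightarrow> (\<lambda>i. c * v i) \<in> K"
  shows "\<exists>U b. unimod N U \<and> (\<forall>i. Suc i < N \<longrightarrow> b i dvd b (Suc i)) \<and>
    (\<forall>v\<in>vecs N. v \<in> K \<longleftrightarrow> (\<forall>i<N. b i dvd U v i))"
  using assms
proof (induction N arbitrary: K)
  case 0
  have "v \<in> K" if "v \<in> vecs 0" for v
  proof -
    have "v = (\<lambda>_. 0)" using that by (auto simp: vecs_def)
    then show ?thesis using "0.prems"(2) by (simp add: submod_def)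
  qed
  then show ?case using unimod_id[of 0] by (intro exI) auto
next
  case (Suc N)
  note K = Suc.prems(1) and sK = Suc.prems(2) and cK = Suc.prems(4)
  define S where "S = {n. \<exists>U v. unimod (Suc N) U \<and> v \<in> K \<and> U v 0 \<noteq> 0 \<and> n = euclidean_size (U v 0)}"
  have "(\<lambda>i. if i = 0 then c else 0) \<in> K"
    using cK[of "\<lambda>i. if i = 0 then 1 else 0"] by (simp add: vecs_def if_distrib cong: if_cong)
  then have "euclidean_size c \<in> S" unfolding S_def using unimod_id[of "Suc N"] \<open>c \<noteq> 0\<close>
    by (intro CollectI exI[of _ "\<lambda>v. v"] exI[of _ "\<lambda>i. if i = 0 then c else 0"]) auto
  then have "(LEAST n. n \<in> S) \<in> S" by (rule LeastI)
  then obtain U0 v0 where U0: "unimod (Suc N) U0" and v0: "v0 \<in> K" "U0 v0 0 \<noteq> 0"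
    and least: "euclidean_size (U0 v0 0) = (LEAST n. n \<in> S)" unfolding S_def by auto
  define b where "b = U0 v0 0"
  have b0: "b \<noteq> 0" using v0 by (simp add: b_def)
  have min: "U v 0 = 0" if "unimod (Suc N) U" "v \<in> K" "euclidean_size (U v 0) < euclidean_size b" for U v
  proof (rule ccontr)
    assume "U v 0 \<noteq> 0"
    then have "euclidean_size (U v 0) \<in> S" unfolding S_def using that by blast
    then show False using that(3) Least_le[of "\<lambda>n. n \<in> S"] least by (fastforce simp: b_def)
  qed
  have Kadd: "(\<lambda>i. a * v i + w i) \<in> K" if "v \<in> K" "w \<in> K" for v w a
    using sK that by (auto simp: submod_def)
  \<comment> \<open>Subtracting a multiple of v0 replaces the first coordinate by its remainder
    modulo b, which minimality forces to be 0.\<close>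
  have dvd0: "b dvd U v 0" if "unimod (Suc N) U" "U v0 0 = b" "v \<in> K" for U v
  proof -
    let ?t = "- (U v 0 div b)"
    have e: "U (\<lambda>i. ?t * v0 i + v i) 0 = U v 0 mod b"
      unfolding unimodD(1)[OF that(1)] that(2) by (simp add: minus_div_mult_eq_mod[symmetric])
    have "U (\<lambda>i. ?t * v0 i + v i) 0 = 0"
      by (rule min[OF that(1) Kadd[OF v0(1) that(3)]]) (unfold e, rule mod_size_less[OF b0])
    then show ?thesis unfolding e by (rule mod_0_imp_dvd)
  qed
  have dvdj: "b dvd U v j" if U: "unimod (Suc N) U" and v: "v \<in> K" "U v 0 = b" for U v j
  proof (cases "j = 0 \<or> j \<ge> Suc N")
    case True
    then show ?thesis using unimodD(4)[OF U, of v] K v by (auto simp: vecs_def)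
  next
    case False
    let ?t = "U v j div b"
    \<comment> \<open>One step of the Euclidean algorithm between coordinates 0 and j: the remainder
      of coordinate j becomes the first coordinate, so that minimality applies to it.
      \<open>YY\<close> is the inverse.\<close>
    define XX where "XX v i = (if i = 0 then v j - ?t * v 0 else if i = j then v 0 else v i)" for v :: "nat \<Rightarrow> 'b" and i
    define YY where "YY v i = (if i = 0 then v j else if i = j then v 0 + ?t * v j else v i)" for v :: "nat \<Rightarrow> 'b" and i
    have "bij_betw XX (vecs (Suc N)) (vecs (Suc N))"
      by (rule bij_betw_byWitness[of _ YY]) (use False in \<open>auto simp: XX_def YY_def vecs_def fun_eq_iff\<close>)
    then have "unimod (Suc N) XX" unfolding unimod_def by (auto simp: XX_def fun_eq_iff algebra_simps)
    then have uXU: "unimod (Suc N) (\<lambda>v. XX (U v))" using U by (rule unimod_comp)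
    have e: "XX (U v) 0 = U v j mod b" unfolding XX_def v(2) by (simp add: minus_div_mult_eq_mod)
    have "XX (U v) 0 = 0"
      by (rule min[OF uXU v(1)]) (unfold e, rule mod_size_less[OF b0])
    then show ?thesis unfolding e by (rule mod_0_imp_dvd)
  qed
  define t where "t i = U0 v0 i div b" for i
  have t: "U0 v0 i = t i * b" for i using dvdj[OF U0 v0(1)] by (simp add: t_def b_def)
  define Sh where "Sh v i = (if i = 0 then v 0 else v i - t i * v 0)" for v :: "nat \<Rightarrow> 'b" and i
  define Sh' where "Sh' v i = (if i = 0 then v 0 else v i + t i * v 0)" for v :: "nat \<Rightarrow> 'b" and i
  have t0: "t i = 0" if "i \<ge> Suc N" for i
    using that unimodD(4)[OF U0, of v0] v0 K by (auto simp: vecs_def t_def)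
  have "bij_betw Sh (vecs (Suc N)) (vecs (Suc N))"
    by (rule bij_betw_byWitness[of _ Sh']) (use t0 in \<open>auto simp: Sh_def Sh'_def vecs_def fun_eq_iff\<close>)
  then have "unimod (Suc N) Sh" unfolding unimod_def by (auto simp: Sh_def fun_eq_iff algebra_simps)
  then have U1': "unimod (Suc N) (\<lambda>v. Sh (U0 v))" using U0 by (rule unimod_comp)
  define U1 where "U1 v = Sh (U0 v)" for v
  have U1: "unimod (Suc N) U1" using U1' unfolding U1_def by simp
  have U1v0: "U1 v0 = (\<lambda>i. if i = 0 then b else 0)"
    unfolding U1_def Sh_def b_def[symmetric] by (auto simp: fun_eq_iff t)
  note U1D = unimodD[OF U1]
  have all_dvd: "b dvd U1 v j" if vK: "v \<in> K" for v j
  proof (cases j)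
    case 0 then show ?thesis using dvd0[OF U1 _ that] U1v0 by simp
  next
    case (Suc j')
    obtain s where s: "U1 v 0 = b * s" using dvd0[OF U1 _ vK] U1v0 by auto
    \<comment> \<open>Chosen so that the first coordinate is exactly b, as \<open>dvdj\<close>
      demands.\<close>
    let ?x = "\<lambda>i. (1 - s) * v0 i + v i"
    have "b dvd U1 ?x j"
      by (rule dvdj[OF U1 Kadd[OF v0(1) that]]) (simp only: U1D(1) U1v0, simp add: s algebra_simps)
    then show ?thesis using Suc by (simp add: U1D(1) U1v0)
  qed
  define emb0 :: "(nat \<Rightarrow> 'b) \<Rightarrow> nat \<Rightarrow> 'b" where "emb0 u i = (case i of 0 \<Rightarrow> 0 | Suc i \<Rightarrow> u i)" for u i
  define K' where "K' = {u \<in> vecs N. \<exists>v\<in>K. U1 v = emb0 u}"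
  have emb_V: "emb0 u \<in> vecs (Suc N)" if "u \<in> vecs N" for u
    using that by (auto simp: vecs_def emb0_def split: nat.split)
  have emb_lin: "emb0 (\<lambda>i. a * u i + w i) = (\<lambda>i. a * emb0 u i + emb0 w i)" for a u w
    by (auto simp: emb0_def fun_eq_iff split: nat.split)
  have emb_0: "emb0 (\<lambda>_. 0) = (\<lambda>_. 0)" by (auto simp: emb0_def fun_eq_iff split: nat.split)
  have "submod K'"
    unfolding submod_def
  proof (intro conjI ballI allI)
    show "(\<lambda>_. 0) \<in> K'"
      using sK U1D(2) emb_0 by (auto simp: K'_def vecs_def submod_def intro!: bexI[of _ "\<lambda>_. 0"])
    fix u w a assume "u \<in> K'" "w \<in> K'"
    then obtain v v' where "u \<in> vecs N" "w \<in> vecs N" "v \<in> K" "v' \<in> K" "U1 v = emb0 u" "U1 v' = emb0 w"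
      by (auto simp: K'_def)
    then show "(\<lambda>i. a * u i + w i) \<in> K'"
      using Kadd[of v v' a] by (auto simp: K'_def vecs_def U1D(1) emb_lin intro!: bexI[of _ "\<lambda>i. a * v i + v' i"])
  qed
  moreover have "(\<lambda>i. c * u i) \<in> K'" if uV: "u \<in> vecs N" for u
  proof -
    obtain v where v: "v \<in> vecs (Suc N)" "U1 v = emb0 u" using U1D(5)[OF emb_V[OF uV]] by blast
    have "U1 (\<lambda>i. c * v i) = emb0 (\<lambda>i. c * u i)"
      unfolding U1D(3) v(2) by (auto simp: emb0_def fun_eq_iff split: nat.split)
    then show ?thesis using cK[OF v(1)] uV by (auto simp: K'_def vecs_def intro!: bexI[of _ "\<lambda>i. c * v i"])
  qed
  moreover have "K' \<subseteq> vecs N" by (auto simp: K'_def)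
  ultimately obtain U' b' where U': "unimod N U'" and ch: "\<And>i. Suc i < N \<Longrightarrow> b' i dvd b' (Suc i)"
    and K'iff: "\<And>v. v \<in> vecs N \<Longrightarrow> v \<in> K' \<longleftrightarrow> (\<forall>i<N. b' i dvd U' v i)"
    using Suc.IH[OF _ _ \<open>c \<noteq> 0\<close>, of K'] by blast
  note U'D = unimodD[OF U']
  \<comment> \<open>The vector with the single entry b' 0 is the image of an element of K', whose
    coordinates are all divisible by b. A linear map preserves this.\<close>
  have b_dvd: "b dvd b' 0" if "N > 0"
  proof -
    let ?y = "\<lambda>i. if i = 0 then b' 0 else 0"
    have "?y \<in> vecs N" using that by (auto simp: vecs_def)
    then obtain u where u: "u \<in> vecs N" "U' u = ?y" using U'D(5) by blast
    then have "u \<in> K'" using K'iff by auto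
    then obtain v where v: "v \<in> K" "U1 v = emb0 u" by (auto simp: K'_def)
    have "b dvd u i" for i using all_dvd[OF v(1), of "Suc i"] v(2) by (simp add: emb0_def)
    then have "u = (\<lambda>i. b * (u i div b))" by (auto simp: fun_eq_iff)
    then have "U' u = (\<lambda>i. b * U' (\<lambda>i. u i div b) i)" using U'D(3)[of b "\<lambda>i. u i div b"] by simp
    then have "b' 0 = b * U' (\<lambda>i. u i div b) 0" using fun_cong[OF u(2), of 0] by simp
    then show ?thesis by simp
  qed
  define U2 where "U2 v i = (case i of 0 \<Rightarrow> v 0 | Suc i \<Rightarrow> U' (\<lambda>i. v (Suc i)) i)" for v :: "nat \<Rightarrow> 'b" and i
  have "unimod (Suc N) U2"
    unfolding unimod_def
  proof (intro conjI allI bij_betwI')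
    fix v w :: "nat \<Rightarrow> 'b" and a
    show "U2 (\<lambda>i. a * v i + w i) = (\<lambda>i. a * U2 v i + U2 w i)"
      using U'D(1)[of a "\<lambda>i. v (Suc i)" "\<lambda>i. w (Suc i)"] by (auto simp: U2_def fun_eq_iff split: nat.split)
  next
    have tl: "(\<lambda>i. v (Suc i)) \<in> vecs N" if "v \<in> vecs (Suc N)" for v :: "nat \<Rightarrow> 'b"
      using that by (auto simp: vecs_def)
    {
      fix v w :: "nat \<Rightarrow> 'b" assume vw: "v \<in> vecs (Suc N)" "w \<in> vecs (Suc N)"
      show "(U2 v = U2 w) = (v = w)"
      proof
        assume eq: "U2 v = U2 w"
        have "U' (\<lambda>i. v (Suc i)) = U' (\<lambda>i. w (Suc i))"
        proof
          fix i show "U' (\<lambda>i. v (Suc i)) i = U' (\<lambda>i. w (Suc i)) i"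
            using fun_cong[OF eq, of "Suc i"] by (simp add: U2_def)
        qed
        then have e: "(\<lambda>i. v (Suc i)) = (\<lambda>i. w (Suc i))" using U'D(6) tl vw by blast
        show "v = w"
        proof
          fix i show "v i = w i"
            using fun_cong[OF eq, of 0] fun_cong[OF e, of "i - 1"] by (cases i) (auto simp: U2_def)
        qed
      qed simp
    }
    fix v :: "nat \<Rightarrow> 'b" assume v: "v \<in> vecs (Suc N)"
    then show "U2 v \<in> vecs (Suc N)" using U'D(4)[OF tl[OF v]]
      by (auto simp: U2_def vecs_def split: nat.split)
    obtain u where u: "u \<in> vecs N" "U' u = (\<lambda>i. v (Suc i))" using U'D(5)[OF tl[OF v]] by blast
    have "U2 (\<lambda>i. case i of 0 \<Rightarrow> v 0 | Suc i \<Rightarrow> u i) = v"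
      using u(2) by (auto simp: U2_def fun_eq_iff split: nat.split)
    moreover have "(\<lambda>i. case i of 0 \<Rightarrow> v 0 | Suc i \<Rightarrow> u i) \<in> vecs (Suc N)"
      using u(1) by (auto simp: vecs_def split: nat.split)
    ultimately show "\<exists>u\<in>vecs (Suc N). v = U2 u" by metis
  qed
  then have U: "unimod (Suc N) (\<lambda>v. U2 (U1 v))" using U1 by (rule unimod_comp)
  define bb where "bb i = (case i of 0 \<Rightarrow> b | Suc i \<Rightarrow> b' i)" for i
  have "bb i dvd bb (Suc i)" if "Suc i < Suc N" for i
    using that ch b_dvd by (cases i) (auto simp: bb_def)
  moreover have "v \<in> K \<longleftrightarrow> (\<forall>i<Suc N. bb i dvd U2 (U1 v) i)" if v: "v \<in> vecs (Suc N)" for v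
  proof -
    define tl where "tl = (\<lambda>i. U1 v (Suc i))"
    have tlV: "tl \<in> vecs N" using U1D(4)[OF v] by (auto simp: vecs_def tl_def)
    have "(\<forall>i<Suc N. bb i dvd U2 (U1 v) i) \<longleftrightarrow> b dvd U1 v 0 \<and> (\<forall>i<N. b' i dvd U' tl i)"
      by (auto simp: bb_def U2_def tl_def All_less_Suc2)
    also have "\<dots> \<longleftrightarrow> b dvd U1 v 0 \<and> tl \<in> K'" using K'iff[OF tlV] by simp
    also have "\<dots> \<longleftrightarrow> v \<in> K"
    proof
      assume vK: "v \<in> K"
      obtain s where s: "U1 v 0 = b * s" using all_dvd[OF vK] by auto
      have "U1 (\<lambda>i. - s * v0 i + v i) = emb0 tl"
        unfolding U1D(1) U1v0 by (auto simp: fun_eq_iff emb0_def tl_def s split: nat.split)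
      then have "tl \<in> K'" unfolding K'_def using tlV Kadd[OF v0(1) vK, of "- s"] by blast
      then show "b dvd U1 v 0 \<and> tl \<in> K'" using s by simp
    next
      assume "b dvd U1 v 0 \<and> tl \<in> K'"
      then have "b dvd U1 v 0" and "\<exists>v'\<in>K. U1 v' = emb0 tl" by (auto simp: K'_def)
      then obtain s v' where s: "U1 v 0 = b * s" and v': "v' \<in> K" "U1 v' = emb0 tl" by (auto elim!: dvdE)
      have "U1 (\<lambda>i. s * v0 i + v' i) = U1 v"
        unfolding U1D(1) U1v0 v'(2) by (auto simp: fun_eq_iff emb0_def tl_def s split: nat.split)
      then have "v = (\<lambda>i. s * v0 i + v' i)" 
        by (intro U1D(6)[OF v]) (use Kadd[OF v0(1) v'(1), of s] K in auto)
      then show "v \<in> K" using Kadd[OF v0(1) v'(1)] by simp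
    qed
    finally show ?thesis by simp
  qed
  ultimately show ?case using U by blast
qed

section \<open>The refined index inside the ring of twisted polynomials\<close>

context reduced_module begin

text \<open>The counterpart of \<open>refined_index\<close> after the residues have been mapped into
  the closure of F_q.\<close>

definition rindex :: "(nat \<Rightarrow> 'a poly) \<Rightarrow> bool" where
  "rindex b \<longleftrightarrow> (\<forall>i<r-1. lead_coeff (b i) = 1) \<and> (\<forall>i. Suc i < r - 1 \<longrightarrow> b i dvd b (Suc i)) \<and>
     (\<exists>h :: 'a twist \<Rightarrow> nat \<Rightarrow> 'a poly.
        (\<forall>f\<in>EE. \<forall>g\<in>EE. \<forall>a. \<forall>i<r-1. b i dvd (h (Ev a * f + g) i - (a * h f i + h g i))) \<and>
        (\<forall>c. \<exists>f\<in>EE. \<forall>i<r-1. b i dvd (h f i - c i)) \<and>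
        (\<forall>f\<in>EE. f \<in> range evP \<longleftrightarrow> (\<forall>i<r-1. b i dvd h f i)))"

lemma chain_dvd:
  assumes "\<And>i. Suc i < N \<Longrightarrow> b i dvd (b (Suc i) :: 'a poly)" "i < N"
  shows "b 0 dvd b i"
  using assms(2)
proof (induction i)
  case (Suc i)
  then show ?case using assms(1)[of i] dvd_trans by auto
qed simp

text \<open>Both modules of residues below are quotients of the endomorphism ring modulo A[pi] and
  multiples of b 0; comparing their sizes shows that the smallest elementary divisor is unique.\<close>
lemma rindex_dvd:
  assumes b: "rindex b" and b': "rindex b'" and r2: "r \<ge> 2"
  shows "b 0 dvd b' 0"
proof -
  define N where "N = r - 1"
  have N: "N > 0" using r2 by (simp add: N_def)
  define n where "n = b 0"
  obtain h where h: "\<And>f g a i. f \<in> EE \<Longrightarrow> g \<in> EE \<Longrightarrow> i < N \<Longrightarrow> b i dvd (h (Ev a * f + g) i - (a * h f i + h g i))"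
    "\<And>c. \<exists>f\<in>EE. \<forall>i<N. b i dvd (h f i - c i)"
    "\<And>f. f \<in> EE \<Longrightarrow> f \<in> range evP \<longleftrightarrow> (\<forall>i<N. b i dvd h f i)"
    using b unfolding rindex_def N_def by blast
  obtain h' where h': "\<And>f g a i. f \<in> EE \<Longrightarrow> g \<in> EE \<Longrightarrow> i < N \<Longrightarrow> b' i dvd (h' (Ev a * f + g) i - (a * h' f i + h' g i))"
    "\<And>c. \<exists>f\<in>EE. \<forall>i<N. b' i dvd (h' f i - c i)"
    "\<And>f. f \<in> EE \<Longrightarrow> f \<in> range evP \<longleftrightarrow> (\<forall>i<N. b' i dvd h' f i)"
    using b' unfolding rindex_def N_def by blast
  have n_dvd: "n dvd b i" if "i < N" for i
    unfolding n_def by (rule chain_dvd[of N]) (use b that in \<open>auto simp: rindex_def N_def\<close>)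
  have n0: "n \<noteq> 0" using b N unfolding rindex_def n_def N_def by (metis leading_coeff_0_iff zero_neq_one)
  define g where "g i = gcd (b' i) n" for i
  have g0: "g i \<noteq> 0" for i using n0 by (simp add: g_def)
  define low :: "nat \<Rightarrow> 'a poly set" where "low k = {a. \<forall>i\<ge>k. coeff a i = 0}" for k
  obtain ff where ff: "\<And>x. ff x \<in> EE" "\<And>x i. i < N \<Longrightarrow> b i dvd (h (ff x) i - x i)"
    using h(2) by metis
  \<comment> \<open>Vectors over A/n are lifted to E by means of h and read off by means of h'
    modulo the gcds. Injectivity bounds the N-th power of the size of A/n by the product of the
    sizes of the A/(b' i, n).\<close>
  define F where "F x = restrict (\<lambda>i. h' (ff x) i mod g i) {..<N}" for x
  have low_mod: "a mod c \<in> low (degree c)" if "c \<noteq> 0" for a c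
    using degree_mod_less[OF that, of a] by (auto simp: low_def intro: coeff_eq_0)
  have "inj_on F (PiE {..<N} (\<lambda>_. low (degree n)))"
  proof (rule inj_onI)
    fix x x' assume x: "x \<in> PiE {..<N} (\<lambda>_. low (degree n))" "x' \<in> PiE {..<N} (\<lambda>_. low (degree n))"
      and eq: "F x = F x'"
    define f where "f = Ev (- 1) * ff x' + ff x"
    have fE: "f \<in> EE" unfolding f_def by (intro EE_closed Ev_EE ff)
    have "g i dvd h' f i" if "i < N" for i
    proof -
      have 1: "g i dvd h' f i - (- 1 * h' (ff x') i + h' (ff x) i)"
        using h'(1)[OF ff(1) ff(1) that, of "- 1" x' x] unfolding f_def g_def by (rule gcd_dvdI1)
      have "h' (ff x) i mod g i = h' (ff x') i mod g i"
        using fun_cong[OF eq, of i] that by (simp add: F_def)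
      then have 2: "g i dvd h' (ff x) i - h' (ff x') i" by (simp add: mod_eq_dvd_iff)
      have "h' f i = (h' f i - (- 1 * h' (ff x') i + h' (ff x) i)) + (h' (ff x) i - h' (ff x') i)" by simp
      then show ?thesis using dvd_add[OF 1 2] by metis
    qed
    then have "\<forall>i. \<exists>s t. i < N \<longrightarrow> h' f i = b' i * s + n * t"
    proof (intro allI)
      fix i
      assume a: "\<And>i. i < N \<Longrightarrow> g i dvd h' f i"
      obtain u v where uv: "u * b' i + v * n = g i" by (metis g_def bezout_coefficients_fst_snd)
      show "\<exists>s t. i < N \<longrightarrow> h' f i = b' i * s + n * t"
      proof (cases "i < N")
        case True
        then obtain k where "h' f i = g i * k" using a by blast
        then have "h' f i = b' i * (u * k) + n * (v * k)" by (simp add: uv[symmetric] algebra_simps)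
        then show ?thesis by blast
      qed auto
    qed
    then obtain s t where st: "\<And>i. i < N \<Longrightarrow> h' f i = b' i * s i + n * t i" by metis
    obtain e where e: "e \<in> EE" "\<And>i. i < N \<Longrightarrow> b' i dvd h' e i - t i" using h'(2)[of t] by blast
    \<comment> \<open>Subtracting n e leaves only multiples of the b' i, so f2 lies in A[pi] while
      it agrees with f modulo n.\<close>
    define f2 where "f2 = Ev (- n) * e + f"
    have f2E: "f2 \<in> EE" unfolding f2_def by (intro EE_closed Ev_EE fE e)
    have "b' i dvd h' f2 i" if "i < N" for i
    proof -
      have 1: "b' i dvd h' f2 i - (- n * h' e i + h' f i)"
        unfolding f2_def by (rule h'(1)[OF e(1) fE that])
      have 2: "b' i dvd - n * (h' e i - t i) + b' i * s i" using e(2)[OF that] by simp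
      have "h' f2 i = (h' f2 i - (- n * h' e i + h' f i)) + (- n * (h' e i - t i) + b' i * s i)"
        unfolding st[OF that] by (simp add: algebra_simps)
      then show ?thesis using dvd_add[OF 1 2] by metis
    qed
    then have "f2 \<in> range evP" using h'(3)[OF f2E] by blast
    then have 3: "b i dvd h f2 i" if "i < N" for i using h(3)[OF f2E] that by blast
    have "x i = x' i" if i: "i < N" for i
    proof -
      have 4: "n dvd h f2 i - (- n * h e i + h f i)"
        using h(1)[OF e(1) fE i, of "- n"] n_dvd[OF i] unfolding f2_def by (rule dvd_trans[rotated])
      have 5: "n dvd h f i - (- 1 * h (ff x') i + h (ff x) i)"
        using h(1)[OF ff(1) ff(1) i, of "- 1" x' x] n_dvd[OF i] unfolding f_def by (rule dvd_trans[rotated])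
      have 6: "n dvd h (ff x) i - x i" "n dvd h (ff x') i - x' i"
        using ff(2)[OF i] n_dvd[OF i] dvd_trans by blast+
      have 7: "n dvd h f2 i" using 3[OF i] n_dvd[OF i] dvd_trans by blast
      have "x i - x' i = h f2 i - (h f2 i - (- n * h e i + h f i)) + n * h e i
        - (h f i - (- 1 * h (ff x') i + h (ff x) i)) - (h (ff x) i - x i) + (h (ff x') i - x' i)"
        by simp
      also have "n dvd \<dots>" by (intro dvd_add dvd_diff 4 5 6 7 dvd_triv_left)
      finally have "x i mod n = x' i mod n" by (simp add: mod_eq_dvd_iff)
      moreover have "y mod n = y" if "y \<in> low (degree n)" for y
      proof -
        have "y = 0 \<or> degree y < degree n" using that unfolding low_def by (metis (mono_tags) leading_coeff_0_iff mem_Collect_eq not_le)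
        then show ?thesis by (auto simp: mod_poly_less)
      qed
      moreover have "x i \<in> low (degree n)" "x' i \<in> low (degree n)" using x i by auto
      ultimately show ?thesis by metis
    qed
    then show "x = x'" using x by (intro PiE_ext) auto
  qed
  moreover have "F ` PiE {..<N} (\<lambda>_. low (degree n)) \<subseteq> PiE {..<N} (\<lambda>i. low (degree (g i)))"
    using low_mod g0 by (auto simp: F_def)
  moreover have "finite (PiE {..<N} (\<lambda>i. low (degree (g i))))"
    by (intro finite_PiE) (auto simp: low_def card_polys)
  ultimately have "card (PiE {..<N} (\<lambda>_. low (degree n))) \<le> card (PiE {..<N} (\<lambda>i. low (degree (g i))))"
    by (rule card_inj_on_le)
  then have "q ^ (degree n * N) \<le> q ^ (\<Sum>i<N. degree (g i))"
    by (simp add: card_PiE low_def card_polys power_mult power_sum)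
  then have le: "degree n * N \<le> (\<Sum>i<N. degree (g i))" using power_increasing_iff[OF q_gt_1] by blast
  have gle: "degree (g i) \<le> degree n" for i using n0 by (intro dvd_imp_degree_le) (auto simp: g_def)
  \<comment> \<open>The N degrees on the right are each at most the degree of n, and their sum is at
    least N times it; so none can be smaller, in particular not the one at index 0.\<close>
  have "degree n \<le> degree (g 0)"
  proof (rule ccontr)
    assume "\<not> ?thesis"
    then have "(\<Sum>i<N. degree (g i)) < (\<Sum>i<N. degree n)"
      using N gle by (intro sum_strict_mono_ex1) (auto intro!: bexI[of _ 0])
    then show False using le by (simp add: mult.commute)
  qed
  then have "degree (g 0) = degree n" using gle[of 0] by simp
  moreover obtain k where k: "n = g 0 * k" using gcd_dvd2[of "b' 0" n] unfolding g_def by blast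
  ultimately have "degree k = 0" using n0 by (auto simp: degree_mult_eq)
  moreover have "k \<noteq> 0" using k n0 by auto
  ultimately have "is_unit k" by (simp add: is_unit_iff_degree)
  then have "n dvd g 0" unfolding k by (simp add: mult_unit_dvd_iff)
  then show ?thesis unfolding n_def[symmetric] g_def using dvd_trans gcd_dvd1 by blast
qed

lemma monic_dvd_antisym:
  assumes "lead_coeff a = 1" "lead_coeff b = 1" "a dvd b" "b dvd (a :: 'a poly)"
  shows "a = b"
  using assms poly_dvd_antisym[of a b] by metis

lemma rindex_unique: "rindex b \<Longrightarrow> rindex b' \<Longrightarrow> r \<ge> 2 \<Longrightarrow> b 0 = b' 0"
  using rindex_dvd[of b b'] rindex_dvd[of b' b]
  by (intro monic_dvd_antisym) (auto simp: rindex_def)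

text \<open>Multiplication by c gives every f in E coordinates in 1, pi, ..., pi^(r-1). Forgetting
  the coordinate of 1 embeds E/A as a module W of vectors, in which A[pi] becomes c times all
  vectors. If W has the elementary divisors w i, then E/A[pi] is the product of the A/(c / w i).
  Moreover pi lies in A + n E exactly if all of A[pi] does, that is, if n divides every c / w
  i.\<close>

theorem ex_rindex:
  assumes r0: "of_nat r \<noteq> (0::'a)" and r2: "r \<ge> 2"
  shows "\<exists>b. rindex b \<and> (\<forall>n. n \<noteq> 0 \<longrightarrow> n dvd b 0 \<longleftrightarrow> (\<exists>a. \<exists>\<gamma>\<in>EE. fr = Ev a + Ev n * \<gamma>))"
proof -
  define N where "N = r - 1"
  have N: "N > 0" "r = Suc N" using r2 by (auto simp: N_def)
  obtain c where c: "c \<noteq> 0" and "\<forall>f\<in>EE. \<exists>P. (\<forall>i\<ge>r. coeff P i = 0) \<and> Ev c * f = evP P"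
    using ex_conductor[OF r0] by blast
  then obtain co where co: "\<And>f i. f \<in> EE \<Longrightarrow> i \<ge> r \<Longrightarrow> coeff (co f) i = 0" "\<And>f. f \<in> EE \<Longrightarrow> Ev c * f = evP (co f)"
    by metis
  have co_eq: "co f = P" if "f \<in> EE" "Ev c * f = evP P" "\<And>i. i \<ge> r \<Longrightarrow> coeff P i = 0" for f P
  proof -
    have "co f - P = 0" by (rule evP_inj) (use that co in \<open>auto simp: evP_simps\<close>)
    then show ?thesis by simp
  qed
  have co_lin: "co (Ev a * f + g) = smult a (co f) + co g" if "f \<in> EE" "g \<in> EE" for a f g
  proof (rule co_eq)
    have "Ev c * (Ev a * f + g) = Ev a * (Ev c * f) + Ev c * g"
      by (simp only: distrib_left mult.assoc[symmetric] Ev_simps(3)[symmetric] mult.commute[of c])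
    then show "Ev c * (Ev a * f + g) = evP (smult a (co f) + co g)"
      using that co(2) by (simp add: evP_simps evP_smult)
  qed (use that co(1) in \<open>auto intro!: EE_closed Ev_EE\<close>)
  define lift where "lift v = (\<Sum>i<N. monom (v i) (Suc i))" for v :: "nat \<Rightarrow> 'a poly"
  have lift_co: "coeff (lift v) i = (case i of 0 \<Rightarrow> 0 | Suc i \<Rightarrow> if i < N then v i else 0)" for v i
    unfolding lift_def by (auto simp: coeff_sum split: nat.split)
  define wv where "wv f i = (if i < N then coeff (co f) (Suc i) else 0)" for f i
  have co_wv: "co f = [:coeff (co f) 0:] + lift (wv f)" if "f \<in> EE" for f
    using co(1)[OF that] by (intro poly_eqI) (auto simp: lift_co wv_def N(2) coeff_pCons split: nat.split)
  have wvV: "wv f \<in> vecs N" for f by (auto simp: wv_def vecs_def)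
  have wv_lin: "wv (Ev a * f + g) = (\<lambda>i. a * wv f i + wv g i)" if "f \<in> EE" "g \<in> EE" for a f g
    using co_lin[OF that] by (auto simp: wv_def fun_eq_iff)
  have liftE: "evP P \<in> EE" for P by (rule evP_EE[OF EE_closed(4)])
  have co_evP: "co (evP P) = smult c P" if "\<And>i. i \<ge> r \<Longrightarrow> coeff P i = 0" for P
    by (rule co_eq[OF liftE]) (use that in \<open>auto simp: evP_smult\<close>)
  have wv_lift: "wv (evP (lift v)) = (\<lambda>i. c * v i)" if "v \<in> vecs N" for v
  proof -
    have "co (evP (lift v)) = smult c (lift v)"
      by (rule co_evP) (auto simp: lift_co N split: nat.split)
    then show ?thesis using that by (auto simp: wv_def lift_co vecs_def fun_eq_iff)
  qed
  have wv_Ev: "wv (Ev a) = (\<lambda>_. 0)" for a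
  proof -
    have "co (Ev a) = smult c [:a:]"
      using co_evP[of "[:a:]"] r_pos by (simp add: evP_const coeff_pCons split: nat.splits)
    then show ?thesis by (auto simp: wv_def fun_eq_iff)
  qed
  have wv_0: "\<exists>b. f = Ev b" if "f \<in> EE" "wv f = (\<lambda>_. 0)" for f
  proof -
    have "lift (wv f) = 0" unfolding that(2) lift_def by simp
    then have "Ev c * f = Ev (coeff (co f) 0)" using co(2)[OF that(1)] co_wv[OF that(1)] evP_const
      by (metis add.right_neutral)
    then show ?thesis using Ev_saturated[OF that(1) c] by blast
  qed
  define W where "W = wv ` EE"
  have "submod W"
    unfolding submod_def
  proof (intro conjI ballI allI)
    show "(\<lambda>_. 0) \<in> W" using wv_Ev[of 0] Ev_EE[of 0] unfolding W_def by (metis imageI)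
    fix v w a assume "v \<in> W" "w \<in> W"
    then obtain f g where "f \<in> EE" "g \<in> EE" "v = wv f" "w = wv g" by (auto simp: W_def)
    then show "(\<lambda>i. a * v i + w i) \<in> W"
      using wv_lin[of f g a] EE_closed(1,3) Ev_EE unfolding W_def by (metis imageI)
  qed
  moreover have "(\<lambda>i. c * v i) \<in> W" if "v \<in> vecs N" for v
    using wv_lift[OF that] liftE unfolding W_def by (metis imageI)
  moreover have "W \<subseteq> vecs N" using wvV by (auto simp: W_def)
  ultimately obtain U w where U: "unimod N U" and ch: "\<And>i. Suc i < N \<Longrightarrow> w i dvd w (Suc i)"
    and W_iff: "\<And>v. v \<in> vecs N \<Longrightarrow> v \<in> W \<longleftrightarrow> (\<forall>i<N. w i dvd U v i)"
    using smith_normal_form[OF _ _ c, of W N] by blast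
  note UD = unimodD[OF U]
  have w_dvd: "w j dvd U (wv f) j" if "f \<in> EE" "j < N" for f j
    using W_iff[OF wvV] that unfolding W_def by blast
  have unit_vec: "\<exists>u\<in>vecs N. U u = (\<lambda>i. if i = j then 1 else 0)" if "j < N" for j
    by (rule UD(5)) (use that in \<open>auto simp: vecs_def\<close>)
  have w_c: "w j dvd c" if j: "j < N" for j
  proof -
    obtain u where u: "u \<in> vecs N" "U u = (\<lambda>i. if i = j then 1 else 0)" using unit_vec[OF j] by blast
    have "w j dvd U (wv (evP (lift u))) j" by (rule w_dvd[OF liftE j])
    then show ?thesis unfolding wv_lift[OF u(1)] UD(3) u(2) by simp
  qed
  define e where "e j = c div w j" for j
  have e: "c = w j * e j" if "j < N" for j using w_c[OF that] by (simp add: e_def)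
  have w0: "w j \<noteq> 0" and e0: "e j \<noteq> 0" if "j < N" for j using e[OF that] c by auto
  \<comment> \<open>Since w i divides w (i + 1), the quotients c / w i form a chain in the opposite
    direction.\<close>
  define \<rho> where "\<rho> i = N - Suc i" for i
  have \<rho>: "i < N \<Longrightarrow> \<rho> i < N" "i < N \<Longrightarrow> \<rho> (\<rho> i) = i" for i by (auto simp: \<rho>_def)
  define b where "b i = smult (inverse (lead_coeff (e (\<rho> i)))) (e (\<rho> i))" for i
  have b_dvd: "b i dvd x \<longleftrightarrow> e (\<rho> i) dvd x" if "i < N" for i x
    using e0[OF \<rho>(1)[OF that]] by (simp add: b_def smult_dvd_iff)
  have dvd_b: "x dvd b i \<longleftrightarrow> x dvd e (\<rho> i)" if "i < N" for i x
    using e0[OF \<rho>(1)[OF that]] by (simp add: b_def dvd_smult_iff)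
  define h where "h f i = U (wv f) (\<rho> i) div w (\<rho> i)" for f i
  have h: "U (wv f) (\<rho> i) = w (\<rho> i) * h f i" if "f \<in> EE" "i < N" for f i
    using w_dvd[OF that(1) \<rho>(1)[OF that(2)]] by (simp add: h_def)
  have kernel: "f \<in> range evP \<longleftrightarrow> (\<forall>i<N. b i dvd h f i)" if f: "f \<in> EE" for f
  proof
    assume "f \<in> range evP"
    then obtain P where P: "\<And>i. i \<ge> r \<Longrightarrow> coeff P i = 0" "f = evP P" using evP_reduce by (metis imageE)
    define v where "v i = (if i < N then coeff P (Suc i) else 0)" for i
    have vV: "v \<in> vecs N" by (auto simp: v_def vecs_def)
    have wf: "wv f = (\<lambda>i. c * v i)" using co_evP[OF P(1)] by (auto simp: P(2) wv_def v_def fun_eq_iff)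
    show "\<forall>i<N. b i dvd h f i"
    proof (intro allI impI)
      fix i assume i: "i < N"
      have "w (\<rho> i) * h f i = c * U v (\<rho> i)" using h[OF f i] unfolding wf UD(3) by simp
      also have "\<dots> = w (\<rho> i) * (e (\<rho> i) * U v (\<rho> i))" using e[OF \<rho>(1)[OF i]] by (simp add: mult.assoc)
      finally have "h f i = e (\<rho> i) * U v (\<rho> i)" using w0[OF \<rho>(1)[OF i]] by simp
      then show "b i dvd h f i" using b_dvd[OF i] by simp
    qed
  next
    assume a: "\<forall>i<N. b i dvd h f i"
    have "c dvd U (wv f) j" for j
    proof (cases "j < N")
      case True
      then have "e j dvd h f (\<rho> j)" using a b_dvd[OF \<rho>(1)[OF True]] \<rho> by auto
      then have "w j * e j dvd w j * h f (\<rho> j)" by simp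
      then show ?thesis using h[OF f \<rho>(1)[OF True]] e[OF True] \<rho>(2)[OF True] by simp
    next
      case False then show ?thesis using UD(4)[OF wvV[of f]] by (simp add: vecs_def)
    qed
    then have x: "U (wv f) = (\<lambda>j. c * (U (wv f) j div c))" by (auto simp: fun_eq_iff)
    moreover have "(\<lambda>j. U (wv f) j div c) \<in> vecs N" using UD(4)[OF wvV[of f]] by (auto simp: vecs_def)
    then obtain v where v: "v \<in> vecs N" "U v = (\<lambda>j. U (wv f) j div c)" using UD(5) by blast
    ultimately have "U (wv f) = U (\<lambda>i. c * v i)" using UD(3)[of c v] v(2) by (metis (no_types))
    then have "wv f = (\<lambda>i. c * v i)" using UD(6)[OF wvV] v(1) by (auto simp: vecs_def)
    \<comment> \<open>The difference of f and the lifted vector has no coordinate besides that of 1,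
      so it lies in A by saturation.\<close>
    then have "wv (Ev (- 1) * evP (lift v) + f) = (\<lambda>_. 0)"
      using wv_lin[OF liftE f, of "- 1" "lift v"] wv_lift[OF v(1)] by simp
    then obtain x where "Ev (- 1) * evP (lift v) + f = Ev x"
      using wv_0[of "Ev (- 1) * evP (lift v) + f"] EE_closed(1,3) Ev_EE liftE f by blast
    then have "f = evP ([:x:] + lift v)" by (simp add: evP_simps(2) evP_const Ev_simps algebra_simps)
    then show "f \<in> range evP" by blast
  qed
  have "rindex b"
    unfolding rindex_def N_def[symmetric]
  proof (intro conjI allI impI exI[of _ h] ballI)
    fix i assume "i < N" then show "lead_coeff (b i) = 1"
      using e0[OF \<rho>(1)] by (simp add: b_def)
  next
    fix i assume i: "Suc i < N"
    then have "w (\<rho> (Suc i)) dvd w (\<rho> i)" using ch[of "\<rho> (Suc i)"] by (simp add: \<rho>_def Suc_diff_Suc)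
    then obtain k where k: "w (\<rho> i) = w (\<rho> (Suc i)) * k" by blast
    have "w (\<rho> (Suc i)) * e (\<rho> (Suc i)) = w (\<rho> (Suc i)) * (k * e (\<rho> i))"
      using e[of "\<rho> i"] e[of "\<rho> (Suc i)"] \<rho>(1)[of i] \<rho>(1)[of "Suc i"] i by (simp add: k mult.assoc)
    then have "e (\<rho> (Suc i)) = k * e (\<rho> i)" using w0[OF \<rho>(1)[OF i]] by simp
    then show "b i dvd b (Suc i)" using b_dvd[of i] dvd_b[OF i] i by simp
  next
    fix f g a i assume fg: "f \<in> EE" "g \<in> EE" and i: "i < N"
    have "w (\<rho> i) * h (Ev a * f + g) i = w (\<rho> i) * (a * h f i + h g i)"
    proof -
      have "w (\<rho> i) * h (Ev a * f + g) i = U (wv (Ev a * f + g)) (\<rho> i)"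
        by (rule h[symmetric]) (auto intro!: EE_closed Ev_EE fg i)
      also have "\<dots> = a * (w (\<rho> i) * h f i) + w (\<rho> i) * h g i"
        by (simp only: wv_lin[OF fg] UD(1) h[OF fg(1) i] h[OF fg(2) i])
      finally show ?thesis by (simp add: algebra_simps)
    qed
    then have "h (Ev a * f + g) i = a * h f i + h g i" using w0[OF \<rho>(1)[OF i]] by simp
    then show "b i dvd h (Ev a * f + g) i - (a * h f i + h g i)" by simp
  next
    fix x :: "nat \<Rightarrow> 'a poly"
    have "(\<lambda>j. if j < N then w j * x (\<rho> j) else 0) \<in> vecs N" by (auto simp: vecs_def)
    then obtain u where u: "u \<in> vecs N" "U u = (\<lambda>j. if j < N then w j * x (\<rho> j) else 0)" using UD(5) by blast
    then have "u \<in> W" using W_iff by auto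
    then obtain f where f: "f \<in> EE" "u = wv f" by (auto simp: W_def)
    have "h f i = x i" if "i < N" for i
      using h[OF f(1) that] u(2) w0[OF \<rho>(1)[OF that]] \<rho>[OF that] by (simp add: f(2))
    then show "\<exists>f\<in>EE. \<forall>i<N. b i dvd h f i - x i" using f(1) by (intro bexI[of _ f]) auto
  qed (use kernel in blast)
  have char: "n dvd b 0 \<longleftrightarrow> (\<exists>a. \<exists>\<gamma>\<in>EE. fr = Ev a + Ev n * \<gamma>)" if n0: "n \<noteq> 0" for n
  proof
    assume "n dvd b 0"
    then have n_e: "n dvd e j" if "j < N" for j
    proof -
      have "b 0 dvd b (\<rho> j)"
        by (rule chain_dvd[of N]) (use \<open>rindex b\<close> \<rho>(1)[OF that] in \<open>auto simp: rindex_def N_def\<close>)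
      then have "n dvd b (\<rho> j)" using \<open>n dvd b 0\<close> dvd_trans by blast
      then show ?thesis using dvd_b[OF \<rho>(1)[OF that]] \<rho>(2)[OF that] by simp
    qed
    \<comment> \<open>The coordinate vector of pi before scaling by c.\<close>
    define e0 :: "nat \<Rightarrow> 'a poly" where "e0 i = (if i = 0 then 1 else 0)" for i
    have e0V: "e0 \<in> vecs N" using N by (auto simp: e0_def vecs_def)
    have "lift e0 = (\<Sum>i<N. if i = 0 then [:0, 1:] else 0)"
      unfolding lift_def e0_def by (intro sum.cong) (auto simp: monom_Suc)
    then have "lift e0 = [:0, 1:]" using N by simp
    then have wfr: "wv fr = (\<lambda>i. c * e0 i)" using wv_lift[OF e0V] by (simp add: evP_X)
    have nd: "n dvd U (wv fr) j" if "j < N" for j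
      unfolding wfr UD(3) e[OF that] using n_e[OF that] by simp
    have "(\<lambda>j. U (wv fr) j div n) \<in> vecs N" using UD(4)[OF wvV[of fr]] by (auto simp: vecs_def)
    then obtain u where u: "u \<in> vecs N" "U u = (\<lambda>j. U (wv fr) j div n)" using UD(5) by blast
    have "w j dvd U u j" if j: "j < N" for j
    proof -
      obtain k where k: "e j = n * k" using n_e[OF j] by blast
      have "U (wv fr) j = n * (w j * (k * U e0 j))" unfolding wfr UD(3) e[OF j] by (simp add: k)
      then show ?thesis unfolding u(2) using n0 by simp
    qed
    then have "u \<in> W" using W_iff[OF u(1)] by blast
    then obtain \<gamma> where g: "\<gamma> \<in> EE" "u = wv \<gamma>" by (auto simp: W_def)
    have "U (\<lambda>i. n * u i) = U (wv fr)"
      unfolding UD(3) u(2)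
    proof
      fix j show "n * (U (wv fr) j div n) = U (wv fr) j"
        using nd[of j] UD(4)[OF wvV[of fr]] by (cases "j < N") (auto simp: vecs_def)
    qed
    then have nu: "(\<lambda>i. n * u i) = wv fr" using UD(6)[OF _ wvV] u(1) by (auto simp: vecs_def)
    have "wv (Ev (- n) * \<gamma> + fr) = (\<lambda>_. 0)"
      using wv_lin[OF g(1) EE_closed(4), of "- n"] g(2) nu by (auto simp: fun_eq_iff)
    then obtain a where "Ev (- n) * \<gamma> + fr = Ev a"
      using wv_0[of "Ev (- n) * \<gamma> + fr"] EE_closed(1,3,4) Ev_EE g(1) by blast
    then have "fr = Ev a + Ev n * \<gamma>" by (simp add: Ev_simps algebra_simps)
    then show "\<exists>a. \<exists>\<gamma>\<in>EE. fr = Ev a + Ev n * \<gamma>" using g(1) by blast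
  next
    assume "\<exists>a. \<exists>\<gamma>\<in>EE. fr = Ev a + Ev n * \<gamma>"
    then obtain a \<gamma> where g: "\<gamma> \<in> EE" "fr = Ev a + Ev n * \<gamma>" by blast
    \<comment> \<open>Horner's scheme: if pi lies in A + n E, so does every polynomial in pi,
      because the image of A commutes with E.\<close>
    have all: "\<exists>x. \<exists>y\<in>EE. evP P = Ev n * y + Ev x" for P
    proof (induction P)
      case 0 then show ?case using EE_closed(6) by (intro exI[of _ 0] bexI[of _ 0]) (auto simp: evP_simps Ev_simps)
    next
      case (pCons z P)
      then obtain x y where xy: "y \<in> EE" "evP P = Ev n * y + Ev x" by blast
      have "evP (pCons z P) = Ev z + (fr * (Ev n * y) + Ev a * Ev x + Ev n * \<gamma> * Ev x)"
      proof -
        have "fr * Ev x = Ev a * Ev x + Ev n * \<gamma> * Ev x"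
          using arg_cong[OF g(2), of "\<lambda>z. z * Ev x"] by (simp only: distrib_right)
        then show ?thesis unfolding evP_pCons xy(2) by (simp only: distrib_left add.assoc)
      qed
      also have "fr * (Ev n * y) = Ev n * (fr * y)"
        by (simp only: mult.assoc[symmetric] Ev_commute[OF EE_closed(4)])
      finally have "evP (pCons z P) = Ev n * (fr * y + \<gamma> * Ev x) + Ev (z + a * x)"
        by (simp add: Ev_simps algebra_simps)
      moreover have "fr * y + \<gamma> * Ev x \<in> EE" by (intro EE_closed xy g Ev_EE)
      ultimately show ?case by blast
    qed
    have j: "\<rho> 0 < N" using \<rho>(1) N by blast
    \<comment> \<open>An element of A[pi] whose vector is mapped by U to c times one unit vector. It
      is chosen at \<rho> 0, where c / w has its smallest value in the chain, namely b 0 up to a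
      constant.\<close>
    obtain u where u: "u \<in> vecs N" "U u = (\<lambda>i. if i = \<rho> 0 then 1 else 0)" using unit_vec[OF j] by blast
    obtain x y where xy: "y \<in> EE" "evP (lift u) = Ev n * y + Ev x" using all by blast
    have "(\<lambda>i. c * u i) = (\<lambda>i. n * wv y i)"
      using wv_lift[OF u(1)] wv_lin[OF xy(1) Ev_EE, of n x] by (simp add: xy(2) wv_Ev)
    then have "U (\<lambda>i. c * u i) (\<rho> 0) = U (\<lambda>i. n * wv y i) (\<rho> 0)" by simp
    then have "c = n * U (wv y) (\<rho> 0)" unfolding UD(3) u(2) by simp
    also have "U (wv y) (\<rho> 0) = w (\<rho> 0) * h y 0" by (rule h[OF xy(1) N(1)])
    finally have "w (\<rho> 0) * e (\<rho> 0) = w (\<rho> 0) * (n * h y 0)" using e[OF j] by (simp add: algebra_simps)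
    then have "e (\<rho> 0) = n * h y 0" using w0[OF j] by simp
    then show "n dvd b 0" using dvd_b[OF N(1)] by simp
  qed
  with \<open>rindex b\<close> show ?thesis by blast
qed


text \<open>For x in E commuting with tau^d, both \<gamma> x and x \<gamma> become x (fr - 1) after
  multiplication by \<open>Ev n\<close> on the right, and \<open>Ev n\<close> can be
  cancelled.\<close>

lemma divisor_of_fr_minus_1_EE:
  assumes n: "n \<noteq> 0" and c: "\<gamma> * Ev n = fr - 1"
  shows "\<gamma> \<in> EE"
proof -
  have "\<gamma> * x = x * \<gamma>" if x: "x \<in> EE" "fr * x = x * fr" for x
  proof -
    have "(\<gamma> * x) * Ev n = \<gamma> * Ev n * x" by (simp only: mult.assoc Ev_commute[OF x(1)])
    also have "\<dots> = x * (fr - 1)" using x(2) by (simp add: c algebra_simps)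
    also have "\<dots> = (x * \<gamma>) * Ev n" by (simp only: c[symmetric] mult.assoc)
    finally show ?thesis using n by simp
  qed
  then show ?thesis using \<Phi>_EE \<Phi>_fr EE_closed(4) by (simp add: EE_def)
qed

theorem divides_iff_divisor_of_fr_minus_1:
  assumes r0: "of_nat r \<noteq> (0::'a)" and r2: "r \<ge> 2" and n: "n \<noteq> 0" and m: "is_cp m" and b: "rindex b"
  shows "n dvd coeff m (r - 1) + of_nat r \<and> n dvd b 0 \<longleftrightarrow> (\<exists>\<gamma>. \<gamma> * Ev n = fr - 1)"
proof -
  obtain b' where b': "rindex b'"
    and char: "\<And>n. n \<noteq> 0 \<Longrightarrow> n dvd b' 0 \<longleftrightarrow> (\<exists>a. \<exists>\<gamma>\<in>EE. fr = Ev a + Ev n * \<gamma>)"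
    using ex_rindex[OF r0 r2] by blast
  have bb: "b 0 = b' 0" by (rule rindex_unique[OF b b' r2])
  show ?thesis
  proof
    assume A: "n dvd coeff m (r - 1) + of_nat r \<and> n dvd b 0"
    then obtain a \<gamma> where g: "\<gamma> \<in> EE" "fr = Ev a + Ev n * \<gamma>" using char[OF n] bb by auto
    have "n dvd coeff m (r - 1) + of_nat r * a" by (rule cp_coeff_shift[OF m g])
    \<comment> \<open>The two congruences for the same coefficient differ by r (a - 1), and r is
      invertible in F_q; hence a = 1 modulo n.\<close>
    then have "n dvd (coeff m (r - 1) + of_nat r * a) - (coeff m (r - 1) + of_nat r)"
      using A dvd_diff by blast
    also have "(coeff m (r - 1) + of_nat r * a) - (coeff m (r - 1) + of_nat r) = smult (of_nat r) (a - 1)"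
      by (simp add: of_nat_poly smult_diff_right)
    finally have "n dvd a - 1" using r0 by (simp add: dvd_smult_iff)
    then obtain k where k: "a - 1 = n * k" by blast
    have "fr - 1 = Ev (a - 1) + Ev n * \<gamma>" by (simp add: g(2) Ev_simps)
    also have "\<dots> = Ev n * (Ev k + \<gamma>)" by (simp add: k Ev_simps distrib_left)
    also have "\<dots> = (Ev k + \<gamma>) * Ev n" by (rule Ev_commute) (intro EE_closed Ev_EE g)
    finally show "\<exists>\<gamma>. \<gamma> * Ev n = fr - 1" by metis
  next
    assume "\<exists>\<gamma>. \<gamma> * Ev n = fr - 1"
    then obtain \<gamma> where c: "\<gamma> * Ev n = fr - 1" by blast
    have g: "\<gamma> \<in> EE" by (rule divisor_of_fr_minus_1_EE[OF n c])
    have f: "fr = Ev 1 + Ev n * \<gamma>" using c Ev_commute[OF g, of n] by (simp add: Ev_simps)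
    show "n dvd coeff m (r - 1) + of_nat r \<and> n dvd b 0"
      using cp_coeff_shift[OF m g f] char[OF n] g f bb by auto
  qed
qed

end

section \<open>Reduction modulo p\<close>

context residue_field begin

abbreviation PI :: "'a poly fract \<Rightarrow> bool" where "PI \<equiv> p_integral p"

text \<open>\<open>red\<close> chooses a residue for some way of writing x as a fraction.
  Cross-multiplication shows that its value in the residue field is the quotient belonging to any
  such fraction.\<close>

lemma red_spec:
  assumes x: "x = Fract u v" "\<not> p dvd v"
  shows "red p x mod p = red p x" "ev \<theta> (red p x) = ev \<theta> u / ev \<theta> v"
proof -
  let ?R = "\<lambda>y. y mod p = y \<and> (\<exists>u v. x = Fract u v \<and> v \<noteq> 0 \<and> \<not> p dvd v \<and> p dvd (y * v - u))"
  have v0: "v \<noteq> 0" using x by auto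
  have ev_v: "ev \<theta> v \<noteq> 0" using x ev_eq_0_iff by simp
  obtain w where w: "ev \<theta> v * ev \<theta> w = 1" using KK_inverse[of "ev \<theta> v"] ev_v by auto
  have "ev \<theta> (((u * w) mod p) * v - u) = 0" using w by (simp add: algebra_simps)
  then have "p dvd ((u * w) mod p) * v - u" using ev_eq_0_iff by blast
  then have "?R ((u * w) mod p)" using x v0 by auto
  then have R: "?R (red p x)" unfolding red_def by (rule someI)
  then show "red p x mod p = red p x" by blast
  obtain u' v' where uv: "x = Fract u' v'" "v' \<noteq> 0" "\<not> p dvd v'" "p dvd (red p x * v' - u')" using R by blast
  have "u * v' = u' * v" using x uv v0 by (simp add: eq_fract)
  then have "ev \<theta> u * ev \<theta> v' = ev \<theta> u' * ev \<theta> v" by (metis ev_simps(4))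
  moreover have "ev \<theta> (red p x) * ev \<theta> v' = ev \<theta> u'" using uv(4) ev_eq_0_iff[of "red p x * v' - u'"] by simp
  moreover have "ev \<theta> v' \<noteq> 0" using uv(3) ev_eq_0_iff by blast
  ultimately have "ev \<theta> u * ev \<theta> v' = (ev \<theta> (red p x) * ev \<theta> v) * ev \<theta> v'" "ev \<theta> v' \<noteq> 0"
    by (simp_all add: mult_ac)
  then have "ev \<theta> u = ev \<theta> (red p x) * ev \<theta> v" by simp
  then show "ev \<theta> (red p x) = ev \<theta> u / ev \<theta> v" using ev_v by simp
qed

text \<open>Reduction of the local ring at p, with values in the residue field as a subset of the
  closure of F_q.\<close>

definition rd :: "'a poly fract \<Rightarrow> 'a alg_closure" where "rd x = ev \<theta> (red p x)"

lemma rd_Fract: "\<not> p dvd v \<Longrightarrow> rd (Fract u v) = ev \<theta> u / ev \<theta> v"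
  unfolding rd_def by (rule red_spec(2)[OF refl])

lemma PI_E: assumes "PI x" obtains u v where "x = Fract u v" "v \<noteq> 0" "\<not> p dvd v" "rd x = ev \<theta> u / ev \<theta> v" "ev \<theta> v \<noteq> 0"
proof -
  obtain u v where uv: "x = Fract u v" "v \<noteq> 0" "\<not> p dvd v" using assms by (auto simp: p_integral_def)
  moreover have "rd x = ev \<theta> u / ev \<theta> v" using rd_Fract uv by simp
  moreover have "ev \<theta> v \<noteq> 0" using uv ev_eq_0_iff by simp
  ultimately show ?thesis using that by blast
qed

lemma red_reduced: assumes "PI x" shows "red p x mod p = red p x"
proof -
  obtain u v where "x = Fract u v" "\<not> p dvd v" using PI_E[OF assms] .
  then show ?thesis by (rule red_spec(1))
qed

lemma PI_to_fract: "PI (to_fract a)" and rd_to_fract: "rd (to_fract a) = ev \<theta> a"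
proof -
  have 1: "\<not> p dvd 1" using ev_eq_0_iff[of 1] by simp
  then show "PI (to_fract a)" unfolding p_integral_def to_fract_def by (intro exI[of _ a] exI[of _ 1]) auto
  show "rd (to_fract a) = ev \<theta> a" unfolding to_fract_def using rd_Fract[OF 1, of a] by simp
qed

lemma PI_add: "PI x \<Longrightarrow> PI y \<Longrightarrow> PI (x + y) \<and> rd (x + y) = rd x + rd y"
proof -
  assume x: "PI x" and y: "PI y"
  obtain u v where uv: "x = Fract u v" "v \<noteq> 0" "\<not> p dvd v" "rd x = ev \<theta> u / ev \<theta> v" "ev \<theta> v \<noteq> 0" using PI_E[OF x] .
  obtain s t where st: "y = Fract s t" "t \<noteq> 0" "\<not> p dvd t" "rd y = ev \<theta> s / ev \<theta> t" "ev \<theta> t \<noteq> 0" using PI_E[OF y] .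
  have e: "x + y = Fract (u * t + s * v) (v * t)" using uv st by (simp add: algebra_simps)
  have nd: "\<not> p dvd v * t" using uv st prime_p prime_dvd_mult_iff by blast
  have "PI (x + y)" unfolding p_integral_def e using nd uv st by (intro exI conjI refl) auto
  moreover have "rd (x + y) = rd x + rd y"
    unfolding e rd_Fract[OF nd] uv(4) st(4) using uv(5) st(5) by (simp add: add_frac_eq)
  ultimately show ?thesis by blast
qed

lemma PI_mult: "PI x \<Longrightarrow> PI y \<Longrightarrow> PI (x * y) \<and> rd (x * y) = rd x * rd y"
proof -
  assume x: "PI x" and y: "PI y"
  obtain u v where uv: "x = Fract u v" "v \<noteq> 0" "\<not> p dvd v" "rd x = ev \<theta> u / ev \<theta> v" "ev \<theta> v \<noteq> 0" using PI_E[OF x] .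
  obtain s t where st: "y = Fract s t" "t \<noteq> 0" "\<not> p dvd t" "rd y = ev \<theta> s / ev \<theta> t" "ev \<theta> t \<noteq> 0" using PI_E[OF y] .
  have e: "x * y = Fract (u * s) (v * t)" using uv st by simp
  have nd: "\<not> p dvd v * t" using uv st prime_p prime_dvd_mult_iff by blast
  have "PI (x * y)" unfolding p_integral_def e using nd uv st by (intro exI conjI refl) auto
  moreover have "rd (x * y) = rd x * rd y"
    unfolding e rd_Fract[OF nd] uv(4) st(4) by simp
  ultimately show ?thesis by blast
qed

lemma PI_0: "PI 0" "rd 0 = 0" and PI_1: "PI 1" "rd 1 = 1"
  using PI_to_fract[of 0] rd_to_fract[of 0] PI_to_fract[of 1] rd_to_fract[of 1] by simp_all

lemma PI_power: "PI x \<Longrightarrow> PI (x ^ n) \<and> rd (x ^ n) = rd x ^ n"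
  by (induction n) (auto simp: PI_1 PI_mult)

lemma PI_sum: "(\<And>i. i \<in> I \<Longrightarrow> PI (f i)) \<Longrightarrow> PI (\<Sum>i\<in>I. f i) \<and> rd (\<Sum>i\<in>I. f i) = (\<Sum>i\<in>I. rd (f i))"
  by (induction I rule: infinite_finite_induct) (auto simp: PI_0 PI_add)

lemma PI_uminus: "PI x \<Longrightarrow> PI (- x) \<and> rd (- x) = - rd x"
  using PI_mult[of x "to_fract (- 1)"] PI_to_fract[of "- 1"] rd_to_fract[of "- 1"] by simp

lemma PI_diff: "PI x \<Longrightarrow> PI y \<Longrightarrow> PI (x - y) \<and> rd (x - y) = rd x - rd y"
  using PI_add[of x "- y"] PI_uminus[of y] by simp

lemma red_0: "red p 0 = 0"
  using red_reduced[OF PI_0(1)] PI_0(2) ev_inj_reduced[of "red p 0" 0] by (simp add: rd_def)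

lemma rd_eq_0: "PI x \<Longrightarrow> rd x = 0 \<Longrightarrow> \<exists>y. PI y \<and> x = to_fract p * y"
proof -
  assume x: "PI x" "rd x = 0"
  obtain u v where uv: "x = Fract u v" "v \<noteq> 0" "\<not> p dvd v" "rd x = ev \<theta> u / ev \<theta> v" "ev \<theta> v \<noteq> 0" using PI_E[OF x(1)] .
  then have "ev \<theta> u = 0" using x(2) by simp
  then obtain k where k: "u = p * k" using ev_eq_0_iff by blast
  have "x = to_fract p * Fract k v" unfolding uv(1) k to_fract_def by simp
  moreover have "PI (Fract k v)" using uv by (auto simp: p_integral_def)
  ultimately show ?thesis by blast
qed

text \<open>The passage from polynomials over residues to twisted polynomials over the residue
  field; \<open>trF\<close> does the same for coefficients in the local ring. Both turn skew
  products into products.\<close>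

definition tr :: "'a poly poly \<Rightarrow> 'a twist" where "tr f = Abs_twist (map_poly (ev \<theta>) f)"
definition trF :: "'a poly fract poly \<Rightarrow> 'a twist" where "trF f = Abs_twist (map_poly rd f)"

definition PIp :: "'a poly fract poly \<Rightarrow> bool" where "PIp f \<longleftrightarrow> (\<forall>k. PI (coeff f k))"

lemma tcoeff_tr [simp]: "tcoeff (tr f) k = ev \<theta> (coeff f k)"
  by (simp add: tr_def coeff_map_poly)

lemma tcoeff_trF [simp]: "tcoeff (trF f) k = rd (coeff f k)"
  by (simp add: trF_def coeff_map_poly PI_0)

lemma tr_add: "tr (f + g) = tr f + tr g" by (rule twist_eqI) simp

lemma tr_0 [simp]: "tr 0 = 0" by (rule twist_eqI) simp

lemma tr_1 [simp]: "tr 1 = 1" by (rule twist_eqI) simp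

lemma tr_skew_mult: "tr (skew_mult q f g) = tr f * tr g"
  by (rule twist_eqI) (simp add: coeff_skew_mult[OF q_pos] tcoeff_mult_q ev_sum)

definition reduced :: "'a poly poly \<Rightarrow> bool" where "reduced f \<longleftrightarrow> (\<forall>k. coeff f k mod p = coeff f k)"

lemma coeff_rmult: "coeff (rmult p q f g) k = coeff (skew_mult q f g) k mod p"
  by (simp add: rmult_def coeff_map_poly)

lemma tr_rmult: "tr (rmult p q f g) = tr f * tr g"
  unfolding tr_skew_mult[symmetric] by (rule twist_eqI) (simp add: coeff_rmult)

lemma reduced_rmult: "reduced (rmult p q f g)" by (simp add: reduced_def coeff_rmult)

lemma reduced_add: "reduced f \<Longrightarrow> reduced g \<Longrightarrow> reduced (f + g)"
  by (simp add: reduced_def mod_p_eq_iff)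

lemma reduced_0: "reduced 0" by (simp add: reduced_def)

lemma reduced_sum: "(\<And>i. i \<in> I \<Longrightarrow> reduced (f i)) \<Longrightarrow> reduced (\<Sum>i\<in>I. f i)"
  by (induction I rule: infinite_finite_induct) (auto simp: reduced_add reduced_0)

lemma tr_inj: "reduced f \<Longrightarrow> reduced g \<Longrightarrow> tr f = tr g \<longleftrightarrow> f = g"
proof
  assume fg: "reduced f" "reduced g" "tr f = tr g"
  show "f = g"
  proof (rule poly_eqI)
    fix k
    have "ev \<theta> (coeff f k) = ev \<theta> (coeff g k)"
      using arg_cong[OF fg(3), of "\<lambda>z. tcoeff z k"] by simp
    then show "coeff f k = coeff g k"
      using fg(1,2) ev_inj_reduced[of "coeff f k" "coeff g k"] by (simp add: reduced_def)
  qed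
qed simp

lemma tr_surj: assumes "\<And>k. tcoeff F k \<in> KK" shows "\<exists>f. reduced f \<and> tr f = F"
proof -
  have "\<forall>k. \<exists>a. a mod p = a \<and> ev \<theta> a = tcoeff F k"
  proof
    fix k
    have "tcoeff F k \<in> ev \<theta> ` {a. \<forall>i\<ge>d. coeff a i = 0}" using assms KK_eq by simp
    then show "\<exists>a. a mod p = a \<and> ev \<theta> a = tcoeff F k" unfolding mod_p_eq_iff by auto
  qed
  then obtain a where a: "\<And>k. a k mod p = a k" "\<And>k. ev \<theta> (a k) = tcoeff F k" by metis
  define f where "f = (\<Sum>k\<le>tdeg F. monom (a k) k)"
  have "coeff f k = (if k \<le> tdeg F then a k else 0)" for k by (simp add: f_def coeff_sum)
  then have "reduced f" "tr f = F"
    using a by (auto simp: reduced_def intro!: twist_eqI simp: tcoeff_above_tdeg)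
  then show ?thesis by blast
qed

lemma tr_sum: "tr (\<Sum>i\<in>I. f i) = (\<Sum>i\<in>I. tr (f i))"
  by (induction I rule: infinite_finite_induct) (auto simp: tr_add)

lemma tr_rpow: "tr (rpow p q f k) = tr f ^ k"
  by (induction k) (auto simp: tr_rmult)

lemma tr_frob: "tr (frob p) = tmonom 1 d"
  by (rule twist_eqI) (simp add: frob_def)

lemma trF_skew_mult: "PIp f \<Longrightarrow> PIp g \<Longrightarrow> PIp (skew_mult q f g) \<and> trF (skew_mult q f g) = trF f * trF g"
proof -
  assume fg: "PIp f" "PIp g"
  have t: "PI (coeff f i * coeff g j ^ n) \<and> rd (coeff f i * coeff g j ^ n) = rd (coeff f i) * rd (coeff g j) ^ n" for i j n
    using fg PI_mult PI_power by (simp add: PIp_def)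
  have "PI (coeff (skew_mult q f g) k) \<and> rd (coeff (skew_mult q f g) k) =
    (\<Sum>i\<le>k. rd (coeff f i) * rd (coeff g (k - i)) ^ (q ^ i))" for k
    unfolding coeff_skew_mult[OF q_pos] using t PI_sum[of "{..k}" "\<lambda>i. coeff f i * coeff g (k - i) ^ (q ^ i)"] by simp
  then show ?thesis by (auto simp: PIp_def intro!: twist_eqI simp: tcoeff_mult_q)
qed

lemma trF_skew_pow: "PIp f \<Longrightarrow> PIp (skew_pow q f k) \<and> trF (skew_pow q f k) = trF f ^ k"
proof (induction k)
  case 0 then show ?case by (auto simp: PIp_def PI_0 PI_1 intro!: twist_eqI)
next
  case (Suc k) then show ?case by (simp add: trF_skew_mult)
qed

lemma tr_red: "PIp f \<Longrightarrow> reduced (map_poly (red p) f) \<and> tr (map_poly (red p) f) = trF f"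
  by (auto simp: reduced_def PIp_def coeff_map_poly red_0 red_reduced rd_def intro!: twist_eqI)

end

section \<open>Good reduction: the given notions expressed by twisted polynomials\<close>

locale good_reduction = residue_field p \<theta> q
  for p :: "'a::{finite,field_gcd} poly" and \<theta> q +
  fixes phiT :: "'a poly fract poly" and r :: nat
  assumes drinfeld: "drinfeld_module r phiT" and good: "p \<in> good_primes r phiT"
begin

lemma PIp_phiT: "PIp phiT" using good by (simp add: good_primes_def PIp_def)

lemma rd_lead: "rd (coeff phiT r) \<noteq> 0"
proof -
  obtain u v where "coeff phiT r = Fract u v" "v \<noteq> 0" "\<not> p dvd v" "\<not> p dvd u"
    using good by (auto simp: good_primes_def p_unit_def)
  then show ?thesis using rd_Fract[of v u] ev_eq_0_iff by simp
qed

sublocale reduced_module p \<theta> q "trF phiT" r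
proof
  show "tcoeff (trF phiT) 0 = \<theta>" using drinfeld by (simp add: drinfeld_module_def rd_to_fract)
  show "tdeg (trF phiT) = r"
  proof (rule antisym)
    show "tdeg (trF phiT) \<le> r"
      using drinfeld by (intro tdeg_le) (auto simp: drinfeld_module_def coeff_eq_0 PI_0)
    show "r \<le> tdeg (trF phiT)" using rd_lead tcoeff_above_tdeg[of "trF phiT" r] by force
  qed
  show "1 \<le> r" using drinfeld by (simp add: drinfeld_module_def)
  show "tcoeff (trF phiT) k \<in> KK" for k by (simp add: rd_def)
qed

lemma phi_of_PI: "PIp (phi_of phiT a) \<and> trF (phi_of phiT a) = Ev a"
proof -
  let ?s = "\<lambda>k. smult (to_fract [:coeff a k:]) (skew_pow q phiT k)"
  have s: "PIp (?s k) \<and> trF (?s k) = cst (coeff a k) * trF phiT ^ k" for k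
  proof -
    have P: "PIp (skew_pow q phiT k)" "trF (skew_pow q phiT k) = trF phiT ^ k"
      using trF_skew_pow[OF PIp_phiT] by auto
    have "PI (coeff (?s k) i) \<and> rd (coeff (?s k) i) = to_ac (coeff a k) * rd (coeff (skew_pow q phiT k) i)" for i
      using P(1) PI_mult[of "to_fract [:coeff a k:]" "coeff (skew_pow q phiT k) i"]
      by (simp add: PIp_def PI_to_fract rd_to_fract)
    then show ?thesis
      unfolding P(2)[symmetric]
      by (auto simp: PIp_def cst_def tcoeff_tmonom_mult intro!: twist_eqI)
  qed
  have "PI (coeff (phi_of phiT a) i) \<and> rd (coeff (phi_of phiT a) i) = tcoeff (Ev a) i" for i
  proof -
    have "PI (\<Sum>k\<le>degree a. coeff (?s k) i) \<and> rd (\<Sum>k\<le>degree a. coeff (?s k) i) = (\<Sum>k\<le>degree a. rd (coeff (?s k) i))"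
      by (rule PI_sum) (use s in \<open>auto simp: PIp_def\<close>)
    moreover have "rd (coeff (?s k) i) = tcoeff (cst (coeff a k) * trF phiT ^ k) i" for k
      using s[of k] by (metis tcoeff_trF)
    ultimately show ?thesis
      unfolding phi_of_def q_card[symmetric] Ev_def peval_def coeff_sum tcoeff_sum by simp
  qed
  then show ?thesis by (auto simp: PIp_def intro!: twist_eqI)
qed

lemma phi_red: "reduced (phi_red p phiT a)" "tr (phi_red p phiT a) = Ev a"
  unfolding phi_red_def using tr_red phi_of_PI by auto

text \<open>Commutation with the image of A can be tested at T alone. Commutation with tau^d is
  automatic, since the coefficients lie in the residue field.\<close>

lemma End_red_iff: "f \<in> End_red p phiT \<longleftrightarrow> reduced f \<and> tr f \<in> EE"
proof -
  have KKf: "tr f * fr = fr * tr f" for f unfolding fr_commute_iff by simp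
  have "(\<forall>a. rmult p q f (phi_red p phiT a) = rmult p q (phi_red p phiT a) f) \<longleftrightarrow> tr f \<in> EE" if "reduced f"
  proof -
    have "rmult p q f (phi_red p phiT a) = rmult p q (phi_red p phiT a) f \<longleftrightarrow> tr f * Ev a = Ev a * tr f" for a
      using tr_inj[OF reduced_rmult reduced_rmult, of f "phi_red p phiT a" "phi_red p phiT a" f]
      by (simp add: tr_rmult phi_red)
    moreover have "(\<forall>a. tr f * Ev a = Ev a * tr f) \<longleftrightarrow> tr f \<in> EE"
    proof
      assume "\<forall>a. tr f * Ev a = Ev a * tr f"
      from spec[OF this, of "[:0, 1:]"] have "tr f * trF phiT = trF phiT * tr f" by (simp only: Ev_X)
      then show "tr f \<in> EE" using KKf by (simp add: EE_def)
    qed (use Ev_commute in simp)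
    ultimately show ?thesis by simp
  qed
  then show ?thesis unfolding End_red_def q_card[symmetric] by (auto simp: reduced_def)
qed

lemma eval_frob: "reduced (eval_frob p phiT c)" "tr (eval_frob p phiT c) = evP c"
proof -
  show "reduced (eval_frob p phiT c)" unfolding eval_frob_def q_card[symmetric]
    by (intro reduced_sum reduced_rmult)
  show "tr (eval_frob p phiT c) = evP c" unfolding eval_frob_def q_card[symmetric] peval_def
    by (simp add: tr_sum tr_rmult tr_rpow tr_frob phi_red)
qed

lemma eval_frob_eq_0_iff: "eval_frob p phiT c = 0 \<longleftrightarrow> evP c = 0"
  using tr_inj[OF eval_frob(1) reduced_0, of c] eval_frob(2)[of c] by simp

lemma A_frob_iff: "reduced f \<Longrightarrow> f \<in> A_frob p phiT \<longleftrightarrow> tr f \<in> range evP"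
proof
  assume f: "reduced f" "tr f \<in> range evP"
  then obtain c where "tr f = evP c" by blast
  then have "tr f = tr (eval_frob p phiT c)" by (simp only: eval_frob)
  then have "f = eval_frob p phiT c" using tr_inj[OF f(1) eval_frob(1)] by simp
  then show "f \<in> A_frob p phiT" by (simp add: A_frob_def)
qed (auto simp: A_frob_def eval_frob)

text \<open>Monic relations of pi have degree at least r, and only one of them has degree r; so the
  definite description determines it.\<close>

lemma is_cp_frob_charpoly: "is_cp (frob_charpoly p phiT)"
proof -
  obtain m where m: "is_cp m" using ex_is_cp by blast
  have deg: "r \<le> degree Q" if "lead_coeff Q = 1" "evP Q = 0" for Q
    using relation_degree[of Q] that by (metis leading_coeff_0_iff zero_neq_one)
  have "frob_charpoly p phiT = m"
    unfolding frob_charpoly_def eval_frob_eq_0_iff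
  proof (rule the_equality)
    show "lead_coeff m = 1 \<and> evP m = 0 \<and> (\<forall>Q. lead_coeff Q = 1 \<and> evP Q = 0 \<longrightarrow> degree m \<le> degree Q)"
      using m deg by (auto simp: is_cp_def)
    fix P assume P: "lead_coeff P = 1 \<and> evP P = 0 \<and> (\<forall>Q. lead_coeff Q = 1 \<and> evP Q = 0 \<longrightarrow> degree P \<le> degree Q)"
    then have "degree P \<le> r" using m by (auto simp: is_cp_def)
    then have "degree P = r" using deg P by (intro antisym) auto
    then have "is_cp P" using P by (auto simp: is_cp_def)
    then show "P = m" using is_cp_unique m by blast
  qed
  with m show ?thesis by simp
qed

text \<open>On the reduced endomorphisms \<open>tr\<close> is a bijection onto E. The map h is
  transported along it in one direction and along its inverse \<open>s\<close> in the other.\<close>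

lemma refined_index_iff: "refined_index r p phiT b \<longleftrightarrow> rindex b"
proof -
  have surj: "\<exists>f. f \<in> End_red p phiT \<and> tr f = F" if "F \<in> EE" for F
  proof -
    have "\<And>k. tcoeff F k \<in> KK" using EE_comm_fr[OF that] fr_commute_iff by blast
    from tr_surj[OF this] show ?thesis using that End_red_iff by blast
  qed
  then obtain s where s: "\<And>F. F \<in> EE \<Longrightarrow> s F \<in> End_red p phiT" "\<And>F. F \<in> EE \<Longrightarrow> tr (s F) = F" by metis
  have st: "s (tr f) = f" if "f \<in> End_red p phiT" for f
    using that s End_red_iff tr_inj by metis
  have lin: "rmult p q (phi_red p phiT a) f + g \<in> End_red p phiT"
    "tr (rmult p q (phi_red p phiT a) f + g) = Ev a * tr f + tr g"
    if "f \<in> End_red p phiT" "g \<in> End_red p phiT" for a f g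
  proof -
    show e: "tr (rmult p q (phi_red p phiT a) f + g) = Ev a * tr f + tr g"
      by (simp add: tr_add tr_rmult phi_red)
    show "rmult p q (phi_red p phiT a) f + g \<in> End_red p phiT"
      using that unfolding End_red_iff e by (auto intro!: reduced_add reduced_rmult EE_closed Ev_EE)
  qed
  have Efrob: "f \<in> A_frob p phiT \<longleftrightarrow> tr f \<in> range evP" if "f \<in> End_red p phiT" for f
    using that A_frob_iff End_red_iff by blast
  have tE: "tr f \<in> EE" if "f \<in> End_red p phiT" for f using that End_red_iff by blast
  let ?ch = "(\<forall>i<r-1. lead_coeff (b i) = 1) \<and> (\<forall>i. Suc i < r - 1 \<longrightarrow> b i dvd b (Suc i))"
  let ?H1 = "\<lambda>h :: 'a poly poly \<Rightarrow> nat \<Rightarrow> 'a poly.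
        (\<forall>f\<in>End_red p phiT. \<forall>g\<in>End_red p phiT. \<forall>a. \<forall>i<r-1.
            b i dvd (h (rmult p q (phi_red p phiT a) f + g) i - (a * h f i + h g i))) \<and>
        (\<forall>c. \<exists>f\<in>End_red p phiT. \<forall>i<r-1. b i dvd (h f i - c i)) \<and>
        (\<forall>f\<in>End_red p phiT. f \<in> A_frob p phiT \<longleftrightarrow> (\<forall>i<r-1. b i dvd h f i))"
  let ?H2 = "\<lambda>h :: 'a twist \<Rightarrow> nat \<Rightarrow> 'a poly.
        (\<forall>f\<in>EE. \<forall>g\<in>EE. \<forall>a. \<forall>i<r-1. b i dvd (h (Ev a * f + g) i - (a * h f i + h g i))) \<and>
        (\<forall>c. \<exists>f\<in>EE. \<forall>i<r-1. b i dvd (h f i - c i)) \<and>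
        (\<forall>f\<in>EE. f \<in> range evP \<longleftrightarrow> (\<forall>i<r-1. b i dvd h f i))"
  have 1: "?H2 (\<lambda>F. h (s F))" if H: "?H1 h" for h
  proof (intro conjI ballI allI impI)
    fix F G a i assume FG: "F \<in> EE" "G \<in> EE" and i: "i < r - 1"
    have "s (Ev a * F + G) = rmult p q (phi_red p phiT a) (s F) + s G"
      using st[OF lin(1)[OF s(1)[OF FG(1)] s(1)[OF FG(2)]], of a] lin(2)[OF s(1)[OF FG(1)] s(1)[OF FG(2)], of a]
        s(2) FG by simp
    then show "b i dvd h (s (Ev a * F + G)) i - (a * h (s F) i + h (s G) i)"
      using H s(1) FG i by simp
  next
    fix c
    obtain f where f: "f \<in> End_red p phiT" "\<forall>i<r-1. b i dvd (h f i - c i)" using H by blast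
    then show "\<exists>F\<in>EE. \<forall>i<r-1. b i dvd h (s F) i - c i"
      using st[OF f(1)] tE[OF f(1)] by (intro bexI[of _ "tr f"]) auto
  next
    fix F assume F: "F \<in> EE"
    show "F \<in> range evP \<longleftrightarrow> (\<forall>i<r-1. b i dvd h (s F) i)"
      using H Efrob[OF s(1)[OF F]] s(1)[OF F] s(2)[OF F] by auto
  qed
  have 2: "?H1 (\<lambda>f. h (tr f))" if H: "?H2 h" for h
  proof (intro conjI ballI allI impI)
    fix f g a i assume fg: "f \<in> End_red p phiT" "g \<in> End_red p phiT" and i: "i < r - 1"
    show "b i dvd h (tr (rmult p q (phi_red p phiT a) f + g)) i - (a * h (tr f) i + h (tr g) i)"
      unfolding lin(2)[OF fg] using H tE fg i by blast
  next
    fix c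
    obtain F where F: "F \<in> EE" "\<forall>i<r-1. b i dvd (h F i - c i)" using H by blast
    then show "\<exists>f\<in>End_red p phiT. \<forall>i<r-1. b i dvd h (tr f) i - c i"
      using s by (intro bexI[of _ "s F"]) auto
  next
    fix f assume f: "f \<in> End_red p phiT"
    show "f \<in> A_frob p phiT \<longleftrightarrow> (\<forall>i<r-1. b i dvd h (tr f) i)"
      using H Efrob[OF f] tE[OF f] by blast
  qed
  have "refined_index r p phiT b \<longleftrightarrow> ?ch \<and> (\<exists>h. ?H1 h)"
    unfolding refined_index_def q_card[symmetric] by blast
  also have "(\<exists>h. ?H1 h) \<longleftrightarrow> (\<exists>h. ?H2 h)"
  proof
    assume "\<exists>h. ?H1 h"
    then obtain h where "?H1 h" by (elim exE)
    from 1[OF this] show "\<exists>h. ?H2 h" by (rule exI[of _ "\<lambda>F. h (s F)"])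
  next
    assume "\<exists>h. ?H2 h"
    then obtain h where "?H2 h" by (elim exE)
    from 2[OF this] show "\<exists>h. ?H1 h" by (rule exI[of _ "\<lambda>f. h (tr f)"])
  qed
  also have "?ch \<and> (\<exists>h. ?H2 h) \<longleftrightarrow> rindex b" unfolding rindex_def by (simp only: conj_assoc)
  finally show ?thesis .
qed

theorem rhs_iff:
  assumes r0: "of_nat r \<noteq> (0::'a)" and r2: "r \<ge> 2" and n: "n \<noteq> 0"
  shows "n dvd coeff (frob_charpoly p phiT) (r - 1) + of_nat r \<and> n dvd refined_b1 r p phiT \<longleftrightarrow>
    (\<exists>\<gamma>. \<gamma> * Ev n = fr - 1)"
proof -
  obtain b where b: "rindex b" using ex_rindex[OF r0 r2] by blast
  have "refined_b1 r p phiT = b 0"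
    unfolding refined_b1_def refined_index_iff
    by (rule the_equality) (use b rindex_unique[OF _ b r2] in blast)+
  then show ?thesis using divides_iff_divisor_of_fr_minus_1[OF r0 r2 n is_cp_frob_charpoly b] by simp
qed

end

section \<open>Integral elements and finite extensions\<close>

lemma card_roots_separable:
  fixes f :: "'b::alg_closed_field poly"
  assumes "f \<noteq> 0" "\<And>x. poly f x = 0 \<Longrightarrow> poly (pderiv f) x \<noteq> 0"
  shows "card {x. poly f x = 0} = degree f"
  using assms
proof (induction "degree f" arbitrary: f)
  case 0
  then obtain c where "f = [:c:]" "c \<noteq> 0" by (metis degree_eq_zeroE pCons_0_0)
  then show ?case by simp
next
  case (Suc n)
  then obtain x where x: "poly f x = 0" using alg_closed_imp_poly_has_root[of f] by auto
  then obtain g where g: "f = [:- x, 1:] * g" by (metis dvdE poly_eq_0_iff_dvd)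
  have g0: "g \<noteq> 0" using g Suc.prems by auto
  have deg: "degree f = Suc (degree g)" using g0 unfolding g by (subst degree_mult_eq) auto
  have der: "poly (pderiv f) y = (y - x) * poly (pderiv g) y + poly g y" for y
    unfolding g pderiv_mult by (simp add: pderiv_pCons algebra_simps)
  have gx: "poly g x \<noteq> 0" using Suc.prems(2)[OF x] der[of x] by simp
  have "card {x. poly g x = 0} = degree g"
  proof (rule Suc.hyps(1))
    show "n = degree g" using deg Suc.hyps(2) by simp
    show "poly (pderiv g) y \<noteq> 0" if "poly g y = 0" for y
      using Suc.prems(2)[of y] der[of y] that g by auto
  qed (rule g0)
  moreover have "{y. poly f y = 0} = insert x {y. poly g y = 0}" unfolding g by auto
  moreover have "finite {y. poly g y = 0}" using g0 by (rule poly_roots_finite)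
  ultimately show ?case using gx deg by simp
qed

definition is_subring :: "'b::field set \<Rightarrow> bool" where
  "is_subring R \<longleftrightarrow> 1 \<in> R \<and> (\<forall>x\<in>R. \<forall>y\<in>R. x + y \<in> R \<and> x * y \<in> R) \<and> (\<forall>x\<in>R. - x \<in> R)"

lemma subringD:
  assumes "is_subring R"
  shows "1 \<in> R" "0 \<in> R" "x \<in> R \<Longrightarrow> y \<in> R \<Longrightarrow> x + y \<in> R" "x \<in> R \<Longrightarrow> y \<in> R \<Longrightarrow> x * y \<in> R"
    "x \<in> R \<Longrightarrow> - x \<in> R" "x \<in> R \<Longrightarrow> y \<in> R \<Longrightarrow> x - y \<in> R" "x \<in> R \<Longrightarrow> x ^ n \<in> R"
    "(\<And>i. i \<in> I \<Longrightarrow> f i \<in> R) \<Longrightarrow> (\<Sum>i\<in>I. f i) \<in> R"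
    "(\<And>i. i \<in> I \<Longrightarrow> f i \<in> R) \<Longrightarrow> (\<Prod>i\<in>I. f i) \<in> R"
proof -
  show 1: "1 \<in> R" and a: "\<And>x y. x \<in> R \<Longrightarrow> y \<in> R \<Longrightarrow> x + y \<in> R"
    and m: "\<And>x y. x \<in> R \<Longrightarrow> y \<in> R \<Longrightarrow> x * y \<in> R" and u: "\<And>x. x \<in> R \<Longrightarrow> - x \<in> R"
    using assms by (auto simp: is_subring_def)
  show 0: "0 \<in> R" using a[OF 1 u[OF 1]] by simp
  show "x \<in> R \<Longrightarrow> y \<in> R \<Longrightarrow> x - y \<in> R" using a[of x "- y"] u by simp
  show "x \<in> R \<Longrightarrow> x ^ n \<in> R" by (induction n) (auto intro: 1 m)
  show "(\<And>i. i \<in> I \<Longrightarrow> f i \<in> R) \<Longrightarrow> (\<Sum>i\<in>I. f i) \<in> R"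
    by (induction I rule: infinite_finite_induct) (auto intro: 0 a)
  show "(\<And>i. i \<in> I \<Longrightarrow> f i \<in> R) \<Longrightarrow> (\<Prod>i\<in>I. f i) \<in> R"
    by (induction I rule: infinite_finite_induct) (auto intro: 1 m)
qed

definition kspan :: "'b::field set \<Rightarrow> 'b set \<Rightarrow> 'b set" where
  "kspan K S = {\<Sum>s\<in>S. c s * s | c. \<forall>s\<in>S. c s \<in> K}"

lemma kspanI: "(\<And>s. s \<in> S \<Longrightarrow> c s \<in> K) \<Longrightarrow> (\<Sum>s\<in>S. c s * s) \<in> kspan K S"
  by (auto simp: kspan_def)

lemma kspanE: assumes "x \<in> kspan K S" obtains c where "\<forall>s\<in>S. c s \<in> K" "x = (\<Sum>s\<in>S. c s * s)"
  using assms by (auto simp: kspan_def)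

context
  fixes K :: "'b::field set"
  assumes K: "is_subring K"
begin

lemma kspan_0: "0 \<in> kspan K S"
  using kspanI[of S "\<lambda>_. 0" K] subringD(2)[OF K] by simp

lemma kspan_add: "x \<in> kspan K S \<Longrightarrow> y \<in> kspan K S \<Longrightarrow> x + y \<in> kspan K S"
proof -
  assume x: "x \<in> kspan K S" and y: "y \<in> kspan K S"
  obtain c where c: "\<forall>s\<in>S. c s \<in> K" "x = (\<Sum>s\<in>S. c s * s)" using kspanE[OF x] .
  obtain e where e: "\<forall>s\<in>S. e s \<in> K" "y = (\<Sum>s\<in>S. e s * s)" using kspanE[OF y] .
  have "x + y = (\<Sum>s\<in>S. (c s + e s) * s)" by (simp add: c e sum.distrib distrib_right)
  also have "\<dots> \<in> kspan K S" by (rule kspanI) (simp add: c e subringD[OF K])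
  finally show ?thesis .
qed

lemma kspan_scale: "x \<in> kspan K S \<Longrightarrow> a \<in> K \<Longrightarrow> a * x \<in> kspan K S"
proof -
  assume x: "x \<in> kspan K S" and a: "a \<in> K"
  obtain c where c: "\<forall>s\<in>S. c s \<in> K" "x = (\<Sum>s\<in>S. c s * s)" using kspanE[OF x] .
  have "a * x = (\<Sum>s\<in>S. (a * c s) * s)" by (simp add: c sum_distrib_left mult.assoc)
  also have "\<dots> \<in> kspan K S" by (rule kspanI) (simp add: c a subringD[OF K])
  finally show ?thesis .
qed

lemma kspan_sum: "(\<And>i. i \<in> I \<Longrightarrow> f i \<in> kspan K S) \<Longrightarrow> (\<Sum>i\<in>I. f i) \<in> kspan K S"
  by (induction I rule: infinite_finite_induct) (auto intro: kspan_0 kspan_add)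

lemma kspan_base: "finite S \<Longrightarrow> s \<in> S \<Longrightarrow> s \<in> kspan K S"
proof -
  assume S: "finite S" "s \<in> S"
  have "s = (\<Sum>t\<in>S. (if t = s then 1 else 0) * t)" using S by (simp add: if_distrib[of "\<lambda>x. x * _"] cong: if_cong)
  also have "\<dots> \<in> kspan K S" by (rule kspanI) (simp add: subringD[OF K])
  finally show ?thesis .
qed

lemma kspan_minimal:
  assumes "is_subring T" "K \<subseteq> T" "S \<subseteq> T" shows "kspan K S \<subseteq> T"
  using assms by (auto simp: kspan_def intro!: subringD(4,8))

lemma kspan_mult_right:
  assumes "\<And>s. s \<in> S \<Longrightarrow> s * y \<in> kspan K S'" "x \<in> kspan K S"
  shows "x * y \<in> kspan K S'"
proof -
  obtain c where c: "\<forall>s\<in>S. c s \<in> K" "x = (\<Sum>s\<in>S. c s * s)" using kspanE[OF assms(2)] .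
  have "x * y = (\<Sum>s\<in>S. c s * (s * y))" by (simp add: c sum_distrib_right mult.assoc)
  also have "\<dots> \<in> kspan K S'" using c(1) by (intro kspan_sum kspan_scale assms) auto
  finally show ?thesis .
qed

lemma kspan_subringI:
  assumes "finite S" "1 \<in> kspan K S" "\<And>s t. s \<in> S \<Longrightarrow> t \<in> S \<Longrightarrow> s * t \<in> kspan K S"
  shows "is_subring (kspan K S)"
proof -
  have "x * y \<in> kspan K S" if "x \<in> kspan K S" "y \<in> kspan K S" for x y
  proof (rule kspan_mult_right[OF _ that(1)])
    fix s assume "s \<in> S"
    then show "s * y \<in> kspan K S"
      using kspan_mult_right[OF _ that(2), of s S] assms(3) by (simp add: mult.commute)
  qed
  moreover have "- x \<in> kspan K S" if "x \<in> kspan K S" for x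
    using kspan_scale[OF that, of "- 1"] subringD(1,5)[OF K] by simp
  ultimately show ?thesis using assms(2) kspan_add by (auto simp: is_subring_def)
qed

end

text \<open>The degree D is automatically positive: for D = 0 the equation would read 1 = 0.\<close>

definition int_over :: "'b::field set \<Rightarrow> 'b \<Rightarrow> bool" where
  "int_over K x \<longleftrightarrow> (\<exists>D c. (\<forall>i<D. c i \<in> K) \<and> x ^ D = (\<Sum>i<D. c i * x ^ i))"

lemma int_over_power:
  assumes K: "is_subring K" and c: "\<And>i. i < D \<Longrightarrow> c i \<in> K" and x: "x ^ D = (\<Sum>i<D. c i * x ^ i)"
  shows "\<exists>e. (\<forall>i<D. e i \<in> K) \<and> x ^ l = (\<Sum>i<D. e i * x ^ i)"
proof (induction l)
  case 0
  show ?case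
  proof (cases "D = 0")
    case True then show ?thesis using x by simp
  next
    case False
    have "x ^ 0 = (\<Sum>i<D. (if i = 0 then 1 else 0) * x ^ i)"
      using False by (simp add: if_distrib[of "\<lambda>y. y * _"] cong: if_cong)
    then show ?thesis using subringD(1,2)[OF K] by (intro exI[of _ "\<lambda>i. if i = 0 then 1 else 0"]) simp
  qed
next
  case (Suc l)
  then obtain e where e: "\<forall>i<D. e i \<in> K" "x ^ l = (\<Sum>i<D. e i * x ^ i)" by blast
  show ?case
  proof (cases D)
    case 0 then show ?thesis using x by simp
  next
    case (Suc D')
    define e' where "e' i = e D' * c i + (if i = 0 then 0 else e (i - 1))" for i
    have "x ^ Suc l = (\<Sum>i<D. e i * x ^ Suc i)" by (simp add: e(2) sum_distrib_left mult.left_commute)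
    also have "\<dots> = (\<Sum>i<D'. e i * x ^ Suc i) + e D' * x ^ D" by (simp add: Suc)
    also have "(\<Sum>i<D'. e i * x ^ Suc i) = (\<Sum>i<D. (if i = 0 then 0 else e (i - 1)) * x ^ i)"
      unfolding Suc by (simp add: sum.lessThan_Suc_shift del: sum.lessThan_Suc)
    also have "e D' * x ^ D = (\<Sum>i<D. e D' * c i * x ^ i)" by (simp add: x sum_distrib_left mult.assoc)
    finally have "x ^ Suc l = (\<Sum>i<D. e' i * x ^ i)" by (simp add: e'_def distrib_right sum.distrib add.commute)
    moreover have "\<forall>i<D. e' i \<in> K" unfolding e'_def using e c Suc subringD[OF K] by auto
    ultimately show ?thesis by blast
  qed
qed

text \<open>Elements are adjoined one at a time, each contributing its powers below the degree of
  its equation. The last clause makes the span the ring generated by K and T, so that properties of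
  the generators pass to it.\<close>

lemma fg_subring:
  assumes K: "is_subring K" and T: "finite T" "\<And>x. x \<in> T \<Longrightarrow> int_over K x"
  shows "\<exists>S. finite S \<and> 1 \<in> S \<and> is_subring (kspan K S) \<and> T \<subseteq> kspan K S \<and>
    (\<forall>R. is_subring R \<longrightarrow> K \<subseteq> R \<longrightarrow> T \<subseteq> R \<longrightarrow> S \<subseteq> R)"
  using T
proof (induction T rule: finite_induct)
  case empty
  have "is_subring (kspan K {1})"
    by (rule kspan_subringI[OF K]) (auto intro!: kspan_base[OF K])
  then show ?case by (intro exI[of _ "{1}"]) (auto dest: subringD)
next
  case (insert a T)
  then obtain S where S: "finite S" "1 \<in> S" "is_subring (kspan K S)" "T \<subseteq> kspan K S"
    and min: "\<And>R. is_subring R \<Longrightarrow> K \<subseteq> R \<Longrightarrow> T \<subseteq> R \<Longrightarrow> S \<subseteq> R" by auto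
  obtain D c where D: "\<And>i. i < D \<Longrightarrow> c i \<in> K" "a ^ D = (\<Sum>i<D. c i * a ^ i)"
    using insert.prems[of a] unfolding int_over_def by auto
  have "D \<noteq> 0" using D(2) by (cases "D = 0") auto
  define S' where "S' = (\<lambda>(s, i). s * a ^ i) ` (S \<times> {..<D})"
  have fin: "finite S'" using S by (simp add: S'_def)
  have S'I: "s * a ^ i \<in> S'" if "s \<in> S" "i < D" for s i using that by (force simp: S'_def)
  have pow: "s * a ^ l \<in> kspan K S'" if s: "s \<in> S" for s l
  proof -
    obtain e where e: "\<forall>i<D. e i \<in> K" "a ^ l = (\<Sum>i<D. e i * a ^ i)" using int_over_power[OF K D] by blast
    have "s * a ^ l = (\<Sum>i<D. e i * (s * a ^ i))" by (simp add: e(2) sum_distrib_left mult.left_commute)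
    also have "\<dots> \<in> kspan K S'" using e s by (intro kspan_sum[OF K] kspan_scale[OF K] kspan_base[OF K] fin S'I) auto
    finally show ?thesis .
  qed
  have powR: "x * a ^ l \<in> kspan K S'" if "x \<in> kspan K S" for x l
    by (rule kspan_mult_right[OF K _ that]) (rule pow)
  have "is_subring (kspan K S')"
  proof (rule kspan_subringI[OF K fin])
    show "1 \<in> kspan K S'" using pow[OF S(2), of 0] by simp
    fix u v assume "u \<in> S'" "v \<in> S'"
    then obtain s i t j where uv: "u = s * a ^ i" "v = t * a ^ j" "s \<in> S" "t \<in> S" by (auto simp: S'_def)
    have "s * t \<in> kspan K S" using uv S kspan_base[OF K] subringD(4)[OF S(3)] by blast
    from powR[OF this, of "i + j"] show "u * v \<in> kspan K S'" by (simp add: uv power_add mult_ac)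
  qed
  moreover have "insert a T \<subseteq> kspan K S'"
  proof -
    have "a \<in> kspan K S'" using pow[OF S(2), of 1] by simp
    moreover have "x \<in> kspan K S'" if "x \<in> T" for x using powR[of x 0] that S(4) by auto
    ultimately show ?thesis by blast
  qed
  moreover have "1 \<in> S'" using S'I[OF S(2), of 0] \<open>D \<noteq> 0\<close> by simp
  moreover have "S' \<subseteq> R" if "is_subring R" "K \<subseteq> R" "insert a T \<subseteq> R" for R
    using min[OF that(1,2)] that(3) subringD(4,7)[OF that(1)] by (auto simp: S'_def)
  ultimately show ?case using fin by blast
qed

lemma emb_simps [simp]:
  "emb 0 = 0" "emb 1 = 1" "emb (x + y) = emb x + emb y" "emb (x * y) = emb x * emb y"
  "emb (- x) = - emb x" "emb (x - y) = emb x - emb y" "emb (x ^ k) = emb x ^ k"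
  "emb (inverse x) = inverse (emb x)" "emb (x / y) = emb x / emb y" "emb x = 0 \<longleftrightarrow> x = 0"
  by (simp_all add: emb_def)

lemma emb_sum: "emb (\<Sum>i\<in>I. f i) = (\<Sum>i\<in>I. emb (f i))"
  by (simp add: emb_def to_ac_sum)

lemma to_fract_power: "to_fract (x ^ k) = to_fract x ^ k"
  by (induction k) simp_all

lemma A_emb_simps [simp]:
  "A_emb 0 = 0" "A_emb 1 = 1" "A_emb (x + y) = A_emb x + A_emb y" "A_emb (x * y) = A_emb x * A_emb y"
  "A_emb (- x) = - A_emb x" "A_emb (x - y) = A_emb x - A_emb y" "A_emb (x ^ k) = A_emb x ^ k"
  "A_emb x = 0 \<longleftrightarrow> x = 0"
  by (simp_all add: A_emb_def to_fract_power)

lemma emb_to_fract: "emb (to_fract a) = A_emb a" by (simp add: A_emb_def)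

lemma emb_Fract: "emb (Fract u v) = A_emb u / A_emb v"
  by (simp add: A_emb_def Fract_conv_to_fract)

lemma subring_range_A_emb: "is_subring (range A_emb)"
  unfolding is_subring_def
proof (intro conjI ballI)
  show "1 \<in> range A_emb" using rangeI[of A_emb 1] by simp
  fix x :: "'a poly fract alg_closure" assume "x \<in> range A_emb"
  then obtain a where x: "x = A_emb a" by blast
  then show "- x \<in> range A_emb" using rangeI[of A_emb "- a"] by simp
  fix y :: "'a poly fract alg_closure" assume "y \<in> range A_emb"
  then obtain b where y: "y = A_emb b" by blast
  show "x + y \<in> range A_emb" "x * y \<in> range A_emb"
    using rangeI[of A_emb "a + b"] rangeI[of A_emb "a * b"] by (simp_all add: x y)
qed

lemma subring_range_emb: "is_subring (range emb)"
  unfolding is_subring_def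
proof (intro conjI ballI)
  show "1 \<in> range emb" using rangeI[of emb 1] by simp
  fix x :: "'a poly fract alg_closure" assume "x \<in> range emb"
  then obtain a where x: "x = emb a" by blast
  then show "- x \<in> range emb" using rangeI[of emb "- a"] by simp
  fix y :: "'a poly fract alg_closure" assume "y \<in> range emb"
  then obtain b where y: "y = emb b" by blast
  show "x + y \<in> range emb" "x * y \<in> range emb"
    using rangeI[of emb "a + b"] rangeI[of emb "a * b"] by (simp_all add: x y)
qed

lemma int_over_polyI:
  assumes "is_subring K" "\<And>i. coeff f i \<in> K" "lead_coeff f = 1" "poly f x = 0"
  shows "int_over K x"
proof -
  have "0 = (\<Sum>i\<le>degree f. coeff f i * x ^ i)" using assms(4) by (simp add: poly_altdef)
  also have "\<dots> = (\<Sum>i<degree f. coeff f i * x ^ i) + x ^ degree f"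
    using assms(3) by (simp add: lessThan_Suc_atMost[symmetric])
  finally have "x ^ degree f = - (\<Sum>i<degree f. coeff f i * x ^ i)"
    by (metis add.commute eq_neg_iff_add_eq_0)
  then have "x ^ degree f = (\<Sum>i<degree f. (- coeff f i) * x ^ i)" by (simp add: sum_negf)
  then show ?thesis unfolding int_over_def using assms(2) subringD(5)[OF assms(1)]
    by (intro exI[of _ "degree f"] exI[of _ "\<lambda>i. - coeff f i"]) simp
qed

lemma coeff_map_A_emb: "coeff (map_poly A_emb f) i = A_emb (coeff f i)"
  by (simp add: coeff_map_poly)

lemma degree_map_A_emb: "degree (map_poly A_emb f) = degree f"
  by (rule degree_map_poly) simp

lemma int_over_A_iff:
  "(\<exists>f. lead_coeff f = 1 \<and> poly (map_poly A_emb f) x = 0) \<longleftrightarrow> int_over (range A_emb) x"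
proof
  assume "\<exists>f. lead_coeff f = 1 \<and> poly (map_poly A_emb f) x = 0"
  then obtain f where f: "lead_coeff f = 1" "poly (map_poly A_emb f) x = 0" by blast
  show "int_over (range A_emb) x"
    by (rule int_over_polyI[OF subring_range_A_emb, of "map_poly A_emb f"])
      (use f in \<open>auto simp: coeff_map_A_emb degree_map_A_emb\<close>)
next
  assume "int_over (range A_emb) x"
  then obtain D c where c: "\<forall>i<D. c i \<in> range A_emb" "x ^ D = (\<Sum>i<D. c i * x ^ i)" unfolding int_over_def by blast
  then have "\<forall>i. \<exists>a. i < D \<longrightarrow> c i = A_emb a" by blast
  then obtain a where a: "\<And>i. i < D \<Longrightarrow> c i = A_emb (a i)" by metis
  define f where "f = monom 1 D - (\<Sum>i<D. monom (a i) i)"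
  have co: "coeff f i = (if i = D then 1 else if i < D then - a i else 0)" for i
    by (auto simp: f_def coeff_sum)
  have "degree f \<le> D" by (rule degree_le) (simp add: co)
  moreover have "coeff f D = 1" by (simp add: co)
  ultimately have deg: "degree f = D" by (intro antisym le_degree) auto
  have "poly (map_poly A_emb f) x = (\<Sum>i\<le>D. A_emb (coeff f i) * x ^ i)"
    by (simp add: poly_altdef degree_map_A_emb coeff_map_A_emb deg)
  also have "\<dots> = x ^ D + (\<Sum>i<D. - (c i * x ^ i))"
    by (simp add: lessThan_Suc_atMost[symmetric] co a)
  also have "\<dots> = 0" by (simp add: c(2) sum_negf)
  finally show "\<exists>f. lead_coeff f = 1 \<and> poly (map_poly A_emb f) x = 0"
    using deg \<open>coeff f D = 1\<close> by (intro exI[of _ f]) simp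
qed

lemma int_closure_iff: "x \<in> int_closure L \<longleftrightarrow> x \<in> L \<and> int_over (range A_emb) x"
  unfolding int_closure_def int_over_A_iff by simp

text \<open>Multiplication by z maps the span to itself and hence satisfies the characteristic
  polynomial of a matrix over A. Applied to 1, which is one of the generators, this is an equation
  for z.\<close>

lemma int_over_of_fg:
  fixes S :: "'a::field_gcd poly fract alg_closure set"
  assumes S: "finite S" "1 \<in> S" "is_subring (kspan (range A_emb) S)" "z \<in> kspan (range A_emb) S"
  shows "int_over (range A_emb) z"
proof -
  note KA = subring_range_A_emb
  obtain e where e: "bij_betw e {0..<card S} S" using ex_bij_betw_nat_finite[OF S(1)] by blast
  let ?m = "card S"
  have "\<forall>i. \<exists>c. i < ?m \<longrightarrow> z * e i = (\<Sum>j<?m. A_emb (c j) * e j)"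
  proof
    fix i
    show "\<exists>c. i < ?m \<longrightarrow> z * e i = (\<Sum>j<?m. A_emb (c j) * e j)"
    proof (cases "i < ?m")
      case True
      then have "e i \<in> S" using e by (auto simp: bij_betw_def)
      then have "z * e i \<in> kspan (range A_emb) S"
        using S(4) kspan_base[OF KA S(1)] subringD(4)[OF S(3)] by blast
      then obtain c where c: "\<forall>s\<in>S. c s \<in> range A_emb" "z * e i = (\<Sum>s\<in>S. c s * s)" by (rule kspanE)
      then have "\<forall>s. \<exists>a. s \<in> S \<longrightarrow> c s = A_emb a" by blast
      then obtain a where a: "\<And>s. s \<in> S \<Longrightarrow> c s = A_emb (a s)" by metis
      have "z * e i = (\<Sum>j<?m. A_emb (a (e j)) * e j)"
        unfolding c(2) lessThan_atLeast0 sum.reindex_bij_betw[OF e, symmetric]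
      proof (intro sum.cong refl)
        fix j assume "j \<in> {0..<?m}"
        then have "e j \<in> S" using e by (auto simp: bij_betw_def)
        then show "c (e j) * e j = A_emb (a (e j)) * e j" by (simp add: a)
      qed
      then show ?thesis by (intro exI[of _ "\<lambda>j. a (e j)"]) simp
    qed simp
  qed
  then obtain N where N: "\<And>i. i < ?m \<Longrightarrow> z * e i = (\<Sum>j<?m. A_emb (N i j) * e j)" by metis
  define M where "M = mat ?m ?m (\<lambda>(i, j). N i j)"
  have M: "M \<in> carrier_mat ?m ?m" by (simp add: M_def)
  have "1 \<in> e ` {0..<?m}" using e S(2) by (simp add: bij_betw_def)
  then obtain l where l: "l < ?m" "e l = 1" by auto
  have act: "is_act (\<lambda>a x :: 'a poly fract alg_closure. A_emb a * x)"
    by (simp add: is_act_def algebra_simps)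
  have "pact (\<lambda>a x. A_emb a * x) ((*) z) (char_poly M) (e l) = 0"
  proof (rule char_poly_kills[OF act _ _ M _ l(1)])
    fix i assume "i < ?m"
    then show "z * e i = (\<Sum>j<?m. A_emb (M $$ (i, j)) * e j)" using N by (simp add: M_def)
  qed (simp_all add: algebra_simps)
  moreover have "(((*) z) ^^ i) 1 = z ^ i" for i by (induction i) auto
  ultimately have "poly (map_poly A_emb (char_poly M)) z = 0"
    by (simp add: pact_def l(2) poly_altdef degree_map_A_emb coeff_map_A_emb)
  moreover have "lead_coeff (char_poly M) = 1" using degree_monic_char_poly[OF M] by auto
  ultimately show ?thesis unfolding int_over_A_iff[symmetric] by blast
qed

lemma int_over_mem:
  assumes "is_subring K" "x \<in> K" shows "int_over K x"
  unfolding int_over_def using assms by (intro exI[of _ 1] exI[of _ "\<lambda>_. x"]) auto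

lemma subring_integral: "is_subring {x. int_over (range A_emb) x}"
proof -
  note KA = subring_range_A_emb
  have *: "int_over (range A_emb) (x + y) \<and> int_over (range A_emb) (x * y) \<and> int_over (range A_emb) (- x)"
    if xy: "int_over (range A_emb) x" "int_over (range A_emb) y" for x y :: "'a poly fract alg_closure"
  proof -
    obtain S where S: "finite S" "1 \<in> S" "is_subring (kspan (range A_emb) S)" "{x, y} \<subseteq> kspan (range A_emb) S"
      using fg_subring[OF KA, of "{x, y}"] xy by auto
    then show ?thesis using int_over_of_fg[OF S(1-3)] subringD[OF S(3)] by auto
  qed
  moreover have "int_over (range A_emb) (1 :: 'a poly fract alg_closure)"
    using int_over_mem[OF KA] subringD(1)[OF KA] by blast
  ultimately show ?thesis unfolding is_subring_def by blast
qed

interpretation Fv: Vector_Spaces.vector_space "\<lambda>c x. emb c * (x :: 'a::field_gcd poly fract alg_closure)"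
  by unfold_locales (auto simp: algebra_simps)

lemma Fv_span_finite:
  "finite S \<Longrightarrow> Fv.span S = {\<Sum>s\<in>S. emb (c s) * s | c. True}"
  by (auto simp: Fv.span_finite)

lemma ext_degree_alt:
  "ext_degree L = (LEAST m. \<exists>S. finite S \<and> S \<subseteq> L \<and> card S = m \<and> L \<subseteq> Fv.span S)"
proof -
  have "(finite S \<and> S \<subseteq> L \<and> card S = m \<and> L \<subseteq> {\<Sum>s\<in>S. emb (c s) * s | c. True}) \<longleftrightarrow>
    (finite S \<and> S \<subseteq> L \<and> card S = m \<and> L \<subseteq> Fv.span S)" for S m
    by (cases "finite S") (simp_all only: Fv_span_finite simp_thms)
  then show ?thesis unfolding ext_degree_def by (simp only:)
qed

lemma ext_degree_le: "finite S \<Longrightarrow> S \<subseteq> L \<Longrightarrow> L \<subseteq> Fv.span S \<Longrightarrow> ext_degree L \<le> card S"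
  unfolding ext_degree_alt by (rule Least_le) blast

lemma ext_degree_basis:
  assumes "finite S" "S \<subseteq> L" "L \<subseteq> Fv.span S"
  shows "\<exists>S. finite S \<and> S \<subseteq> L \<and> card S = ext_degree L \<and> L \<subseteq> Fv.span S"
  unfolding ext_degree_alt by (rule LeastI_ex) (use assms in blast)

lemma common_denominator:
  fixes u :: "'i \<Rightarrow> 'a::field_gcd poly fract"
  assumes "finite I"
  shows "\<exists>D a. D \<noteq> 0 \<and> (\<forall>i\<in>I. to_fract D * u i = to_fract (a i))"
  using assms
proof (induction I rule: finite_induct)
  case empty then show ?case by (intro exI[of _ 1]) auto
next
  case (insert j I)
  then obtain D a where D: "D \<noteq> 0" "\<forall>i\<in>I. to_fract D * u i = to_fract (a i)" by blast
  obtain x y where xy: "u j = Fract x y" "y \<noteq> 0" by (cases "u j") auto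
  have "to_fract (y * D) * u i = to_fract (if i = j then D * x else y * a i)" if "i \<in> insert j I" for i
  proof (cases "i = j")
    case True
    have "to_fract (y * D) * u j = to_fract (D * x)"
      using xy by (simp add: Fract_conv_to_fract)
    then show ?thesis using True by simp
  next
    case False
    then show ?thesis using D(2) that by (simp add: mult.assoc)
  qed
  then show ?case using D(1) xy(2)
    by (intro exI[of _ "y * D"] exI[of _ "\<lambda>i. if i = j then D * x else y * a i"]) auto
qed

section \<open>Independence modulo p and the local ring at p\<close>

context residue_field begin

text \<open>If p divides all coefficients of every relation, it can be divided out again and again,
  so the coefficients are 0. Clearing denominators turns this into independence over F.\<close>

lemma card_le_ext_degree:
  fixes y :: "'i \<Rightarrow> 'a poly fract alg_closure"
  assumes I: "finite I" and L: "finite S" "S \<subseteq> L" "L \<subseteq> Fv.span S" and yL: "\<And>i. i \<in> I \<Longrightarrow> y i \<in> L"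
    and rel: "\<And>a. (\<Sum>i\<in>I. A_emb (a i) * y i) = 0 \<Longrightarrow> \<forall>i\<in>I. p dvd a i"
  shows "card I \<le> ext_degree L"
proof -
  have pk: "\<forall>i\<in>I. p ^ k dvd a i" if "(\<Sum>i\<in>I. A_emb (a i) * y i) = 0" for a k
    using that
  proof (induction k arbitrary: a)
    case (Suc k)
    from rel[OF Suc.prems] have "\<forall>i. \<exists>b. i \<in> I \<longrightarrow> a i = p * b" by (metis dvdE)
    then obtain b where b: "\<And>i. i \<in> I \<Longrightarrow> a i = p * b i" by metis
    have "A_emb p * (\<Sum>i\<in>I. A_emb (b i) * y i) = (\<Sum>i\<in>I. A_emb (a i) * y i)"
      unfolding sum_distrib_left by (intro sum.cong) (auto simp: b mult.assoc)
    then have "(\<Sum>i\<in>I. A_emb (b i) * y i) = 0" using Suc.prems p_nonzero by simp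
    from Suc.IH[OF this] show ?case using b by auto
  qed simp
  have zero: "\<forall>i\<in>I. a i = 0" if "(\<Sum>i\<in>I. A_emb (a i) * y i) = 0" for a
  proof (intro ballI, rule ccontr)
    fix i assume i: "i \<in> I" "a i \<noteq> 0"
    have "p ^ Suc (degree (a i)) dvd a i" using pk[OF that] i by blast
    then have "degree (p ^ Suc (degree (a i))) \<le> degree (a i)" using i by (intro dvd_imp_degree_le)
    then have "Suc (degree (a i)) * d \<le> degree (a i)" by (simp add: degree_power_eq p_nonzero mult.commute del: power_Suc)
    moreover have "Suc (degree (a i)) * 1 \<le> Suc (degree (a i)) * d" using d_pos by (intro mult_le_mono2) simp
    ultimately have "Suc (degree (a i)) \<le> degree (a i)" by (metis le_trans mult.right_neutral)
    then show False by simp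
  qed
  have inj: "inj_on y I"
  proof (rule inj_onI)
    fix i j assume ij: "i \<in> I" "j \<in> I" "y i = y j"
    show "i = j"
    proof (rule ccontr)
      assume ne: "i \<noteq> j"
      define a :: "'i \<Rightarrow> 'a poly" where "a l = (if l = i then 1 else if l = j then - 1 else 0)" for l
      have "(\<Sum>l\<in>I. A_emb (a l) * y l) = (\<Sum>l\<in>I. (if l = i then y l else 0) - (if l = j then y l else 0))"
        using ne by (intro sum.cong) (auto simp: a_def)
      also have "\<dots> = 0" using ij I by (simp add: sum_subtractf)
      finally have "a i = 0" using zero ij by blast
      then show False by (simp add: a_def)
    qed
  qed
  have "\<not> Fv.dependent (y ` I)"
  proof
    assume "Fv.dependent (y ` I)"
    then have "\<exists>u. (\<exists>v\<in>y ` I. u v \<noteq> 0) \<and> (\<Sum>v\<in>y ` I. emb (u v) * v) = 0"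
      by (rule iffD1[OF Fv.dependent_finite[OF finite_imageI[OF I]]])
    then obtain u where u: "\<exists>v\<in>y ` I. u v \<noteq> 0" "(\<Sum>v\<in>y ` I. emb (u v) * v) = 0"
      by (elim exE conjE)
    obtain D a where D: "D \<noteq> 0" "\<forall>i\<in>I. to_fract D * u (y i) = to_fract (a i)"
      using common_denominator[OF I, of "\<lambda>i. u (y i)"] by blast
    have "(\<Sum>i\<in>I. A_emb (a i) * y i) = (\<Sum>i\<in>I. A_emb D * (emb (u (y i)) * y i))"
    proof (intro sum.cong refl)
      fix i assume "i \<in> I"
      then have "to_fract D * u (y i) = to_fract (a i)" using D(2) by blast
      then have "A_emb (a i) = emb (to_fract D * u (y i))" by (simp only: emb_to_fract)
      then show "A_emb (a i) * y i = A_emb D * (emb (u (y i)) * y i)" by (simp add: emb_to_fract mult.assoc)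
    qed
    also have "\<dots> = A_emb D * (\<Sum>v\<in>y ` I. emb (u v) * v)"
      by (simp only: sum.reindex[OF inj] comp_def sum_distrib_left)
    finally have "\<forall>i\<in>I. a i = 0" using u(2) by (intro zero) simp
    then have "\<forall>i\<in>I. u (y i) = 0" using D by auto
    then show False using u(1) by blast
  qed
  moreover obtain S' where S': "finite S'" "S' \<subseteq> L" "card S' = ext_degree L" "L \<subseteq> Fv.span S'"
    using ext_degree_basis[OF L] by blast
  moreover have "y ` I \<subseteq> Fv.span S'" using yL S'(4) by blast
  ultimately have "card (y ` I) \<le> card S'" using Fv.independent_span_bound[of S' "y ` I"] by blast
  then show ?thesis using S'(3) card_image[OF inj] by simp
qed

lemma PI_inverse: "PI x \<Longrightarrow> rd x \<noteq> 0 \<Longrightarrow> PI (inverse x)"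
proof -
  assume x: "PI x" "rd x \<noteq> 0"
  obtain u v where uv: "x = Fract u v" "v \<noteq> 0" "\<not> p dvd v" "rd x = ev \<theta> u / ev \<theta> v" using PI_E[OF x(1)] .
  then have "ev \<theta> u \<noteq> 0" using x(2) by auto
  then have "\<not> p dvd u" using ev_eq_0_iff by blast
  then show "PI (inverse x)" unfolding p_integral_def using uv(1)
    by (intro exI[of _ v] exI[of _ u]) (auto simp: inverse_fract)
qed

text \<open>The local ring of A at p, as a subring of F^alg.\<close>

definition Kp :: "'a poly fract alg_closure set" where "Kp = emb ` {x. PI x}"

lemma subring_Kp: "is_subring Kp"
  unfolding is_subring_def
proof (intro conjI ballI)
  show "1 \<in> Kp" unfolding Kp_def using PI_1 imageI[of 1 "{x. PI x}" emb] by simp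
  fix x assume "x \<in> Kp"
  then obtain a where x: "x = emb a" "PI a" by (auto simp: Kp_def)
  then show "- x \<in> Kp" unfolding Kp_def using PI_uminus[of a] imageI[of "- a" "{x. PI x}" emb] by simp
  fix y assume "y \<in> Kp"
  then obtain b where y: "y = emb b" "PI b" by (auto simp: Kp_def)
  show "x + y \<in> Kp" "x * y \<in> Kp" unfolding Kp_def
    using x y PI_add[of a b] PI_mult[of a b] imageI[of "a + b" "{x. PI x}" emb] imageI[of "a * b" "{x. PI x}" emb]
    by simp_all
qed

lemma A_emb_Kp: "A_emb a \<in> Kp"
  unfolding Kp_def A_emb_def using PI_to_fract by blast

lemma inverse_A_emb_Kp: "\<not> p dvd s \<Longrightarrow> inverse (A_emb s) \<in> Kp"
proof -
  assume "\<not> p dvd s"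
  then have "rd (to_fract s) \<noteq> 0" using ev_eq_0_iff by (simp add: rd_to_fract)
  then have "PI (inverse (to_fract s))" using PI_inverse PI_to_fract by blast
  then have "emb (inverse (to_fract s)) \<in> Kp" unfolding Kp_def by blast
  then show ?thesis by (simp add: A_emb_def)
qed

lemma Kp_denominator: "x \<in> Kp \<Longrightarrow> \<exists>s a. \<not> p dvd s \<and> A_emb s * x = A_emb a"
proof -
  assume "x \<in> Kp"
  then obtain z where z: "x = emb z" "PI z" by (auto simp: Kp_def)
  obtain u v where uv: "z = Fract u v" "v \<noteq> 0" "\<not> p dvd v" using PI_E[OF z(2)] .
  have "A_emb v * x = A_emb u" using uv by (simp add: z(1) emb_Fract)
  then show ?thesis using uv(3) by blast
qed

text \<open>For a common denominator s of the coefficients, multiplying the equation by s^D gives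
  one for s x with the coefficients s^(D-i) c i. These lie in A because D - i > 0.\<close>

lemma int_over_Kp_scaled:
  assumes "int_over Kp x"
  shows "\<exists>s. \<not> p dvd s \<and> int_over (range A_emb) (A_emb s * x)"
proof -
  obtain D c where c: "\<forall>i<D. c i \<in> Kp" "x ^ D = (\<Sum>i<D. c i * x ^ i)" using assms unfolding int_over_def by blast
  have "\<exists>s. \<not> p dvd s \<and> (\<forall>i<m. A_emb s * c i \<in> range A_emb)" if "m \<le> D" for m
    using that
  proof (induction m)
    case 0
    have "\<not> p dvd 1" using ev_eq_0_iff[of 1] by simp
    then show ?case by blast
  next
    case (Suc m)
    then obtain s where s: "\<not> p dvd s" "\<forall>i<m. A_emb s * c i \<in> range A_emb" by auto
    obtain t b where t: "\<not> p dvd t" "A_emb t * c m = A_emb b" using Kp_denominator[of "c m"] c(1) Suc.prems by auto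
    have "A_emb (t * s) * c i \<in> range A_emb" if im: "i < Suc m" for i
    proof (cases "i = m")
      case True
      have "A_emb (t * s) * c m = A_emb s * (A_emb t * c m)" by (simp add: mult_ac)
      also have "\<dots> = A_emb (s * b)" by (simp only: t(2) A_emb_simps)
      finally have "A_emb (t * s) * c m = A_emb (s * b)" .
      then show ?thesis using True by (simp only: rangeI)
    next
      case False
      then obtain a where "A_emb s * c i = A_emb a" using s(2) im by (auto simp: less_Suc_eq)
      then have "A_emb (t * s) * c i = A_emb (t * a)" by (simp add: mult.assoc)
      then show ?thesis by (simp only: rangeI)
    qed
    moreover have "\<not> p dvd t * s" using s t prime_p prime_dvd_mult_iff by blast
    ultimately show ?case by blast
  qed
  then obtain s where s: "\<not> p dvd s" "\<forall>i<D. A_emb s * c i \<in> range A_emb" by blast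
  have "(A_emb s * x) ^ D = (\<Sum>i<D. (A_emb s ^ (D - i) * c i) * (A_emb s * x) ^ i)"
  proof -
    have "(A_emb s * x) ^ D = (\<Sum>i<D. A_emb s ^ D * (c i * x ^ i))"
      by (simp add: power_mult_distrib c(2) sum_distrib_left)
    also have "\<dots> = (\<Sum>i<D. (A_emb s ^ (D - i) * c i) * (A_emb s * x) ^ i)"
    proof (intro sum.cong refl)
      fix i assume "i \<in> {..<D}"
      then have "A_emb s ^ D = A_emb s ^ (D - i) * A_emb s ^ i" by (simp add: power_add[symmetric])
      then show "A_emb s ^ D * (c i * x ^ i) = (A_emb s ^ (D - i) * c i) * (A_emb s * x) ^ i"
        by (simp add: power_mult_distrib mult_ac)
    qed
    finally show ?thesis .
  qed
  moreover have "A_emb s ^ (D - i) * c i \<in> range A_emb" if iD: "i < D" for i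
  proof -
    obtain a where "A_emb s * c i = A_emb a" using s(2) iD by blast
    moreover have "A_emb s ^ (D - i) = A_emb s ^ (D - i - 1) * A_emb s"
      using iD by (metis Suc_diff_1 power_Suc2 zero_less_diff)
    ultimately have "A_emb s ^ (D - i) * c i = A_emb (s ^ (D - i - 1) * a)" by (simp add: mult.assoc)
    then show ?thesis by (simp only: rangeI)
  qed
  ultimately have "int_over (range A_emb) (A_emb s * x)"
    unfolding int_over_def by (intro exI[of _ D] exI[of _ "\<lambda>i. A_emb s ^ (D - i) * c i"]) simp
  then show ?thesis using s(1) by blast
qed

end

section \<open>Torsion points and primes above p\<close>

text \<open>Skew products correspond to the composition of additive polynomials. The statement is
  about coefficient sequences in a ring with additive q-powers, since it is applied over the
  closures of both F_q and F.\<close>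

lemma linearized_comp:
  fixes f g :: "nat \<Rightarrow> 'b::comm_ring_1"
  assumes q: "q > 0" and frob: "\<And>i h (J::nat set). (\<Sum>j\<in>J. h j :: 'b) ^ (q ^ i) = (\<Sum>j\<in>J. h j ^ (q ^ i))"
    and f: "\<And>i. i > m \<Longrightarrow> f i = 0" and g: "\<And>j. j > k \<Longrightarrow> g j = 0"
  shows "(\<Sum>l\<le>m + k. (\<Sum>i\<le>l. f i * g (l - i) ^ (q ^ i)) * x ^ (q ^ l)) =
    (\<Sum>i\<le>m. f i * (\<Sum>j\<le>k. g j * x ^ (q ^ j)) ^ (q ^ i))"
proof -
  define t where "t i j = f i * g j ^ (q ^ i) * x ^ (q ^ (i + j))" for i j
  have t0: "t i j = 0" if "i > m \<or> j > k" for i j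
    using that f g q by (auto simp: t_def zero_power)
  have "(\<Sum>l\<le>m + k. (\<Sum>i\<le>l. f i * g (l - i) ^ (q ^ i)) * x ^ (q ^ l)) = (\<Sum>l\<le>m + k. \<Sum>i\<le>l. t i (l - i))"
    by (auto simp: t_def sum_distrib_right intro!: sum.cong)
  also have "\<dots> = (\<Sum>i\<le>m + k. \<Sum>j\<le>m + k - i. t i j)" by (rule sum_triangle)
  also have "\<dots> = (\<Sum>i\<le>m. \<Sum>j\<le>m + k - i. t i j)"
    by (rule sum.mono_neutral_right) (auto simp: t0)
  also have "\<dots> = (\<Sum>i\<le>m. \<Sum>j\<le>k. t i j)"
    by (intro sum.cong refl sum.mono_neutral_right) (auto simp: t0)
  also have "\<dots> = (\<Sum>i\<le>m. f i * (\<Sum>j\<le>k. g j * x ^ (q ^ j)) ^ (q ^ i))"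
    unfolding frob t_def sum_distrib_left
    by (intro sum.cong refl) (simp add: power_mult_distrib power_mult[symmetric] power_add mult_ac)
  finally show ?thesis .
qed

lemma of_nat_card_UNIV: "of_nat (card (UNIV :: 'a set)) = (0::'a::{finite,field})"
proof -
  have "bij_betw (\<lambda>x::'a. x + 1) UNIV UNIV"
    by (rule bij_betw_byWitness[of _ "\<lambda>x. x - 1"]) auto
  then have "(\<Sum>x\<in>(UNIV::'a set). x + 1) = (\<Sum>x\<in>UNIV. x)" by (rule sum.reindex_bij_betw)
  then show ?thesis by (simp add: sum.distrib)
qed

lemma fract_ac_char: "of_nat k = (0::'a::field_gcd) \<Longrightarrow> of_nat k = (0 :: 'a poly fract alg_closure)"
proof -
  have ae: "A_emb (of_nat k) = (of_nat k :: 'a poly fract alg_closure)" by (induction k) auto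
  assume "of_nat k = (0::'a)"
  then have "(of_nat k :: 'a poly) = 0" by (simp add: of_nat_poly)
  then show ?thesis using ae by simp
qed

text \<open>An equation of x over F, freed from factors X, has a nonzero constant term; dividing by
  it expresses the inverse as a polynomial in x. So every ring between F and F^alg is a
  field.\<close>

lemma algebraic_inverse:
  fixes x :: "'a::field_gcd poly fract alg_closure"
  assumes R: "is_subring R" "range emb \<subseteq> R" "x \<in> R"
  shows "inverse x \<in> R"
proof (cases "x = 0")
  case True then show ?thesis using assms by simp
next
  case False
  obtain f :: "'a poly fract poly" where f: "f \<noteq> 0" "poly (map_poly to_ac f) x = 0" by (rule alg_closure_algebraic)
  have "\<exists>g. coeff g 0 \<noteq> 0 \<and> poly (map_poly to_ac g) x = 0"
    if "f \<noteq> 0" "poly (map_poly to_ac f) x = 0" for f :: "'a poly fract poly" using that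
  proof (induction f)
    case (pCons a f)
    show ?case
    proof (cases "a = 0")
      case True
      then have "f \<noteq> 0" "poly (map_poly to_ac f) x = 0" using pCons.prems False by (auto simp: ac_hom.map_poly_pCons_hom)
      then show ?thesis by (rule pCons.IH)
    next
      case False then show ?thesis using pCons.prems by (intro exI[of _ "pCons a f"]) auto
    qed
  qed simp
  with f obtain g :: "'a poly fract poly" where g: "coeff g 0 \<noteq> 0" "poly (map_poly to_ac g) x = 0" by blast
  obtain a h where ah: "g = pCons a h" by (rule pCons_cases)
  have a: "a \<noteq> 0" using g(1) ah by simp
  define y where "y = poly (map_poly to_ac h) x"
  have "emb a + x * y = 0" using g(2) unfolding ah y_def by (simp add: ac_hom.map_poly_pCons_hom emb_def)
  then have xy: "x * y = - emb a" by (simp add: eq_neg_iff_add_eq_0 add.commute)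
  have "x * (emb (- inverse a) * y) = emb (- inverse a) * (x * y)" by (simp only: mult_ac)
  also have "\<dots> = 1" using a by (simp add: xy)
  finally have "x * (emb (- inverse a) * y) = 1" .
  then have "inverse x = emb (- inverse a) * y" by (rule inverse_unique)
  moreover have "y \<in> R"
    unfolding y_def poly_altdef using R by (intro subringD(8,4,7)[OF R(1)]) (auto simp: coeff_map_poly emb_def[symmetric])
  moreover have "emb (- inverse a) \<in> R" using R(2) by blast
  ultimately show ?thesis using subringD(4)[OF R(1)] by (simp only:)
qed

text \<open>With the quotient on the left, one only has to divide by q-powers of the leading
  coefficient of g; no q-th roots occur.\<close>

lemma twist_right_division:
  assumes g: "g \<noteq> 0"
  shows "\<exists>\<gamma> \<rho>. f = \<gamma> * g + \<rho> \<and> (\<forall>k\<ge>tdeg g. tcoeff \<rho> k = 0)"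
proof -
  have "\<exists>\<gamma> \<rho>. f = \<gamma> * g + \<rho> \<and> (\<forall>k\<ge>tdeg g. tcoeff \<rho> k = 0)" if "\<And>k. k \<ge> N \<Longrightarrow> tcoeff f k = 0" for N f
    using that
  proof (induction N arbitrary: f)
    case 0 then show ?case by (intro exI[of _ 0] exI[of _ f]) auto
  next
    case (Suc N)
    show ?case
    proof (cases "N < tdeg g")
      case True then show ?thesis using Suc.prems by (intro exI[of _ 0] exI[of _ f]) auto
    next
      case False
      define j where "j = N - tdeg g"
      define c where "c = tcoeff f N / tcoeff g (tdeg g) ^ (card (UNIV :: 'a set) ^ j)"
      define f' where "f' = f - tmonom c j * g"
      have "tcoeff f' k = 0" if "k \<ge> N" for k
      proof (cases "k = N")
        case True
        have "tcoeff (tmonom c j * g) N = c * tcoeff g (tdeg g) ^ (card (UNIV :: 'a set) ^ j)"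
          using False by (simp add: tcoeff_tmonom_mult j_def)
        also have "\<dots> = tcoeff f N" using g by (simp add: c_def tcoeff_tdeg_eq_0_iff)
        finally show ?thesis using True by (simp add: f'_def)
      next
        case False
        then have "k > N" using that by simp
        then have "tcoeff g (k - j) = 0" "j \<le> k" using \<open>\<not> N < tdeg g\<close> by (auto simp: j_def intro!: tcoeff_above_tdeg)
        then have "tcoeff (tmonom c j * g) k = 0"
          using card_UNIV_gt_1[where 'a = 'a] by (simp add: tcoeff_tmonom_mult zero_power)
        then show ?thesis using Suc.prems \<open>k > N\<close> by (simp add: f'_def)
      qed
      from Suc.IH[OF this] obtain \<gamma> \<rho> where "f' = \<gamma> * g + \<rho>" "\<forall>k\<ge>tdeg g. tcoeff \<rho> k = 0" by blast
      moreover from this have "f = (\<gamma> + tmonom c j) * g + \<rho>" by (simp add: f'_def algebra_simps)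
      ultimately show ?thesis by blast
    qed
  qed
  from this[of "Suc (tdeg f)" f] show ?thesis by (simp add: tcoeff_above_tdeg)
qed

definition lin_op :: "'a::{finite,field_gcd} twist \<Rightarrow> 'a alg_closure \<Rightarrow> 'a alg_closure" where
  "lin_op f x = (\<Sum>i\<le>tdeg f. tcoeff f i * x ^ (card (UNIV :: 'a set) ^ i))"

lemma lin_op_eq_sum:
  assumes "\<And>i. i > m \<Longrightarrow> tcoeff f i = 0"
  shows "lin_op (f :: 'a::{finite,field_gcd} twist) x = (\<Sum>i\<le>m. tcoeff f i * x ^ (card (UNIV :: 'a set) ^ i))"
proof -
  have "tdeg f \<le> m" using assms by (rule tdeg_le)
  then show ?thesis unfolding lin_op_def by (intro sum.mono_neutral_left) (auto simp: tcoeff_above_tdeg)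
qed

lemma lin_op_add: "lin_op (f + g) x = lin_op f x + lin_op g x"
proof -
  let ?m = "max (tdeg f) (tdeg g)"
  have "lin_op (f + g) x = (\<Sum>i\<le>?m. tcoeff (f + g) i * x ^ (card (UNIV :: 'a set) ^ i))"
    by (rule lin_op_eq_sum) (simp add: tcoeff_above_tdeg)
  also have "\<dots> = (\<Sum>i\<le>?m. tcoeff f i * x ^ (card (UNIV :: 'a set) ^ i)) + (\<Sum>i\<le>?m. tcoeff g i * x ^ (card (UNIV :: 'a set) ^ i))"
    by (simp add: distrib_right sum.distrib)
  also have "(\<Sum>i\<le>?m. tcoeff f i * x ^ (card (UNIV :: 'a set) ^ i)) = lin_op f x"
    by (rule lin_op_eq_sum[symmetric]) (simp add: tcoeff_above_tdeg)
  also have "(\<Sum>i\<le>?m. tcoeff g i * x ^ (card (UNIV :: 'a set) ^ i)) = lin_op g x"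
    by (rule lin_op_eq_sum[symmetric]) (simp add: tcoeff_above_tdeg)
  finally show ?thesis .
qed

lemma lin_op_mult: "lin_op (f * g) x = lin_op f (lin_op g x)"
proof -
  have "lin_op (f * g) x = (\<Sum>l\<le>tdeg f + tdeg g. tcoeff (f * g) l * x ^ (card (UNIV :: 'a set) ^ l))"
    by (rule lin_op_eq_sum) (meson le_less_trans tcoeff_above_tdeg tdeg_mult_le)
  also have "\<dots> = lin_op f (lin_op g x)"
    unfolding tcoeff_mult lin_op_def
    using card_UNIV_gt_1[where 'a = 'a] by (intro linearized_comp) (auto simp: ac_power_sum tcoeff_above_tdeg)
  finally show ?thesis .
qed

lemma lin_op_0: "lin_op f 0 = 0"
  using card_UNIV_gt_1[where 'a = 'a] by (simp add: lin_op_def zero_power)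

lemma lin_op_tmonom: "lin_op (tmonom c j) x = c * x ^ (card (UNIV :: 'a set) ^ j)"
  for x :: "'a::{finite,field_gcd} alg_closure"
proof -
  have "lin_op (tmonom c j) x = (\<Sum>i\<le>j. (if i = j then c * x ^ (card (UNIV :: 'a set) ^ j) else 0))"
    unfolding lin_op_eq_sum[of j "tmonom c j" x, simplified] by (intro sum.cong) auto
  then show ?thesis by simp
qed

lemma subfield_subring: "is_subfield K \<Longrightarrow> is_subring K"
  by (auto simp: is_subfield_def is_subring_def)

lemma primes_aboveD:
  assumes "P \<in> primes_above L p" and B: "B = int_closure L"
  shows "P \<subseteq> B" "0 \<in> P" "x \<in> P \<Longrightarrow> y \<in> P \<Longrightarrow> x + y \<in> P" "b \<in> B \<Longrightarrow> x \<in> P \<Longrightarrow> b * x \<in> P" "P \<noteq> B"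
    "x \<in> B \<Longrightarrow> y \<in> B \<Longrightarrow> x * y \<in> P \<Longrightarrow> x \<in> P \<or> y \<in> P" "A_emb a \<in> P \<longleftrightarrow> p dvd a"
proof -
  have *: "P \<subseteq> B \<and> 0 \<in> P \<and> (\<forall>x\<in>P. \<forall>y\<in>P. x + y \<in> P) \<and> (\<forall>b\<in>B. \<forall>x\<in>P. b * x \<in> P) \<and>
      P \<noteq> B \<and> (\<forall>x\<in>B. \<forall>y\<in>B. x * y \<in> P \<longrightarrow> x \<in> P \<or> y \<in> P) \<and>
      P \<inter> range A_emb = A_emb ` {a. p dvd a}"
    using assms unfolding primes_above_def Let_def by simp
  then show "P \<subseteq> B" "0 \<in> P" "x \<in> P \<Longrightarrow> y \<in> P \<Longrightarrow> x + y \<in> P" "b \<in> B \<Longrightarrow> x \<in> P \<Longrightarrow> b * x \<in> P" "P \<noteq> B"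
    "x \<in> B \<Longrightarrow> y \<in> B \<Longrightarrow> x * y \<in> P \<Longrightarrow> x \<in> P \<or> y \<in> P" by blast+
  have inj: "A_emb a = A_emb b \<Longrightarrow> a = b" for a b :: "'a poly"
    using A_emb_simps(8)[of "a - b"] by simp
  have "A_emb a \<in> P \<longleftrightarrow> A_emb a \<in> A_emb ` {a. p dvd a}" using * by blast
  also have "\<dots> \<longleftrightarrow> p dvd a" using inj by blast
  finally show "A_emb a \<in> P \<longleftrightarrow> p dvd a" .
qed

section \<open>The torsion points and the field generated by them\<close>

locale torsion_setup = good_reduction p \<theta> q phiT r
  for p :: "'a::{finite,field_gcd} poly" and \<theta> q phiT r +
  fixes n :: "'a poly"
  assumes n_nonzero: "n \<noteq> 0" and p_not_dvd_n: "\<not> p dvd n"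
begin

abbreviation g :: "nat \<Rightarrow> 'a poly fract" where "g \<equiv> coeff (phi_of phiT n)"
abbreviation "D \<equiv> r * degree n"
abbreviation "L \<equiv> torsion_field phiT n"
abbreviation "Tn \<equiv> torsion phiT n"

lemma degree_skew_mult_le: "degree (skew_mult q f h) \<le> degree f + degree (h :: 'b::comm_ring_1 poly)"
proof (rule degree_le, intro allI impI)
  fix k assume k: "k > degree f + degree h"
  have "coeff f i * coeff h (k - i) ^ (q ^ i) = 0" if "i \<le> k" for i
  proof (cases "i > degree f")
    case False
    then have "k - i > degree h" using k by simp
    then show ?thesis using q_pos by (simp add: coeff_eq_0 zero_power)
  qed (simp add: coeff_eq_0)
  then show "coeff (skew_mult q f h) k = 0" unfolding coeff_skew_mult[OF q_pos] by (simp add: sum.neutral)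
qed

lemma degree_phi_le: "degree (phi_of phiT n) \<le> D"
proof -
  have dp: "degree phiT = r" using drinfeld by (simp add: drinfeld_module_def)
  have pow: "degree (skew_pow q phiT k) \<le> r * k" for k
  proof (induction k)
    case (Suc k)
    then show ?case using degree_skew_mult_le[of phiT "skew_pow q phiT k"] dp by simp
  qed simp
  show ?thesis unfolding phi_of_def q_card[symmetric]
  proof (rule degree_sum_le)
    fix k assume "k \<in> {..degree n}"
    then have "r * k \<le> D" by simp
    then show "degree (smult (to_fract [:coeff n k:]) (skew_pow q phiT k)) \<le> D"
      using degree_smult_le[of "to_fract [:coeff n k:]" "skew_pow q phiT k"] pow[of k] by linarith
  qed simp
qed

lemma PI_g: "PI (g i)" and rd_g: "rd (g i) = tcoeff (Ev n) i"
  using phi_of_PI[of n] tcoeff_trF[of "phi_of phiT n" i] by (auto simp: PIp_def)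

lemma Ev_n: "Ev n \<noteq> 0" "tdeg (Ev n) = D" using tdeg_Ev[OF n_nonzero] by auto

lemma rd_g_D: "rd (g D) \<noteq> 0"
  using Ev_n tcoeff_tdeg_eq_0_iff[of "Ev n"] by (simp add: rd_g)

lemma rd_g_0: "rd (g 0) \<noteq> 0"
  using p_not_dvd_n ev_eq_0_iff by (simp add: rd_g tcoeff_Ev_0)

lemma g_nonzero: "g D \<noteq> 0" "g 0 \<noteq> 0"
  using rd_g_D rd_g_0 PI_0 by metis+

lemma degree_phi: "degree (phi_of phiT n) = D"
  using degree_phi_le g_nonzero(1) by (intro antisym le_degree)

definition fT :: "'a poly fract alg_closure poly" where
  "fT = (\<Sum>i\<le>D. monom (emb (g i)) (q ^ i))"

lemma poly_fT: "poly fT x = (\<Sum>i\<le>D. emb (g i) * x ^ (q ^ i))"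
  by (simp add: fT_def poly_sum poly_monom)

lemma Tn_iff: "x \<in> Tn \<longleftrightarrow> (\<Sum>i\<le>D. emb (g i) * x ^ (q ^ i)) = 0"
  unfolding torsion_def degree_phi q_card[symmetric] by simp

lemma q_inj: "q ^ i = q ^ j \<longleftrightarrow> i = j"
  using q_gt_1 power_inject_exp[of q i j] by simp

lemma coeff_fT_q: "i \<le> D \<Longrightarrow> coeff fT (q ^ i) = emb (g i)"
  by (simp add: fT_def coeff_sum q_inj)

lemma degree_fT: "degree fT = q ^ D"
proof (rule antisym)
  show "degree fT \<le> q ^ D" unfolding fT_def
  proof (rule degree_sum_le)
    fix i assume "i \<in> {..D}"
    then have "q ^ i \<le> q ^ D" using q_pos by (intro power_increasing) auto
    then show "degree (monom (emb (g i)) (q ^ i)) \<le> q ^ D" using degree_monom_le le_trans by blast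
  qed simp
  show "q ^ D \<le> degree fT" using coeff_fT_q[of D] g_nonzero by (intro le_degree) simp
qed

lemma frob_add: "(x + y :: 'a poly fract alg_closure) ^ (q ^ i) = x ^ (q ^ i) + y ^ (q ^ i)"
  unfolding q_card by (rule power_card_power_add[OF fract_ac_char])

lemma frob_sum: "(\<Sum>j\<in>J. f j :: 'a poly fract alg_closure) ^ (q ^ i) = (\<Sum>j\<in>J. f j ^ (q ^ i))"
  unfolding q_card by (rule power_card_power_sum[OF fract_ac_char])

text \<open>The exponents q^i with i > 0 are 0 in F^alg, so the derivative of phi_n(x) is the
  nonzero constant \<open>g 0\<close> and all roots are simple.\<close>

lemma Tn_finite: "finite Tn" and Tn_card: "card Tn = q ^ D"
proof -
  have Tn: "Tn = {x. poly fT x = 0}" by (auto simp: Tn_iff poly_fT)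
  have f0: "fT \<noteq> 0" using coeff_fT_q[of D] g_nonzero by auto
  show "finite Tn" unfolding Tn using f0 by (rule poly_roots_finite)
  have q0: "of_nat q = (0 :: 'a poly fract alg_closure)"
    using fract_ac_char[OF of_nat_card_UNIV[where 'a = 'a]] by (simp add: q_card)
  have "pderiv fT = (\<Sum>i\<le>D. pderiv (monom (emb (g i)) (q ^ i)))"
    by (simp add: fT_def pderiv_sum)
  also have "\<dots> = (\<Sum>i\<le>D. if i = 0 then [:emb (g 0):] else 0)"
  proof (intro sum.cong refl)
    fix i show "pderiv (monom (emb (g i)) (q ^ i)) = (if i = 0 then [:emb (g 0):] else 0)"
      using q0 by (cases i) (auto simp: pderiv_monom monom_0)
  qed
  finally have "pderiv fT = [:emb (g 0):]" by simp
  then show "card Tn = q ^ D" unfolding Tn degree_fT[symmetric]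
    using g_nonzero by (intro card_roots_separable[OF f0]) simp
qed

lemma Kp_subset: "Kp \<subseteq> range emb" by (auto simp: Kp_def)

text \<open>Good reduction makes the leading coefficient \<open>g D\<close> a unit at p, so phi_n(x)
  becomes monic over the local ring. Over A this may fail, which is why localisations of the
  integral closure appear below.\<close>

lemma Tn_int_Kp: assumes "x \<in> Tn" shows "int_over Kp x"
proof (rule int_over_polyI[OF subring_Kp])
  let ?f = "smult (emb (inverse (g D))) fT"
  have lc: "lead_coeff fT = emb (g D)" using coeff_fT_q[of D] degree_fT by simp
  show "lead_coeff ?f = 1" using g_nonzero(1) lc by simp
  show "poly ?f x = 0" using assms by (simp add: Tn_iff poly_fT)
  have inv: "PI (inverse (g D))" by (rule PI_inverse[OF PI_g rd_g_D])
  fix j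
  have "coeff ?f j = (\<Sum>i\<le>D. if q ^ i = j then emb (inverse (g D) * g i) else 0)"
    unfolding coeff_smult fT_def coeff_sum sum_distrib_left
    by (intro sum.cong refl) simp
  also have "\<dots> \<in> Kp"
  proof (rule subringD(8)[OF subring_Kp])
    fix i
    have "PI (inverse (g D) * g i)" using PI_mult[OF inv PI_g] by blast
    then have "emb (inverse (g D) * g i) \<in> Kp" unfolding Kp_def by blast
    then show "(if q ^ i = j then emb (inverse (g D) * g i) else 0) \<in> Kp"
      using subringD(2)[OF subring_Kp] by (simp only: if_True if_False split: if_split) simp
  qed
  finally show "coeff ?f j \<in> Kp" .
qed

lemma L_subfield: "is_subfield L" "range emb \<subseteq> L" "Tn \<subseteq> L"
  unfolding torsion_field_def is_subfield_def by auto

lemma L_minimal: "is_subfield K \<Longrightarrow> range emb \<subseteq> K \<Longrightarrow> Tn \<subseteq> K \<Longrightarrow> L \<subseteq> K"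
  unfolding torsion_field_def by blast

lemma L_subring: "is_subring L" by (rule subfield_subring[OF L_subfield(1)])

lemma subfieldI:
  assumes "is_subring R" "range emb \<subseteq> R" shows "is_subfield (R :: 'a poly fract alg_closure set)"
  unfolding is_subfield_def using subringD[OF assms(1)] algebraic_inverse[OF assms] by auto

text \<open>The ring generated by the torsion over F has a finite spanning set, and it is already a
  field because its elements are algebraic.\<close>

lemma L_finite_dim: "\<exists>S. finite S \<and> S \<subseteq> L \<and> L \<subseteq> Fv.span S"
proof -
  have "int_over (range emb) x" if "x \<in> Tn" for x
    using Tn_int_Kp[OF that] Kp_subset unfolding int_over_def by blast
  then obtain S where S: "finite S" "1 \<in> S" "is_subring (kspan (range emb) S)" "Tn \<subseteq> kspan (range emb) S"
    and min: "\<And>R. is_subring R \<Longrightarrow> range emb \<subseteq> R \<Longrightarrow> Tn \<subseteq> R \<Longrightarrow> S \<subseteq> R"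
    using fg_subring[OF subring_range_emb Tn_finite] by auto
  have "range emb \<subseteq> kspan (range emb) S"
  proof
    fix x :: "'a poly fract alg_closure" assume x: "x \<in> range emb"
    have "x * 1 \<in> kspan (range emb) S"
      by (rule kspan_scale[OF subring_range_emb kspan_base[OF subring_range_emb S(1,2)] x])
    then show "x \<in> kspan (range emb) S" by simp
  qed
  then have "L \<subseteq> kspan (range emb) S" using L_minimal[OF subfieldI[OF S(3)]] S(4) by blast
  also have "kspan (range emb) S \<subseteq> Fv.span S"
  proof
    fix x :: "'a poly fract alg_closure" assume "x \<in> kspan (range emb) S"
    then obtain c where c: "\<forall>s\<in>S. c s \<in> range emb" "x = (\<Sum>s\<in>S. c s * s)" by (rule kspanE)
    have "c s * s \<in> Fv.span S" if "s \<in> S" for s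
    proof -
      have "c s \<in> range emb" using c(1) that by blast
      then show ?thesis using Fv.span_scale[OF Fv.span_base[OF that]] by (elim rangeE) simp
    qed
    then show "x \<in> Fv.span S" unfolding c(2) by (rule Fv.span_sum)
  qed
  finally show ?thesis using S(1) min[OF L_subring L_subfield(2,3)] by blast
qed

section \<open>Primes of the integral closure above p\<close>

lemma B_subring: "is_subring (int_closure L)"
proof -
  have "int_closure L = L \<inter> {x. int_over (range A_emb) x}" by (auto simp: int_closure_iff)
  then show ?thesis using subringD[OF L_subring] subringD[OF subring_integral] by (auto simp: is_subring_def)
qed

lemma A_emb_B: "A_emb a \<in> int_closure L"
  unfolding int_closure_iff using L_subfield(2) int_over_mem[OF subring_range_A_emb]
  by (auto simp: A_emb_def)

lemma one_notin_prime: assumes "P \<in> primes_above L p" shows "1 \<notin> P"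
proof
  assume "1 \<in> P"
  then have "A_emb 1 \<in> P" by simp
  then have "p dvd 1" using primes_aboveD(7)[OF assms refl] by blast
  then show False using ev_eq_0_iff[of 1] by simp
qed

lemma prime_uminus: assumes "P \<in> primes_above L p" "x \<in> P" shows "- x \<in> P"
  using primes_aboveD(4)[OF assms(1) refl A_emb_B[of "- 1"] assms(2)] by simp

lemma prime_diff: assumes "P \<in> primes_above L p" "x \<in> P" "y \<in> P" shows "x - y \<in> P"
  using primes_aboveD(3)[OF assms(1) refl assms(2) prime_uminus[OF assms(1,3)]] by simp

lemma prime_sum: assumes "P \<in> primes_above L p" "\<And>i. i \<in> I \<Longrightarrow> f i \<in> P" shows "(\<Sum>i\<in>I. f i) \<in> P"
  using assms(2) by (induction I rule: infinite_finite_induct)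
    (auto intro: primes_aboveD(2,3)[OF assms(1) refl])

text \<open>For x in P' outside P, take a monic equation of x modulo P of least degree. Its constant
  term lies in A and in P', hence in P. The rest is a multiple of x, and x can be cancelled as P is
  prime, which leaves an equation of smaller degree.\<close>

lemma primes_incomparable:
  assumes P: "P \<in> primes_above L p" and P': "P' \<in> primes_above L p" and sub: "P \<subseteq> P'"
  shows "P = P'"
proof (rule ccontr)
  assume "P \<noteq> P'"
  then obtain x where x: "x \<in> P'" "x \<notin> P" using sub by blast
  let ?B = "int_closure L"
  note PD = primes_aboveD[OF P refl] and PD' = primes_aboveD[OF P' refl]
  have xB: "x \<in> ?B" using x PD'(1) by blast
  define Q where "Q m \<longleftrightarrow> (\<exists>a. x ^ m + (\<Sum>i<m. A_emb (a i) * x ^ i) \<in> P)" for m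
  have "\<exists>m. Q m"
  proof -
    obtain m c where c: "\<forall>i<m. c i \<in> range A_emb" "x ^ m = (\<Sum>i<m. c i * x ^ i)"
      using xB unfolding int_closure_iff int_over_def by blast
    then have "\<forall>i. \<exists>a. i < m \<longrightarrow> c i = A_emb a" by blast
    then obtain a where a: "\<And>i. i < m \<Longrightarrow> c i = A_emb (a i)" by metis
    have "x ^ m + (\<Sum>i<m. A_emb (- a i) * x ^ i) = 0" by (simp add: c(2) a sum_negf)
    then have "x ^ m + (\<Sum>i<m. A_emb (- a i) * x ^ i) \<in> P" using PD(2) by (simp only:)
    then show ?thesis unfolding Q_def by (intro exI[of _ m] exI[of _ "\<lambda>i. - a i"])
  qed
  then obtain m where m: "Q m" and least: "\<And>k. k < m \<Longrightarrow> \<not> Q k" using exists_least_iff[of Q] by blast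
  obtain a where a: "x ^ m + (\<Sum>i<m. A_emb (a i) * x ^ i) \<in> P" using m unfolding Q_def by blast
  show False
  proof (cases m)
    case 0 then show ?thesis using a one_notin_prime[OF P] by simp
  next
    case (Suc k)
    define y where "y = x ^ k + (\<Sum>i<k. A_emb (a (Suc i)) * x ^ i)"
    have yB: "y \<in> ?B" unfolding y_def using xB A_emb_B
      by (intro subringD(3,8,4,7)[OF B_subring]) auto
    have eq: "x ^ m + (\<Sum>i<m. A_emb (a i) * x ^ i) = x * y + A_emb (a 0)"
      unfolding Suc y_def
      by (simp add: sum.lessThan_Suc_shift sum_distrib_left distrib_left mult_ac del: sum.lessThan_Suc)
    have "x * y \<in> P'" using PD'(4)[OF yB x(1)] by (simp add: mult.commute)
    moreover have "x * y + A_emb (a 0) \<in> P'" using a sub unfolding eq by blast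
    ultimately have "(x * y + A_emb (a 0)) - x * y \<in> P'" using prime_diff[OF P'] by blast
    then have "A_emb (a 0) \<in> P'" by simp
    then have "A_emb (a 0) \<in> P" using PD(7) PD'(7) by blast
    then have "(x * y + A_emb (a 0)) - A_emb (a 0) \<in> P" using a prime_diff[OF P] unfolding eq by blast
    then have "x * y \<in> P" by simp
    then have "y \<in> P" using PD(6)[OF xB yB] x(2) by blast
    then have "Q k" unfolding Q_def y_def by (intro exI[of _ "\<lambda>i. a (Suc i)"])
    then show False using least Suc by blast
  qed
qed

lemma separating_element:
  assumes P: "P \<in> primes_above L p" and Q: "finite Q" "Q \<subseteq> primes_above L p - {P}"
  shows "\<exists>y\<in>int_closure L. y \<notin> P \<and> (\<forall>P'\<in>Q. y \<in> P')"
  using Q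
proof (induction Q rule: finite_induct)
  case empty
  show ?case using one_notin_prime[OF P] subringD(1)[OF B_subring] by auto
next
  case (insert P1 Q)
  then obtain y where y: "y \<in> int_closure L" "y \<notin> P" "\<forall>P'\<in>Q. y \<in> P'" by auto
  have P1: "P1 \<in> primes_above L p" "P1 \<noteq> P" using insert.prems by auto
  then have "\<not> P1 \<subseteq> P" using primes_incomparable[OF P1(1) P] by blast
  then obtain z where z: "z \<in> P1" "z \<notin> P" by blast
  have zB: "z \<in> int_closure L" using z(1) primes_aboveD(1)[OF P1(1) refl] by blast
  have "z * y \<notin> P" using primes_aboveD(6)[OF P refl zB y(1)] y(2) z(2) by blast
  moreover have "z * y \<in> P'" if "P' \<in> Q" for P'
    using primes_aboveD(4)[of P', OF _ refl zB] y(3) that insert.prems by blast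
  moreover have "z * y \<in> P1" using primes_aboveD(4)[OF P1(1) refl y(1) z(1)] by (simp add: mult.commute)
  ultimately show ?case using subringD(4)[OF B_subring zB y(1)] by (intro bexI[of _ "z * y"]) auto
qed

text \<open>Elements y P outside P but in all other primes of Q admit only relations whose
  coefficients are divisible by p. If the residue field at P0 is larger than A/p, the product of x
  and y P0 can be added to them. So equality of number and degree leaves A/p as the only residue
  field.\<close>

lemma primes_independent:
  assumes Q: "finite Q" "Q \<subseteq> primes_above L p"
  shows "card Q \<le> ext_degree L"
    and "P0 \<in> Q \<Longrightarrow> x \<in> int_closure L \<Longrightarrow> (\<And>a. x - A_emb a \<notin> P0) \<Longrightarrow> Suc (card Q) \<le> ext_degree L"
proof -
  let ?B = "int_closure L"
  have "\<exists>y. P \<in> Q \<longrightarrow> y \<in> ?B \<and> y \<notin> P \<and> (\<forall>P'\<in>Q - {P}. y \<in> P')" for P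
  proof (cases "P \<in> Q")
    case True
    then have "P \<in> primes_above L p" "Q - {P} \<subseteq> primes_above L p - {P}" "finite (Q - {P})" using Q by auto
    from separating_element[OF this(1,3,2)] show ?thesis by blast
  qed simp
  then have "\<exists>y. \<forall>P. P \<in> Q \<longrightarrow> y P \<in> ?B \<and> y P \<notin> P \<and> (\<forall>P'\<in>Q - {P}. y P \<in> P')"
    by (intro choice allI)
  then obtain y where y: "\<And>P. P \<in> Q \<Longrightarrow> y P \<in> ?B" "\<And>P. P \<in> Q \<Longrightarrow> y P \<notin> P"
    "\<And>P P'. P \<in> Q \<Longrightarrow> P' \<in> Q \<Longrightarrow> P' \<noteq> P \<Longrightarrow> y P \<in> P'" by blast
  have BL: "x \<in> L" if "x \<in> ?B" for x using that by (simp add: int_closure_iff)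
  obtain S where S: "finite S" "S \<subseteq> L" "L \<subseteq> Fv.span S" using L_finite_dim by blast
  \<comment> \<open>Modulo P every y P' with P' different from P disappears from the
    relation.\<close>
  have key: "A_emb (a P) * y P + z \<in> P"
    if P: "P \<in> Q" and sum: "(\<Sum>P\<in>Q. A_emb (a P) * y P) + z = 0" for a P z
  proof -
    have PP: "P \<in> primes_above L p" using P Q by blast
    have "(\<Sum>P\<in>Q. A_emb (a P) * y P) = A_emb (a P) * y P + (\<Sum>P'\<in>Q - {P}. A_emb (a P') * y P')"
      by (rule sum.remove[OF Q(1) P])
    then have "A_emb (a P) * y P + z = - (\<Sum>P'\<in>Q - {P}. A_emb (a P') * y P')"
      using sum by (simp add: eq_neg_iff_add_eq_0 algebra_simps)
    moreover have "(\<Sum>P'\<in>Q - {P}. A_emb (a P') * y P') \<in> P"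
      by (rule prime_sum[OF PP], rule primes_aboveD(4)[OF PP refl A_emb_B]) (use y(3) P in auto)
    ultimately show ?thesis using prime_uminus[OF PP] by simp
  qed
  show "card Q \<le> ext_degree L"
  proof (rule card_le_ext_degree[OF Q(1) S])
    fix P assume "P \<in> Q" then show "y P \<in> L" using y(1) BL by blast
  next
    fix a assume sum: "(\<Sum>P\<in>Q. A_emb (a P) * y P) = 0"
    show "\<forall>P\<in>Q. p dvd a P"
    proof
      fix P assume P: "P \<in> Q"
      then have PP: "P \<in> primes_above L p" using Q by blast
      have "A_emb (a P) * y P \<in> P" using key[OF P, of a 0] sum by simp
      then have "A_emb (a P) \<in> P" using primes_aboveD(6)[OF PP refl A_emb_B y(1)[OF P]] y(2)[OF P] by blast
      then show "p dvd a P" using primes_aboveD(7)[OF PP refl] by blast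
    qed
  qed
  assume P0: "P0 \<in> Q" and x: "x \<in> ?B" and nx: "\<And>a. x - A_emb a \<notin> P0"
  have PP0: "P0 \<in> primes_above L p" using P0 Q by blast
  \<comment> \<open>\<open>None\<close> indexes the additional element.\<close>
  define w where "w i = (case i of Some P \<Rightarrow> y P | None \<Rightarrow> x * y P0)" for i
  let ?I = "insert None (Some ` Q)"
  have fin: "finite ?I" using Q by simp
  have "card ?I \<le> ext_degree L"
  proof (rule card_le_ext_degree[OF fin S])
    fix i assume "i \<in> ?I"
    then show "w i \<in> L" using y(1) BL x P0 subringD(4)[OF B_subring] by (auto simp: w_def)
  next
    fix a assume sum: "(\<Sum>i\<in>?I. A_emb (a i) * w i) = 0"
    have "(\<Sum>i\<in>?I. A_emb (a i) * w i) = A_emb (a None) * (x * y P0) + (\<Sum>P\<in>Q. A_emb (a (Some P)) * y P)"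
      using Q by (simp add: sum.reindex w_def)
    then have sum': "(\<Sum>P\<in>Q. A_emb (a (Some P)) * y P) + A_emb (a None) * (x * y P0) = 0"
      using sum by (simp add: add.commute)
    have bx: "A_emb (a (Some P0)) + A_emb (a None) * x \<in> ?B"
      using subringD(3,4)[OF B_subring] A_emb_B x by blast
    have "(A_emb (a (Some P0)) + A_emb (a None) * x) * y P0 \<in> P0"
      using key[OF P0 sum'] by (simp add: algebra_simps)
    then have h: "A_emb (a (Some P0)) + A_emb (a None) * x \<in> P0"
      using primes_aboveD(6)[OF PP0 refl bx y(1)[OF P0]] y(2)[OF P0] by blast
    \<comment> \<open>Otherwise the coefficient of x could be inverted modulo p, and x would be
      congruent to an element of A modulo P0.\<close>
    have pN: "p dvd a None"
    proof (rule ccontr)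
      assume "\<not> p dvd a None"
      then have "ev \<theta> (a None) \<noteq> 0" using ev_eq_0_iff by blast
      then obtain t where "ev \<theta> (a None) * ev \<theta> t = 1" using KK_inverse[of "ev \<theta> (a None)"] by auto
      then have "ev \<theta> (a None * t - 1) = 0" by simp
      then obtain k where k: "a None * t - 1 = p * k" using ev_eq_0_iff by blast
      then have k': "A_emb (a None) * A_emb t = 1 + A_emb p * A_emb k" 
      proof -
        have "a None * t = 1 + p * k" using k by (simp add: algebra_simps)
        from arg_cong[OF this, of A_emb] show ?thesis by (simp only: A_emb_simps)
      qed
      have "A_emb t * (A_emb (a (Some P0)) + A_emb (a None) * x) \<in> P0" by (rule primes_aboveD(4)[OF PP0 refl A_emb_B h])
      moreover have "(A_emb k * x) * A_emb p \<in> P0"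
        by (rule primes_aboveD(4)[OF PP0 refl]) (use subringD(4)[OF B_subring A_emb_B x] primes_aboveD(7)[OF PP0 refl] in auto)
      ultimately have "A_emb t * (A_emb (a (Some P0)) + A_emb (a None) * x) - (A_emb k * x) * A_emb p \<in> P0"
        by (rule prime_diff[OF PP0])
      also have "A_emb t * (A_emb (a (Some P0)) + A_emb (a None) * x) - (A_emb k * x) * A_emb p =
        (A_emb (a None) * A_emb t - A_emb p * A_emb k) * x + A_emb t * A_emb (a (Some P0))"
        by (simp add: algebra_simps)
      also have "\<dots> = x - A_emb (- (t * a (Some P0)))" unfolding k' by simp
      finally show False using nx by blast
    qed
    show "\<forall>i\<in>?I. p dvd a i"
    proof
      fix i assume i: "i \<in> ?I"
      show "p dvd a i"
      proof (cases "i = None \<or> i = Some P0")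
        case True
        have "x * A_emb (a None) \<in> P0" by (rule primes_aboveD(4)[OF PP0 refl x]) (use pN primes_aboveD(7)[OF PP0 refl] in blast)
        from prime_diff[OF PP0 h this] have "A_emb (a (Some P0)) \<in> P0" by (simp add: mult.commute)
        then show ?thesis using True pN primes_aboveD(7)[OF PP0 refl] by blast
      next
        case False
        then obtain P where P: "i = Some P" "P \<in> Q" "P \<noteq> P0" using i by auto
        then have PP: "P \<in> primes_above L p" using Q by blast
        have yP0: "y P0 \<in> P" using y(3)[OF P0 P(2)] P(3) by blast
        have "(A_emb (a None) * x) * y P0 \<in> P"
          by (rule primes_aboveD(4)[OF PP refl _ yP0]) (use subringD(4)[OF B_subring A_emb_B x] in blast)
        from prime_diff[OF PP key[OF P(2) sum'] this] have "A_emb (a (Some P)) * y P \<in> P" by (simp add: mult.assoc)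
        then have "A_emb (a (Some P)) \<in> P" using primes_aboveD(6)[OF PP refl A_emb_B y(1)[OF P(2)]] y(2)[OF P(2)] by blast
        then show ?thesis unfolding P(1) using primes_aboveD(7)[OF PP refl] by blast
      qed
    qed
  qed
  moreover have "card ?I = Suc (card Q)" using Q by (simp add: card_image)
  ultimately show "Suc (card Q) \<le> ext_degree L" by simp
qed

lemma primes_finite: "finite (primes_above L p)" and primes_card_le: "card (primes_above L p) \<le> ext_degree L"
proof -
  show "finite (primes_above L p)"
  proof (rule ccontr)
    assume "infinite (primes_above L p)"
    then obtain Q where "Q \<subseteq> primes_above L p" "finite Q" "card Q = Suc (ext_degree L)"
      using infinite_arbitrarily_large by blast
    then show False using primes_independent(1)[of Q] by simp
  qed
  then show "card (primes_above L p) \<le> ext_degree L" using primes_independent(1) by blast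
qed


lemma ext_degree_pos: "ext_degree L > 0"
proof (rule ccontr)
  assume "\<not> ?thesis"
  then have 0: "ext_degree L = 0" by simp
  obtain S where "finite S" "S \<subseteq> L" "L \<subseteq> Fv.span S" using L_finite_dim by blast
  from ext_degree_basis[OF this] obtain S' where S': "finite S'" "card S' = 0" "L \<subseteq> Fv.span S'" using 0 by auto
  then have "S' = {}" by simp
  moreover have "1 \<in> Fv.span S'" by (rule subsetD[OF S'(3) subringD(1)[OF L_subring]])
  ultimately show False by simp
qed

lemma torsion_diff: assumes "x \<in> Tn" "y \<in> Tn" shows "x - y \<in> Tn"
proof -
  have m: "(- y) ^ (q ^ i) = - (y ^ (q ^ i))" for i
    using frob_add[of y "- y" i] q_pos by (simp add: zero_power eq_neg_iff_add_eq_0 add.commute)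
  have "(\<Sum>i\<le>D. emb (g i) * (x - y) ^ (q ^ i)) = (\<Sum>i\<le>D. emb (g i) * x ^ (q ^ i)) - (\<Sum>i\<le>D. emb (g i) * y ^ (q ^ i))"
  proof -
    have "(x - y) ^ (q ^ i) = x ^ (q ^ i) - y ^ (q ^ i)" for i using frob_add[of x "- y" i] m[of i] by simp
    then show ?thesis by (simp add: right_diff_distrib sum_subtractf)
  qed
  then show ?thesis using assms by (simp add: Tn_iff)
qed

text \<open>The integral closure localised at p. It contains the torsion points, which are integral
  over the local ring only.\<close>

definition Bp :: "'a poly fract alg_closure set" where
  "Bp = {x. \<exists>s. \<not> p dvd s \<and> A_emb s * x \<in> int_closure L}"

lemma not_dvd_mult: "\<not> p dvd s \<Longrightarrow> \<not> p dvd t \<Longrightarrow> \<not> p dvd s * t"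
  using prime_p prime_dvd_mult_iff by blast

lemma not_dvd_1: "\<not> p dvd 1" using ev_eq_0_iff[of 1] by simp

lemma B_Bp: "x \<in> int_closure L \<Longrightarrow> x \<in> Bp"
  unfolding Bp_def using not_dvd_1 by (intro CollectI exI[of _ 1]) simp

lemma Bp_subring: "is_subring Bp"
proof -
  let ?B = "int_closure L"
  have "x + y \<in> Bp \<and> x * y \<in> Bp \<and> - x \<in> Bp" if xy: "x \<in> Bp" "y \<in> Bp" for x y
  proof -
    obtain s t where s: "\<not> p dvd s" "A_emb s * x \<in> ?B" and t: "\<not> p dvd t" "A_emb t * y \<in> ?B" using xy by (auto simp: Bp_def)
    have "A_emb t * (A_emb s * x) + A_emb s * (A_emb t * y) \<in> ?B" "(A_emb s * x) * (A_emb t * y) \<in> ?B" "- (A_emb s * x) \<in> ?B"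
      by (intro subringD(3,4,5)[OF B_subring] A_emb_B s t)+
    then have "A_emb (s * t) * (x + y) \<in> ?B" "A_emb (s * t) * (x * y) \<in> ?B" "A_emb s * (- x) \<in> ?B"
      by (simp_all add: algebra_simps)
    then show ?thesis using not_dvd_mult[OF s(1) t(1)] s(1) unfolding Bp_def by blast
  qed
  moreover have "1 \<in> Bp" using B_Bp subringD(1)[OF B_subring] by blast
  ultimately show ?thesis unfolding is_subring_def by blast
qed

lemma Kp_Bp: "Kp \<subseteq> Bp"
proof
  fix x assume xK: "x \<in> Kp"
  obtain s a where "\<not> p dvd s" "A_emb s * x = A_emb a" using Kp_denominator[OF xK] by blast
  then show "x \<in> Bp" unfolding Bp_def using A_emb_B by auto
qed

lemma Tn_Bp: "Tn \<subseteq> Bp"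
proof
  fix x assume xT: "x \<in> Tn"
  obtain s where "\<not> p dvd s" "int_over (range A_emb) (A_emb s * x)" using int_over_Kp_scaled[OF Tn_int_Kp[OF xT]] by blast
  moreover have "A_emb s * x \<in> L" using xT L_subfield(2,3) subringD(4)[OF L_subring] by (auto simp: A_emb_def)
  ultimately show "x \<in> Bp" unfolding Bp_def int_closure_iff by blast
qed

section \<open>From complete splitting to divisibility of pi - 1\<close>

theorem splits_imp_divisor:
  assumes "card (primes_above L p) = ext_degree L"
  shows "\<exists>\<gamma>. \<gamma> * Ev n = fr - 1"
proof -
  let ?B = "int_closure L"
  have "primes_above L p \<noteq> {}" using assms ext_degree_pos by auto
  then obtain P where P: "P \<in> primes_above L p" by blast
  note PD = primes_aboveD[OF P refl]
  \<comment> \<open>A larger residue field at P would allow one independent element more than the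
    degree permits.\<close>
  have res: "\<exists>a. x - A_emb a \<in> P" if "x \<in> ?B" for x
    using primes_independent(2)[OF primes_finite order_refl P that] assms by auto
  \<comment> \<open>The prime P extended to \<open>Bp\<close>, where the torsion lives.\<close>
  define Pp where "Pp = {x. \<exists>s. \<not> p dvd s \<and> A_emb s * x \<in> P}"
  have Pp_P: "x \<in> Pp" if "x \<in> P" for x unfolding Pp_def using that not_dvd_1 by (intro CollectI exI[of _ 1]) simp
  have Pp_add: "x + y \<in> Pp" if xy: "x \<in> Pp" "y \<in> Pp" for x y
  proof -
    obtain s t where s: "\<not> p dvd s" "A_emb s * x \<in> P" and t: "\<not> p dvd t" "A_emb t * y \<in> P" using xy by (auto simp: Pp_def)
    have "A_emb t * (A_emb s * x) + A_emb s * (A_emb t * y) \<in> P" by (intro PD(3,4) A_emb_B s t)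
    then have "A_emb (s * t) * (x + y) \<in> P" by (simp add: algebra_simps)
    then show ?thesis using not_dvd_mult[OF s(1) t(1)] unfolding Pp_def by blast
  qed
  have Pp_mult: "b * x \<in> Pp" if bx: "b \<in> Bp" "x \<in> Pp" for b x
  proof -
    obtain s t where s: "\<not> p dvd s" "A_emb s * b \<in> ?B" and t: "\<not> p dvd t" "A_emb t * x \<in> P" using bx by (auto simp: Pp_def Bp_def)
    have "(A_emb s * b) * (A_emb t * x) \<in> P" by (intro PD(4) s t)
    then have "A_emb (s * t) * (b * x) \<in> P" by (simp add: algebra_simps)
    then show ?thesis using not_dvd_mult[OF s(1) t(1)] unfolding Pp_def by blast
  qed
  have emb_Bp: "emb x \<in> Bp" if "PI x" for x using Kp_Bp that by (auto simp: Kp_def)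
  have Pp_A: "p dvd a" if aP: "A_emb a \<in> Pp" for a
  proof -
    obtain s where s: "\<not> p dvd s" "A_emb s * A_emb a \<in> P" using aP by (auto simp: Pp_def)
    then have "A_emb (s * a) \<in> P" by simp
    then have "p dvd s * a" using PD(7) by blast
    then show ?thesis using s(1) prime_p prime_dvd_mult_iff by blast
  qed
  have Pp_emb: "rd x = 0" if x: "PI x" "emb x \<in> Pp" for x
  proof -
    obtain u v where uv: "x = Fract u v" "v \<noteq> 0" "\<not> p dvd v" "rd x = ev \<theta> u / ev \<theta> v" using PI_E[OF x(1)] .
    have "A_emb v * emb x \<in> Pp" by (rule Pp_mult[OF B_Bp[OF A_emb_B] x(2)])
    then have "A_emb u \<in> Pp" using uv by (simp add: emb_Fract)
    then have "ev \<theta> u = 0" using Pp_A ev_eq_0_iff by blast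
    then show ?thesis using uv(4) by simp
  qed
  have Pp_uminus: "- x \<in> Pp" if "x \<in> Pp" for x
    using Pp_mult[OF B_Bp[OF A_emb_B[of "- 1"]] that] by simp
  have Pp_diff: "x - y \<in> Pp" if "x \<in> Pp" "y \<in> Pp" for x y
    using Pp_add[OF that(1) Pp_uminus[OF that(2)]] by simp
  have Pp_sum: "(\<Sum>i\<in>I. f i) \<in> Pp" if "\<And>i. i \<in> I \<Longrightarrow> f i \<in> Pp" for I :: "nat set" and f
    using that by (induction I rule: infinite_finite_induct) (auto intro: Pp_add Pp_P PD(2))
  \<comment> \<open>If s x is congruent to b and t is an inverse of s modulo p, then x is congruent
    to t b.\<close>
  have resp: "\<exists>a. x - A_emb a \<in> Pp" if xB: "x \<in> Bp" for x
  proof -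
    obtain s where s: "\<not> p dvd s" "A_emb s * x \<in> ?B" using xB by (auto simp: Bp_def)
    obtain b where b: "A_emb s * x - A_emb b \<in> P" using res[OF s(2)] by blast
    have "ev \<theta> s \<noteq> 0" using s(1) ev_eq_0_iff by blast
    then obtain t where t: "ev \<theta> s * ev \<theta> t = 1" using KK_inverse[of "ev \<theta> s"] by auto
    then have "ev \<theta> (b - s * (t * b)) = 0" by (simp add: mult.assoc[symmetric])
    then have "A_emb (b - s * (t * b)) \<in> P" using ev_eq_0_iff PD(7) by blast
    from PD(3)[OF b this] have "A_emb s * (x - A_emb (t * b)) \<in> P" by (simp add: algebra_simps)
    then show ?thesis using s(1) unfolding Pp_def by blast
  qed
  then have "\<exists>a. \<forall>x. x \<in> Tn \<longrightarrow> x - A_emb (a x) \<in> Pp" using Tn_Bp by (intro choice) blast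
  then obtain a where a: "\<And>x. x \<in> Tn \<Longrightarrow> x - A_emb (a x) \<in> Pp" by blast
  have Pp_power: "x ^ k - y ^ k \<in> Pp" if xy: "x - y \<in> Pp" "x \<in> Bp" "y \<in> Bp" for x y k
  proof (induction k)
    case 0 then show ?case using Pp_P[OF PD(2)] by simp
  next
    case (Suc k)
    have "x * (x ^ k - y ^ k) + y ^ k * (x - y) \<in> Pp"
      by (intro Pp_add Pp_mult Suc xy subringD(7)[OF Bp_subring])
    then show ?case by (simp add: algebra_simps)
  qed
  \<comment> \<open>The equation phi_n(x) = 0 is reduced at the prime, after x has been replaced by
    its representative in A.\<close>
  have vanish: "lin_op (Ev n) (ev \<theta> (a x)) = 0" if x: "x \<in> Tn" for x
  proof -
    define z where "z = (\<Sum>i\<le>D. g i * to_fract (a x) ^ (q ^ i))"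
    have zt: "PI (g i * to_fract (a x) ^ k) \<and> rd (g i * to_fract (a x) ^ k) = rd (g i) * ev \<theta> (a x) ^ k" for i k
      using PI_mult[OF PI_g, of "to_fract (a x) ^ k" i] PI_power[OF PI_to_fract, of "a x" k] rd_to_fract by auto
    have z: "PI z" "rd z = (\<Sum>i\<le>D. rd (g i) * ev \<theta> (a x) ^ (q ^ i))"
      unfolding z_def using PI_sum[of "{..D}" "\<lambda>i. g i * to_fract (a x) ^ (q ^ i)"] zt by auto
    have "(\<Sum>i\<le>D. emb (g i) * (x ^ (q ^ i) - A_emb (a x) ^ (q ^ i))) \<in> Pp"
      by (intro Pp_sum Pp_mult emb_Bp PI_g Pp_power a x subsetD[OF Tn_Bp] B_Bp A_emb_B)
    also have "(\<Sum>i\<le>D. emb (g i) * (x ^ (q ^ i) - A_emb (a x) ^ (q ^ i))) = - emb z"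
      using x unfolding Tn_iff z_def by (simp add: emb_sum right_diff_distrib sum_subtractf emb_to_fract)
    finally have "emb z \<in> Pp" using Pp_uminus[of "- emb z"] by simp
    then have "rd z = 0" by (rule Pp_emb[OF z(1)])
    moreover have "lin_op (Ev n) (ev \<theta> (a x)) = rd z"
      unfolding z(2) lin_op_def Ev_n(2) rd_g q_card ..
    ultimately show ?thesis by simp
  qed
  \<comment> \<open>The difference z of two torsion points with equal residues is a torsion point in
    \<open>Pp\<close>. Dividing phi_n(z) = 0 by z puts the constant coefficient \<open>g 0\<close>
    into \<open>Pp\<close>, although it is a unit at p.\<close>
  have inj: "inj_on (\<lambda>x. ev \<theta> (a x)) Tn"
  proof (rule inj_onI)
    fix x y assume xy: "x \<in> Tn" "y \<in> Tn" "ev \<theta> (a x) = ev \<theta> (a y)"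
    show "x = y"
    proof (rule ccontr)
      assume ne: "x \<noteq> y"
      define z where "z = x - y"
      have z0: "z \<noteq> 0" and zT: "z \<in> Tn" unfolding z_def using ne torsion_diff xy by auto
      have "A_emb (a x - a y) \<in> P" using xy(3) ev_eq_iff PD(7) by blast
      then have "(x - A_emb (a x)) - (y - A_emb (a y)) + A_emb (a x - a y) \<in> Pp"
        by (intro Pp_add Pp_diff a xy Pp_P)
      then have zP: "z \<in> Pp" by (simp add: z_def)
      have "0 = (\<Sum>i\<le>D. emb (g i) * z ^ (q ^ i))" using zT by (simp add: Tn_iff)
      also have "\<dots> = z * (\<Sum>i\<le>D. emb (g i) * z ^ (q ^ i - 1))"
        unfolding sum_distrib_left
      proof (intro sum.cong refl)
        fix i
        have "q ^ i = Suc (q ^ i - 1)" using q_pos by simp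
        then have "z ^ (q ^ i) = z * z ^ (q ^ i - 1)" by (metis power_Suc)
        then show "emb (g i) * z ^ (q ^ i) = z * (emb (g i) * z ^ (q ^ i - 1))" by simp
      qed
      finally have "0 = (\<Sum>i\<le>D. emb (g i) * z ^ (q ^ i - 1))" using z0 by simp
      also have "\<dots> = emb (g 0) + (\<Sum>i=1..D. emb (g i) * z ^ (q ^ i - 1))"
        by (simp add: atMost_atLeast0 sum.atLeast_Suc_atMost)
      finally have "emb (g 0) = - (\<Sum>i=1..D. emb (g i) * z ^ (q ^ i - 1))" by (simp add: eq_neg_iff_add_eq_0)
      moreover have "(\<Sum>i=1..D. emb (g i) * z ^ (q ^ i - 1)) \<in> Pp"
      proof (intro Pp_sum Pp_mult emb_Bp PI_g)
        fix i assume "i \<in> {1..D}"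
        then have "q ^ i > 1" using q_gt_1 by (intro one_less_power) auto
        then have e: "q ^ i - 1 = Suc (q ^ i - 2)" by simp
        have "z ^ (q ^ i - 2) * z \<in> Pp" by (intro Pp_mult zP subringD(7)[OF Bp_subring] subsetD[OF Tn_Bp] zT)
        then show "z ^ (q ^ i - 1) \<in> Pp" unfolding e by (simp add: mult.commute)
      qed
      ultimately have "emb (g 0) \<in> Pp" using Pp_uminus by simp
      then show False using Pp_emb[OF PI_g] rd_g_0 by blast
    qed
  qed
  obtain \<gamma> \<rho> where div: "fr - 1 = \<gamma> * Ev n + \<rho>" and \<rho>: "\<forall>k\<ge>D. tcoeff \<rho> k = 0"
    using twist_right_division[OF Ev_n(1), of "fr - 1"] Ev_n(2) by auto
  \<comment> \<open>The remainder as an ordinary polynomial. Its degree is below q^D, while the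
    residues of the torsion points are q^D distinct zeros.\<close>
  define h where "h = (\<Sum>k<D. monom (tcoeff \<rho> k) (q ^ k))"
  have ph: "poly h y = lin_op \<rho> y" for y
  proof -
    have "lin_op \<rho> y = (\<Sum>i\<le>D. tcoeff \<rho> i * y ^ (q ^ i))"
      unfolding q_card by (rule lin_op_eq_sum) (use \<rho> in simp)
    also have "\<dots> = (\<Sum>i<D. tcoeff \<rho> i * y ^ (q ^ i))"
      by (rule sum.mono_neutral_right) (use \<rho> in auto)
    finally show ?thesis by (simp add: h_def poly_sum poly_monom)
  qed
  have "poly h y = 0" if yT: "y \<in> (\<lambda>x. ev \<theta> (a x)) ` Tn" for y
  proof -
    obtain x where x: "x \<in> Tn" "y = ev \<theta> (a x)" using yT by blast
    have "lin_op (fr - 1) y + lin_op 1 y = lin_op fr y" by (simp add: lin_op_add[symmetric])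
    moreover have "lin_op 1 y = y" using lin_op_tmonom[of 1 0 y] by simp
    moreover have "lin_op fr y = y" using KK_power[of y] x(2) by (simp add: lin_op_tmonom q_card)
    ultimately have "lin_op (fr - 1) y = 0" by simp
    then have "lin_op \<gamma> (lin_op (Ev n) y) + lin_op \<rho> y = 0" unfolding div lin_op_add lin_op_mult .
    then show ?thesis using vanish[OF x(1)] x(2) by (simp add: ph lin_op_0)
  qed
  moreover have "degree h < card ((\<lambda>x. ev \<theta> (a x)) ` Tn)"
  proof -
    have "degree h < q ^ D" unfolding h_def
    proof (rule degree_sum_less)
      fix k assume "k \<in> {..<D}"
      then have "q ^ k < q ^ D" using q_gt_1 by (simp add: power_strict_increasing)
      then show "degree (monom (tcoeff \<rho> k) (q ^ k)) < q ^ D" using degree_monom_le le_less_trans by blast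
    qed (use q_pos in simp)
    then show ?thesis by (simp add: card_image[OF inj] Tn_card)
  qed
  ultimately have h0: "h = 0" using Tn_finite by (intro poly_eq_0_if_vanishes[of "(\<lambda>x. ev \<theta> (a x)) ` Tn"]) auto
  have "\<rho> = 0"
  proof (rule twist_eqI)
    fix k
    show "tcoeff \<rho> k = tcoeff 0 k"
    proof (cases "k < D")
      case True
      have "coeff h (q ^ k) = tcoeff \<rho> k" using True by (simp add: h_def coeff_sum q_inj)
      then show ?thesis using h0 by simp
    qed (use \<rho> in simp)
  qed
  then show ?thesis using div by (intro exI[of _ \<gamma>]) simp
qed


text \<open>The relation of one generator s0 can be solved for s0, because 1 - p c is a unit of the
  local ring; substituting the result removes s0 from the other relations. The span is taken over F,
  as suits a bound for the degree of L.\<close>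

lemma nakayama:
  assumes S: "finite S" and rel: "\<And>s. s \<in> S \<Longrightarrow>
    \<exists>v\<in>Fv.span E. \<exists>c. (\<forall>t\<in>S. c t \<in> Kp) \<and> s = v + A_emb p * (\<Sum>t\<in>S. c t * t)"
  shows "S \<subseteq> Fv.span E"
  using S rel
proof (induction S rule: finite_induct)
  case (insert s0 S)
  have scale: "k * v \<in> Fv.span E" if "k \<in> Kp" "v \<in> Fv.span E" for k v
    using Fv.span_scale[OF that(2)] that(1) by (auto simp: Kp_def)
  note KD = subringD[OF subring_Kp]
  have pK: "A_emb p \<in> Kp" by (rule A_emb_Kp)
  obtain v0 c where v0: "v0 \<in> Fv.span E" and c: "\<forall>t\<in>insert s0 S. c t \<in> Kp"
    and s0: "s0 = v0 + A_emb p * (\<Sum>t\<in>insert s0 S. c t * t)" using insert.prems[of s0] by auto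
  obtain z where z: "c s0 = emb z" "PI z" using c by (auto simp: Kp_def)
  define u where "u = 1 - to_fract p * z"
  have "PI (to_fract p * z) \<and> rd (to_fract p * z) = 0"
    using PI_mult[OF PI_to_fract z(2), of p] rd_to_fract[of p] ev_p by simp
  then have u: "PI u" "rd u = 1" unfolding u_def using PI_diff[OF PI_1(1), of "to_fract p * z"] PI_1(2) by auto
  have u0: "u \<noteq> 0" using u(2) PI_0(2) by auto
  define k where "k = emb (inverse u)"
  have "PI (inverse u)" using PI_inverse[OF u(1)] u(2) by simp
  then have kK: "k \<in> Kp" unfolding k_def Kp_def by blast
  have "emb u * s0 = s0 - A_emb p * c s0 * s0" by (simp add: u_def z(1) emb_to_fract algebra_simps)
  also have "\<dots> = v0 + A_emb p * (\<Sum>t\<in>S. c t * t)"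
    using insert.hyps by (subst (1) s0) (simp add: algebra_simps)
  finally have "k * (emb u * s0) = k * (v0 + A_emb p * (\<Sum>t\<in>S. c t * t))" by simp
  moreover have "k * (emb u * s0) = s0" using u0 by (simp add: k_def)
  ultimately have s0': "s0 = k * v0 + A_emb p * (\<Sum>t\<in>S. k * c t * t)"
    by (simp add: distrib_left sum_distrib_left mult_ac)
  have "S \<subseteq> Fv.span E"
  proof (rule insert.IH)
    fix s assume s: "s \<in> S"
    obtain v b where v: "v \<in> Fv.span E" and b: "\<forall>t\<in>insert s0 S. b t \<in> Kp"
      and eq: "s = v + A_emb p * (\<Sum>t\<in>insert s0 S. b t * t)" using insert.prems[of s] s by auto
    have "s = v + A_emb p * (b s0 * s0 + (\<Sum>t\<in>S. b t * t))" using eq insert.hyps by simp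
    also have "\<dots> = v + A_emb p * (b s0 * (k * v0 + A_emb p * (\<Sum>t\<in>S. k * c t * t)) + (\<Sum>t\<in>S. b t * t))"
      using s0' by (simp only:)
    also have "\<dots> = (v + (A_emb p * b s0 * k) * v0) + A_emb p * (\<Sum>t\<in>S. (A_emb p * b s0 * k * c t + b t) * t)"
      by (simp add: distrib_left distrib_right sum.distrib sum_distrib_left mult_ac)
    finally have "s = (v + (A_emb p * b s0 * k) * v0) + A_emb p * (\<Sum>t\<in>S. (A_emb p * b s0 * k * c t + b t) * t)" .
    moreover have "v + (A_emb p * b s0 * k) * v0 \<in> Fv.span E"
      using b by (intro Fv.span_add v scale v0 KD pK kK) auto
    moreover have "\<forall>t\<in>S. A_emb p * b s0 * k * c t + b t \<in> Kp"
      using b c by (auto intro!: KD(3,4) pK kK)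
    ultimately show "\<exists>v\<in>Fv.span E. \<exists>c. (\<forall>t\<in>S. c t \<in> Kp) \<and> s = v + A_emb p * (\<Sum>t\<in>S. c t * t)"
      by (intro bexI[of _ "v + (A_emb p * b s0 * k) * v0"] exI[of _ "\<lambda>t. A_emb p * b s0 * k * c t + b t"]) simp_all
  qed
  moreover have "s0 \<in> Fv.span E"
  proof -
    have "(\<Sum>t\<in>S. k * c t * t) \<in> Fv.span E"
      using c \<open>S \<subseteq> Fv.span E\<close> by (intro Fv.span_sum scale KD(4) kK) auto
    then show ?thesis by (subst s0') (intro Fv.span_add scale kK v0 pK)
  qed
  ultimately show ?case by blast
qed simp

text \<open>Lift \<gamma> to coefficients in A. The product with phi_n still annihilates x, and it
  reduces to tau^d - 1, so it differs from tau^d - 1 by p times a twisted polynomial over the local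
  ring.\<close>

lemma torsion_frobenius:
  assumes c: "\<gamma> * Ev n = fr - 1" and x: "x \<in> Tn" and R: "is_subring R" "Kp \<subseteq> R" "x \<in> R"
  shows "\<exists>w\<in>R. x ^ (q ^ d) - x = A_emb p * w"
proof -
  have "\<gamma> \<in> EE" by (rule divisor_of_fr_minus_1_EE[OF n_nonzero c])
  then have "\<And>k. tcoeff \<gamma> k \<in> KK" using EE_comm_fr fr_commute_iff by blast
  then obtain G where G: "tr G = \<gamma>" using tr_surj by blast
  define GF where "GF = map_poly to_fract G"
  have GF: "coeff GF k = to_fract (coeff G k)" for k by (simp add: GF_def coeff_map_poly)
  have PG: "PIp GF" by (simp add: PIp_def GF PI_to_fract)
  have tG: "trF GF = \<gamma>" unfolding G[symmetric] by (rule twist_eqI) (simp add: GF rd_to_fract)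
  define Y where "Y = skew_mult q GF (phi_of phiT n)"
  have PY: "PIp Y" "trF Y = fr - 1"
    unfolding Y_def using trF_skew_mult[OF PG, of "phi_of phiT n"] phi_of_PI[of n] tG c by auto
  \<comment> \<open>The summand d ensures that the index of tau^d lies in the range of
    summation.\<close>
  define M where "M = (degree GF + d) + D"
  have embY: "emb (coeff Y l) = (\<Sum>i\<le>l. emb (coeff GF i) * emb (g (l - i)) ^ (q ^ i))" for l
    unfolding Y_def coeff_skew_mult[OF q_pos] emb_sum by simp
  have "(\<Sum>l\<le>M. emb (coeff Y l) * x ^ (q ^ l)) =
    (\<Sum>i\<le>degree GF + d. emb (coeff GF i) * (\<Sum>j\<le>D. emb (g j) * x ^ (q ^ j)) ^ (q ^ i))"
    unfolding embY M_def
    by (rule linearized_comp[OF q_pos frob_sum]) (simp_all add: coeff_eq_0 degree_phi)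
  also have "\<dots> = 0" using x q_pos by (simp add: Tn_iff zero_power)
  finally have sum0: "(\<Sum>l\<le>M. emb (coeff Y l) * x ^ (q ^ l)) = 0" .
  \<comment> \<open>The coefficients of tau^d - 1.\<close>
  define \<delta> :: "nat \<Rightarrow> 'a poly" where "\<delta> l = (if l = d then 1 else 0) - (if l = 0 then 1 else 0)" for l
  have "\<exists>y. PI y \<and> coeff Y l - to_fract (\<delta> l) = to_fract p * y" for l
  proof (rule rd_eq_0)
    have "PI (coeff Y l)" using PY(1) by (simp add: PIp_def)
    then have "PI (coeff Y l - to_fract (\<delta> l)) \<and> rd (coeff Y l - to_fract (\<delta> l)) = rd (coeff Y l) - ev \<theta> (\<delta> l)"
      using PI_diff[OF _ PI_to_fract] rd_to_fract by simp
    moreover have "rd (coeff Y l) = ev \<theta> (\<delta> l)"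
      using arg_cong[OF PY(2), of "\<lambda>z. tcoeff z l"] by (auto simp: \<delta>_def)
    ultimately show "PI (coeff Y l - to_fract (\<delta> l))" "rd (coeff Y l - to_fract (\<delta> l)) = 0" by auto
  qed
  then obtain y where y: "\<And>l. PI (y l)" "\<And>l. coeff Y l - to_fract (\<delta> l) = to_fract p * y l" by metis
  have Yl: "emb (coeff Y l) = A_emb (\<delta> l) + A_emb p * emb (y l)" for l
    using arg_cong[OF y(2)[of l], of emb] by (simp add: emb_to_fract algebra_simps)
  define w where "w = (\<Sum>l\<le>M. emb (y l) * x ^ (q ^ l))"
  have wR: "w \<in> R" unfolding w_def using R y(1)
    by (intro subringD(8,4,7)[OF R(1)]) (auto simp: Kp_def)
  have "0 = (\<Sum>l\<le>M. A_emb (\<delta> l) * x ^ (q ^ l)) + A_emb p * w"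
    unfolding sum0[symmetric] w_def Yl by (simp add: distrib_right sum.distrib sum_distrib_left mult.assoc)
  also have "(\<Sum>l\<le>M. A_emb (\<delta> l) * x ^ (q ^ l)) =
    (\<Sum>l\<le>M. (if l = d then x ^ (q ^ l) else 0) - (if l = 0 then x ^ (q ^ l) else 0))"
    by (intro sum.cong refl) (auto simp: \<delta>_def)
  also have "\<dots> = x ^ (q ^ d) - x" by (simp add: sum_subtractf M_def)
  finally have "x ^ (q ^ d) - x = A_emb p * (- w)" by (simp add: eq_neg_iff_add_eq_0)
  then show ?thesis using subringD(5)[OF R(1) wR] by blast
qed

definition residues :: "'a poly set" where "residues = {a. \<forall>i\<ge>d. coeff a i = 0}"

text \<open>Modulo p both polynomials are monic of degree q^d and vanish on the whole residue field,
  so their difference is divisible by p. This factors x^(q^d) - x, up to p, into linear terms with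
  roots in A.\<close>

lemma residue_product:
  "\<exists>D'. \<forall>x. (\<Prod>a\<in>residues. x - A_emb a) - (x ^ (q ^ d) - x) = A_emb p * poly (map_poly A_emb D') x"
proof -
  interpret ev_hom: comm_ring_hom "ev \<theta>" by unfold_locales auto
  interpret evp: map_poly_comm_ring_hom "ev \<theta>" ..
  interpret A_hom: comm_ring_hom "A_emb :: 'a poly \<Rightarrow> _" by unfold_locales auto
  interpret Ap: map_poly_comm_ring_hom "A_emb :: 'a poly \<Rightarrow> _" ..
  have fin: "finite residues" and cardR: "card residues = q ^ d" by (simp_all add: residues_def card_polys)
  have Q: "q ^ d > 1" using q_gt_1 d_pos by (rule one_less_power)
  define Dp where "Dp = (\<Prod>a\<in>residues. [:- a, 1:]) - (monom 1 (q ^ d) - [:0, 1:])"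
  let ?f = "\<Prod>a\<in>residues. [:- ev \<theta> a, 1:]"
  have mapev: "map_poly (ev \<theta>) Dp = ?f - (monom 1 (q ^ d) - [:0, 1:])"
    unfolding Dp_def by (simp add: evp.hom_prod evp.hom_minus ev_hom.map_poly_pCons_hom map_poly_monom)
  have degf: "degree ?f = q ^ d" by (subst degree_prod_eq_sum_degree) (auto simp: cardR)
  have lcf: "coeff ?f (q ^ d) = 1"
    using lead_coeff_prod[of "\<lambda>a. [:- ev \<theta> a, 1:]" residues] degf by simp
  have "degree (map_poly (ev \<theta>) Dp) < q ^ d"
  proof -
    have z: "coeff (map_poly (ev \<theta>) Dp) k = 0" if "k \<ge> q ^ d" for k
    proof (cases "k = q ^ d")
      case True
      then show ?thesis unfolding mapev using lcf Q q_gt_1 d_pos by (auto simp: coeff_pCons split: nat.split)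
    next
      case False
      then have "coeff ?f k = 0" using that degf by (intro coeff_eq_0) simp
      then show ?thesis unfolding mapev using that False Q by (auto simp: coeff_pCons split: nat.split)
    qed
    show ?thesis
    proof (rule ccontr)
      assume nd: "\<not> ?thesis"
      then have "map_poly (ev \<theta>) Dp = 0" using z[of "degree (map_poly (ev \<theta>) Dp)"] leading_coeff_0_iff by (metis not_le)
      then show False using Q nd q_pos by simp
    qed
  qed
  moreover have "poly (map_poly (ev \<theta>) Dp) y = 0" if y: "y \<in> KK" for y
  proof -
    obtain a where a: "a \<in> residues" "y = ev \<theta> a" using y KK_eq unfolding residues_def by auto
    have "poly ?f y = 0" unfolding poly_prod using a fin by auto
    then show ?thesis unfolding mapev using KK_power[OF y] by (simp add: poly_monom)
  qed
  ultimately have "map_poly (ev \<theta>) Dp = 0"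
    using finite_KK card_KK by (intro poly_eq_0_if_vanishes[of KK]) auto
  then have "coeff (map_poly (ev \<theta>) Dp) k = 0" for k by simp
  then have "p dvd coeff Dp k" for k using ev_eq_0_iff[of "coeff Dp k"] by (simp add: coeff_map_poly)
  then have "[:p:] dvd Dp" by (simp add: const_poly_dvd_iff)
  then obtain D' where D': "Dp = smult p D'" by (auto elim!: dvdE)
  have "(\<Prod>a\<in>residues. x - A_emb a) - (x ^ (q ^ d) - x) = A_emb p * poly (map_poly A_emb D') x" for x
  proof -
    have "poly (map_poly A_emb Dp) x = (\<Prod>a\<in>residues. x - A_emb a) - (x ^ (q ^ d) - x)"
      unfolding Dp_def by (simp add: Ap.hom_prod Ap.hom_minus A_hom.map_poly_pCons_hom map_poly_monom poly_prod poly_monom)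
    moreover have "poly (map_poly A_emb Dp) x = A_emb p * poly (map_poly A_emb D') x"
      unfolding D' by (simp add: A_hom.map_poly_hom_smult)
    ultimately show ?thesis by simp
  qed
  then show ?thesis by blast
qed

theorem divisor_imp_splits:
  assumes c: "\<gamma> * Ev n = fr - 1"
  shows "card (primes_above L p) = ext_degree L"
proof -
  let ?B = "int_closure L" and ?P = "A_emb p :: 'a poly fract alg_closure" and ?Q = "q ^ d"
  note KA = subring_Kp
  obtain S where S: "finite S" "1 \<in> S" "is_subring (kspan Kp S)" "Tn \<subseteq> kspan Kp S"
    and min: "\<And>R. is_subring R \<Longrightarrow> Kp \<subseteq> R \<Longrightarrow> Tn \<subseteq> R \<Longrightarrow> S \<subseteq> R"
    using fg_subring[OF KA Tn_finite Tn_int_Kp] by auto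
  define C where "C = kspan Kp S"
  have C: "is_subring C" using S(3) by (simp add: C_def)
  note CD = subringD[OF C]
  have TC: "Tn \<subseteq> C" using S(4) by (simp add: C_def)
  have KC: "x \<in> C" if "x \<in> Kp" for x
    using kspan_scale[OF KA kspan_base[OF KA S(1,2)] that] by (simp add: C_def)
  have SC: "S \<subseteq> C" using kspan_base[OF KA S(1)] by (auto simp: C_def)
  have C_min: "C \<subseteq> R" if "is_subring R" "Kp \<subseteq> R" "Tn \<subseteq> R" for R
    unfolding C_def by (rule kspan_minimal[OF KA that(1,2) min[OF that]])
  have AC: "A_emb a \<in> C" for a by (rule KC[OF A_emb_Kp])
  have p0: "?P \<noteq> 0" using p_nonzero by simp
  have Q1: "?Q > 1" using q_gt_1 d_pos by (rule one_less_power)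
  \<comment> \<open>The elements with this property form a ring that contains the local ring and the
    torsion, so it is all of C.\<close>
  have frobC: "\<exists>w\<in>C. x ^ ?Q - x = ?P * w" if xC: "x \<in> C" for x
  proof -
    define R where "R = {x \<in> C. \<exists>w\<in>C. x ^ ?Q - x = ?P * w}"
    have "x + y \<in> R \<and> x * y \<in> R" if xy: "x \<in> R" "y \<in> R" for x y
    proof -
      obtain w v where w: "x \<in> C" "w \<in> C" "x ^ ?Q - x = ?P * w" and v: "y \<in> C" "v \<in> C" "y ^ ?Q - y = ?P * v"
        using xy by (auto simp: R_def)
      have "(x + y) ^ ?Q - (x + y) = (x ^ ?Q - x) + (y ^ ?Q - y)" by (simp add: frob_add)
      also have "\<dots> = ?P * (w + v)" by (simp only: w v distrib_left)
      finally have 1: "(x + y) ^ ?Q - (x + y) = ?P * (w + v)" .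
      have "(x * y) ^ ?Q - x * y = x ^ ?Q * (y ^ ?Q - y) + y * (x ^ ?Q - x)"
        by (simp add: power_mult_distrib algebra_simps)
      also have "\<dots> = ?P * (x ^ ?Q * v + y * w)" by (simp only: w v) (simp add: algebra_simps)
      finally have 2: "(x * y) ^ ?Q - x * y = ?P * (x ^ ?Q * v + y * w)" .
      show ?thesis unfolding R_def using 1 2 w v by (auto intro!: CD)
    qed
    moreover have "x \<in> R" if xK: "x \<in> Kp" for x
    proof -
      obtain z where z: "x = emb z" "PI z" using xK by (auto simp: Kp_def)
      have pz: "PI (z ^ ?Q - z)" "rd (z ^ ?Q - z) = 0"
        using PI_diff[of "z ^ ?Q" z] PI_power[OF z(2), of ?Q] z(2) KK_power[of "rd z"] by (auto simp: rd_def)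
      obtain u where u: "PI u" "z ^ ?Q - z = to_fract p * u" using rd_eq_0[OF pz] by blast
      have "x ^ ?Q - x = ?P * emb u" using arg_cong[OF u(2), of emb] by (simp add: z(1) emb_to_fract)
      moreover have "emb u \<in> C" using u(1) KC by (auto simp: Kp_def)
      ultimately show ?thesis using KC[OF xK] by (auto simp: R_def)
    qed
    moreover from this have "1 \<in> R" "- 1 \<in> R" using subringD(1,5)[OF KA] by blast+
    moreover have "Tn \<subseteq> R"
    proof
      fix x assume "x \<in> Tn"
      then show "x \<in> R" using torsion_frobenius[OF c _ C] KC TC by (auto simp: R_def)
    qed
    ultimately have "is_subring R" unfolding is_subring_def by (metis mult_minus1)
    then have "C \<subseteq> R" using C_min \<open>\<And>x. x \<in> Kp \<Longrightarrow> x \<in> R\<close> \<open>Tn \<subseteq> R\<close> by blast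
    then show ?thesis using xC by (auto simp: R_def)
  qed
  define pC where "pC = {?P * w | w. w \<in> C}"
  have pCI: "?P * w \<in> pC" if "w \<in> C" for w using that by (auto simp: pC_def)
  have frob: "x ^ ?Q - x \<in> pC" if "x \<in> C" for x using frobC[OF that] by (auto simp: pC_def)
  have pC_add: "x + y \<in> pC" if xy: "x \<in> pC" "y \<in> pC" for x y
  proof -
    obtain w v where "x = ?P * w" "w \<in> C" "y = ?P * v" "v \<in> C" using xy by (auto simp: pC_def)
    then show ?thesis using pCI[OF CD(3), of w v] by (simp add: distrib_left)
  qed
  have pC_mult: "b * x \<in> pC" if bx: "b \<in> C" "x \<in> pC" for b x
  proof -
    obtain w where "x = ?P * w" "w \<in> C" using bx by (auto simp: pC_def)
    then show ?thesis using pCI[OF CD(4)[OF bx(1)], of w] by (simp add: mult.left_commute)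
  qed
  have pC_C: "pC \<subseteq> C" using CD(4)[OF AC] by (auto simp: pC_def)
  have pC_minus: "x - y \<in> pC" if "x \<in> pC" "y \<in> pC" for x y
    using pC_add[OF that(1) pC_mult[OF CD(5)[OF CD(1)] that(2)]] by simp
  \<comment> \<open>Repeated q^d-th powers do not change x modulo pC, and a high one is a multiple
    of x^m. So C/pC has no nilpotent elements.\<close>
  have radical: "x \<in> pC" if x: "x \<in> C" "x ^ m \<in> pC" for x m
  proof -
    have it: "x ^ (?Q ^ k) - x \<in> pC" for k
    proof (induction k)
      case 0 show ?case using pCI[OF CD(2)] by simp
    next
      case (Suc k)
      have "(x ^ (?Q ^ k)) ^ ?Q - x ^ (?Q ^ k) \<in> pC" by (rule frob[OF CD(7)[OF x(1)]])
      from pC_add[OF this Suc] show ?case by (simp add: power_mult[symmetric] mult.commute)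
    qed
    have "m < ?Q ^ m" using Q1 by (intro power_gt_expt) simp
    then have "x ^ (?Q ^ m) = x ^ (?Q ^ m - m) * x ^ m" by (simp add: power_add[symmetric])
    then have "x ^ (?Q ^ m) \<in> pC" using pC_mult[OF CD(7)[OF x(1)] x(2)] by simp
    from pC_minus[OF this it[of m]] show ?thesis by simp
  qed
  have C_Bp: "C \<subseteq> Bp" by (rule C_min[OF Bp_subring Kp_Bp Tn_Bp])
  have C_L: "C \<subseteq> L" by (rule C_min[OF L_subring _ L_subfield(3)]) (use Kp_subset L_subfield(2) in blast)
  \<comment> \<open>The quotients of elements of C by nonzero elements of A form a field that
    contains F and the torsion.\<close>
  have L_frac: "\<exists>s. s \<noteq> 0 \<and> A_emb s * x \<in> C" if xL: "x \<in> L" for x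
  proof -
    define R where "R = {x. \<exists>s. s \<noteq> 0 \<and> A_emb s * x \<in> C}"
    have "x + y \<in> R \<and> x * y \<in> R \<and> - x \<in> R" if xy: "x \<in> R" "y \<in> R" for x y
    proof -
      obtain s t where s: "s \<noteq> 0" "A_emb s * x \<in> C" and t: "t \<noteq> 0" "A_emb t * y \<in> C" using xy by (auto simp: R_def)
      have "A_emb t * (A_emb s * x) + A_emb s * (A_emb t * y) \<in> C" "(A_emb s * x) * (A_emb t * y) \<in> C" "- (A_emb s * x) \<in> C"
        by (intro CD(3,4,5) AC s t)+
      then have "A_emb (s * t) * (x + y) \<in> C" "A_emb (s * t) * (x * y) \<in> C" "A_emb s * (- x) \<in> C"
        by (simp_all add: algebra_simps)
      moreover have "s * t \<noteq> 0" using s t by simp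
      ultimately show ?thesis using s(1) unfolding R_def by blast
    qed
    moreover have C_R: "x \<in> R" if "x \<in> C" for x unfolding R_def using that by (intro CollectI exI[of _ 1]) simp
    ultimately have R: "is_subring R" using CD(1) unfolding is_subring_def by blast
    have "range emb \<subseteq> R"
    proof
      fix x :: "'a poly fract alg_closure" assume "x \<in> range emb"
      then obtain z where z: "x = emb z" by blast
      obtain u v where uv: "z = Fract u v" "v \<noteq> 0" by (cases z) auto
      have "A_emb v * x = A_emb u" using uv by (simp add: z emb_Fract)
      then show "x \<in> R" using uv(2) AC[of u] unfolding R_def by (intro CollectI exI[of _ v]) simp
    qed
    then have "L \<subseteq> R" using L_minimal[OF subfieldI[OF R]] TC C_R by blast
    then show ?thesis using xL by (auto simp: R_def)
  qed
  have unit_C: "x \<in> C" if sx: "\<not> p dvd s" "A_emb s * x \<in> C" for s x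
  proof -
    have "s \<noteq> 0" using sx(1) by auto
    then have "x = inverse (A_emb s) * (A_emb s * x)" by simp
    also have "\<dots> \<in> C" by (rule CD(4)[OF KC[OF inverse_A_emb_Kp[OF sx(1)]] sx(2)])
    finally show ?thesis .
  qed
  \<comment> \<open>If p^j x lies in C with j > 0 least, then integrality of x puts a power of p^j x
    into pC. By \<open>radical\<close> the element p^j x itself lies in pC, and a factor p can be
    cancelled, against the choice of j.\<close>
  have B_C: "?B \<subseteq> C"
  proof
    fix x assume xB: "x \<in> ?B"
    then have xL: "x \<in> L" and xi: "int_over (range A_emb) x" by (auto simp: int_closure_iff)
    obtain s where s: "s \<noteq> 0" "A_emb s * x \<in> C" using L_frac[OF xL] by blast
    have "\<exists>j t. s = p ^ j * t \<and> \<not> p dvd t"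
      using multiplicity_decompose'[of s p] s(1) p_nonzero prime_p by (metis not_prime_unit)
    then obtain j t where jt: "s = p ^ j * t" "\<not> p dvd t" by blast
    have "A_emb t * (?P ^ j * x) \<in> C" using s(2) by (simp add: jt(1) mult_ac)
    then have "\<exists>j. ?P ^ j * x \<in> C" using unit_C[OF jt(2)] by blast
    then obtain j where j: "?P ^ j * x \<in> C" and least: "\<And>i. i < j \<Longrightarrow> ?P ^ i * x \<notin> C"
      using exists_least_iff[of "\<lambda>j. ?P ^ j * x \<in> C"] by blast
    show "x \<in> C"
    proof (cases j)
      case 0 then show ?thesis using j by simp
    next
      case (Suc i)
      define y where "y = ?P ^ j * x"
      obtain m a where a: "\<forall>k<m. a k \<in> range A_emb" "x ^ m = (\<Sum>k<m. a k * x ^ k)"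
        using xi unfolding int_over_def by blast
      have "y ^ m = (\<Sum>k<m. ?P ^ (j * m) * (a k * x ^ k))"
        by (simp add: y_def power_mult_distrib a(2) sum_distrib_left power_mult)
      also have "\<dots> = (\<Sum>k<m. ?P * ((?P ^ (j * (m - k) - 1) * a k) * y ^ k))"
      proof (intro sum.cong refl)
        \<comment> \<open>As k < m, the exponent j (m - k) is positive and one factor p can be taken
          out of each term.\<close>
        fix k assume "k \<in> {..<m}"
        then have km: "k < m" by simp
        then have "j * (m - k) > 0" using Suc by simp
        moreover have "j * m = j * (m - k) + j * k" using km by (simp flip: add_mult_distrib2)
        ultimately have "j * m = Suc (j * (m - k) - 1) + j * k" by simp
        then have "?P ^ (j * m) = ?P * ?P ^ (j * (m - k) - 1) * (?P ^ j) ^ k" by (simp add: power_add power_mult)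
        then show "?P ^ (j * m) * (a k * x ^ k) = ?P * ((?P ^ (j * (m - k) - 1) * a k) * y ^ k)"
          by (simp add: y_def power_mult_distrib mult_ac)
      qed
      also have "\<dots> = ?P * (\<Sum>k<m. (?P ^ (j * (m - k) - 1) * a k) * y ^ k)" by (simp add: sum_distrib_left)
      also have "\<dots> \<in> pC"
      proof (rule pCI, rule CD(8))
        fix k assume "k \<in> {..<m}"
        then have "a k \<in> range A_emb" using a(1) by simp
        then have "a k \<in> C" using AC by auto
        then show "(?P ^ (j * (m - k) - 1) * a k) * y ^ k \<in> C" unfolding y_def by (intro CD(4,7) AC j)
      qed
      finally have "y \<in> pC" by (intro radical[of y m]) (simp_all add: y_def j)
      then obtain w where w: "w \<in> C" "y = ?P * w" by (auto simp: pC_def)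
      then have "?P ^ i * x = w" using p0 by (simp add: y_def Suc mult.assoc)
      then show ?thesis using least[of i] w(1) Suc by simp
    qed
  qed
  \<comment> \<open>In effect the ideals of C/pC; \<open>JJ\<close> consists of its primes.\<close>
  define isI where "isI J \<longleftrightarrow> J \<subseteq> C \<and> pC \<subseteq> J \<and> (\<forall>x\<in>J. \<forall>y\<in>J. x + y \<in> J) \<and> (\<forall>b\<in>C. \<forall>x\<in>J. b * x \<in> J)" for J
  define JJ where "JJ = {J. isI J \<and> 1 \<notin> J \<and> (\<forall>x\<in>C. \<forall>y\<in>C. x * y \<in> J \<longrightarrow> x \<in> J \<or> y \<in> J)}"
  have isID: "J \<subseteq> C" "pC \<subseteq> J" "x \<in> J \<Longrightarrow> y \<in> J \<Longrightarrow> x + y \<in> J" "b \<in> C \<Longrightarrow> x \<in> J \<Longrightarrow> b * x \<in> J"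
    if "isI J" for J x y b using that by (auto simp: isI_def)
  have isI_diff: "x - y \<in> J" if "isI J" "x \<in> J" "y \<in> J" for J x y
    using isID(3)[OF that(1,2) isID(4)[OF that(1) CD(5)[OF CD(1)] that(3)]] by simp
  have JJD: "isI J" "1 \<notin> J" "x \<in> C \<Longrightarrow> y \<in> C \<Longrightarrow> x * y \<in> J \<Longrightarrow> x \<in> J \<or> y \<in> J"
    if "J \<in> JJ" for J x y using that by (auto simp: JJ_def)
  have J0: "0 \<in> J" if "isI J" for J using isID(2)[OF that] pCI[OF CD(2)] by auto
  have PJ: "?P \<in> J" if "isI J" for J using isID(2)[OF that] pCI[OF CD(1)] by auto
  \<comment> \<open>The product of x and x^(q^d - 1) - 1 lies in pC, hence in J, and x does not. So
    every element outside J is a unit modulo J.\<close>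
  have power_J: "x ^ (?Q - 1) - 1 \<in> J" if J: "J \<in> JJ" and x: "x \<in> C" "x \<notin> J" for J x
  proof -
    have "?Q = Suc (?Q - 1)" using Q1 by simp
    then have "x ^ ?Q - x = x * (x ^ (?Q - 1) - 1)" by (metis power_Suc mult.right_neutral right_diff_distrib)
    then have "x * (x ^ (?Q - 1) - 1) \<in> J" using frob[OF x(1)] isID(2)[OF JJD(1)[OF J]] by auto
    then show ?thesis using JJD(3)[OF J x(1), of "x ^ (?Q - 1) - 1"] x CD(1,6,7) by blast
  qed
  have power_in: "x ^ (?Q - 1) \<in> J" if J: "isI J" and x: "x \<in> C" "x \<in> J" for J x
  proof -
    have "?Q - 1 = Suc (?Q - 2)" using Q1 by simp
    then show ?thesis using isID(4)[OF J CD(7)[OF x(1)] x(2), of "?Q - 2"] by (simp add: mult.commute)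
  qed
  have incomp: "J = J'" if JJ': "J \<in> JJ" "J' \<in> JJ" "J \<subseteq> J'" for J J'
  proof (rule ccontr)
    assume "J \<noteq> J'"
    then obtain x where x: "x \<in> J'" "x \<notin> J" using JJ'(3) by blast
    have xC: "x \<in> C" using x isID(1)[OF JJD(1)[OF JJ'(2)]] by blast
    have "x ^ (?Q - 1) - 1 \<in> J'" using power_J[OF JJ'(1) xC x(2)] JJ'(3) by blast
    moreover have "x ^ (?Q - 1) \<in> J'" by (rule power_in[OF JJD(1)[OF JJ'(2)] xC x(1)])
    ultimately have "x ^ (?Q - 1) - (x ^ (?Q - 1) - 1) \<in> J'" using isI_diff[OF JJD(1)[OF JJ'(2)]] by blast
    then show False using JJD(2)[OF JJ'(2)] by simp
  qed
  \<comment> \<open>Up to pC, the product of all x - a over representatives a of A/p is x^(q^d) - x,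
    which lies in pC too. So one factor lies in the prime J.\<close>
  have residue: "\<exists>a. x - A_emb a \<in> J" if J: "J \<in> JJ" and x: "x \<in> C" for J x
  proof -
    obtain D' where D': "(\<Prod>a\<in>residues. x - A_emb a) - (x ^ ?Q - x) = ?P * poly (map_poly A_emb D') x"
      using residue_product by blast
    have "poly (map_poly A_emb D') x \<in> C"
      unfolding poly_altdef coeff_map_A_emb by (intro CD(8,4,7) AC x)
    then have "((\<Prod>a\<in>residues. x - A_emb a) - (x ^ ?Q - x)) + (x ^ ?Q - x) \<in> pC"
      unfolding D' by (intro pC_add pCI frob x)
    then have prod: "(\<Prod>a\<in>residues. x - A_emb a) \<in> J" using isID(2)[OF JJD(1)[OF J]] by auto
    have "\<exists>a\<in>I. x - A_emb a \<in> J" if "finite I" "(\<Prod>a\<in>I. x - A_emb a) \<in> J" for I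
      using that
    proof (induction I rule: finite_induct)
      case empty then show ?case using JJD(2)[OF J] by simp
    next
      case (insert b I)
      have "(\<Prod>a\<in>I. x - A_emb a) \<in> C" by (intro CD(9,6) x AC)
      then have "x - A_emb b \<in> J \<or> (\<Prod>a\<in>I. x - A_emb a) \<in> J"
        using JJD(3)[OF J CD(6)[OF x AC]] insert by simp
      then show ?case using insert.IH by blast
    qed
    moreover have "finite residues" by (simp add: residues_def card_polys)
    ultimately show ?thesis using prod by blast
  qed
  have JB: "J \<inter> ?B \<in> primes_above L p" if J: "J \<in> JJ" for J
  proof -
    note I = JJD(1)[OF J]
    have "A_emb a \<in> J \<longleftrightarrow> p dvd a" for a
    proof
      assume a: "A_emb a \<in> J"
      show "p dvd a"
      proof (rule ccontr)
        assume nd: "\<not> p dvd a"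
        then have "a \<noteq> 0" by auto
        have "inverse (A_emb a) * A_emb a \<in> J" by (rule isID(4)[OF I KC[OF inverse_A_emb_Kp[OF nd]] a])
        then show False using JJD(2)[OF J] \<open>a \<noteq> 0\<close> by simp
      qed
    next
      assume "p dvd a"
      then obtain k where "a = p * k" by blast
      then show "A_emb a \<in> J" using isID(4)[OF I AC PJ[OF I], of k] by (simp add: mult.commute)
    qed
    then have A: "J \<inter> ?B \<inter> range A_emb = A_emb ` {a. p dvd a}" using A_emb_B by blast
    have "J \<inter> ?B \<noteq> ?B" using JJD(2)[OF J] subringD(1)[OF B_subring] by blast
    moreover have "0 \<in> J \<inter> ?B" using J0[OF I] subringD(2)[OF B_subring] by blast
    moreover have "\<forall>x\<in>J \<inter> ?B. \<forall>y\<in>J \<inter> ?B. x + y \<in> J \<inter> ?B" using isID(3)[OF I] subringD(3)[OF B_subring] by blast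
    moreover have "\<forall>b\<in>?B. \<forall>x\<in>J \<inter> ?B. b * x \<in> J \<inter> ?B" using isID(4)[OF I] B_C subringD(4)[OF B_subring] by blast
    moreover have "\<forall>x\<in>?B. \<forall>y\<in>?B. x * y \<in> J \<inter> ?B \<longrightarrow> x \<in> J \<inter> ?B \<or> y \<in> J \<inter> ?B" using JJD(3)[OF J] B_C by blast
    ultimately show ?thesis unfolding primes_above_def Let_def using A by blast
  qed
  \<comment> \<open>Elements of C become integral over A after multiplication by some s prime to p,
    and s is a unit of C. So J can be recovered from its contraction.\<close>
  have inj: "inj_on (\<lambda>J. J \<inter> ?B) JJ"
  proof (rule inj_onI)
    have sub: "J \<subseteq> J'" if J: "J \<in> JJ" "J' \<in> JJ" "J \<inter> ?B = J' \<inter> ?B" for J J'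
    proof
      fix x assume x: "x \<in> J"
      have xC: "x \<in> C" using x isID(1)[OF JJD(1)[OF J(1)]] by blast
      then obtain s where s: "\<not> p dvd s" "A_emb s * x \<in> ?B" using C_Bp unfolding Bp_def by blast
      have "A_emb s * x \<in> J" by (rule isID(4)[OF JJD(1)[OF J(1)] AC x])
      then have "A_emb s * x \<in> J'" using s(2) J(3) by blast
      then have "inverse (A_emb s) * (A_emb s * x) \<in> J'"
        by (rule isID(4)[OF JJD(1)[OF J(2)] KC[OF inverse_A_emb_Kp[OF s(1)]]])
      moreover have "s \<noteq> 0" using s(1) by auto
      ultimately show "x \<in> J'" by (simp flip: mult.assoc)
    qed
    fix J J' assume "J \<in> JJ" "J' \<in> JJ" "J \<inter> ?B = J' \<inter> ?B"
    then show "J = J'" using sub[of J J'] sub[of J' J] by blast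
  qed
  have JJ_fin: "finite JJ" and JJ_card: "card JJ \<le> card (primes_above L p)"
  proof -
    have im: "(\<lambda>J. J \<inter> ?B) ` JJ \<subseteq> primes_above L p" using JB by blast
    show "finite JJ" by (rule inj_on_finite[OF inj im primes_finite])
    show "card JJ \<le> card (primes_above L p)" by (rule card_inj_on_le[OF inj im primes_finite])
  qed
  \<comment> \<open>For x outside pC the power e = x^(q^d - 1) is idempotent modulo pC and not in
    pC. An ideal maximal among those avoiding e is prime, and it cannot contain x.\<close>
  have inter: "x \<in> pC" if x: "x \<in> C" and all: "\<And>J. J \<in> JJ \<Longrightarrow> x \<in> J" for x
  proof (rule ccontr)
    assume nx: "x \<notin> pC"
    define e where "e = x ^ (?Q - 1)"
    have eC: "e \<in> C" unfolding e_def by (rule CD(7)[OF x])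
    have e1: "e \<notin> pC" using radical[OF x] nx unfolding e_def by blast
    have idem: "e * e - e \<in> pC"
    proof -
      have q2: "?Q - 1 + (?Q - 1) = (?Q - 2) + ?Q" "?Q - 1 = (?Q - 2) + 1" using Q1 by auto
      have "e * e - e = x ^ (?Q - 1 + (?Q - 1)) - x ^ (?Q - 1)" by (simp add: e_def power_add)
      also have "\<dots> = x ^ (?Q - 2 + ?Q) - x ^ (?Q - 2 + 1)" by (simp only: q2(1) q2(2)[symmetric])
      also have "\<dots> = x ^ (?Q - 2) * (x ^ ?Q - x)" by (simp only: power_add power_one_right right_diff_distrib)
      finally show ?thesis using pC_mult[OF CD(7)[OF x] frob[OF x]] by simp
    qed
    define \<A> where "\<A> = {I. isI I \<and> e \<notin> I}"
    have pA: "pC \<in> \<A>" unfolding \<A>_def isI_def using pC_C pC_add pC_mult e1 by auto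
    have "\<exists>M\<in>\<A>. \<forall>I\<in>\<A>. M \<subseteq> I \<longrightarrow> I = M"
    proof (rule subset_Zorn_nonempty)
      show "\<A> \<noteq> {}" using pA by blast
      fix \<C> assume ne: "\<C> \<noteq> {}" and ch: "subset.chain \<A> \<C>"
      have sub: "\<C> \<subseteq> \<A>" and tot: "\<And>I I'. I \<in> \<C> \<Longrightarrow> I' \<in> \<C> \<Longrightarrow> I \<subseteq> I' \<or> I' \<subseteq> I"
        using ch by (auto simp: subset.chain_def)
      have I: "isI I" if "I \<in> \<C>" for I using that sub by (auto simp: \<A>_def)
      have "isI (\<Union>\<C>)" unfolding isI_def
      proof (intro conjI ballI)
        show "\<Union>\<C> \<subseteq> C" using isID(1)[OF I] by blast
        show "pC \<subseteq> \<Union>\<C>" using isID(2)[OF I] ne by blast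
        fix x assume "x \<in> \<Union>\<C>"
        then obtain I1 where 1: "I1 \<in> \<C>" "x \<in> I1" by blast
        show "b * x \<in> \<Union>\<C>" if "b \<in> C" for b using isID(4)[OF I[OF 1(1)] that 1(2)] 1(1) by blast
        fix y assume "y \<in> \<Union>\<C>"
        then obtain I2 where 2: "I2 \<in> \<C>" "y \<in> I2" by blast
        from tot[OF 1(1) 2(1)] show "x + y \<in> \<Union>\<C>"
        proof
          assume "I1 \<subseteq> I2" then show ?thesis using isID(3)[OF I[OF 2(1)], of x y] 1 2 by blast
        next
          assume "I2 \<subseteq> I1" then show ?thesis using isID(3)[OF I[OF 1(1)], of x y] 1 2 by blast
        qed
      qed
      then show "\<Union>\<C> \<in> \<A>" using sub by (auto simp: \<A>_def)
    qed
    then obtain M where M: "isI M" "e \<notin> M" and max: "\<And>I. isI I \<Longrightarrow> e \<notin> I \<Longrightarrow> M \<subseteq> I \<Longrightarrow> I = M"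
      by (auto simp: \<A>_def)
    \<comment> \<open>Adjoining an element outside M brings e into the ideal, by maximality.\<close>
    have ext: "\<exists>j\<in>M. \<exists>k\<in>C. e = j + a * k" if a: "a \<in> C" "a \<notin> M" for a
    proof -
      define I where "I = {j + a * k | j k. j \<in> M \<and> k \<in> C}"
      have II: "j + a * k \<in> I" if "j \<in> M" "k \<in> C" for j k using that by (auto simp: I_def)
      have "M \<subseteq> I"
      proof
        fix j assume "j \<in> M" then show "j \<in> I" using II[of j 0] CD(2) by simp
      qed
      moreover have "a \<in> I" using II[OF J0[OF M(1)] CD(1)] by simp
      moreover have "isI I" unfolding isI_def
      proof (intro conjI ballI)
        show "I \<subseteq> C" using isID(1)[OF M(1)] a by (auto simp: I_def intro!: CD(3,4))
        show "pC \<subseteq> I" using \<open>M \<subseteq> I\<close> isID(2)[OF M(1)] by blast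
        fix x assume "x \<in> I"
        then obtain j k where jk: "x = j + a * k" "j \<in> M" "k \<in> C" by (auto simp: I_def)
        show "b * x \<in> I" if b: "b \<in> C" for b
          using II[OF isID(4)[OF M(1) b jk(2)] CD(4)[OF b jk(3)]] by (simp add: jk(1) algebra_simps)
        fix y assume "y \<in> I"
        then obtain j' k' where jk': "y = j' + a * k'" "j' \<in> M" "k' \<in> C" by (auto simp: I_def)
        show "x + y \<in> I"
          using II[OF isID(3)[OF M(1) jk(2) jk'(2)] CD(3)[OF jk(3) jk'(3)]] by (simp add: jk(1) jk'(1) algebra_simps)
      qed
      ultimately have "e \<in> I" using max[of I] a(2) by blast
      then show ?thesis by (auto simp: I_def)
    qed
    have "M \<in> JJ" unfolding JJ_def
    proof (intro CollectI conjI ballI impI M)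
      show "1 \<notin> M" using isID(4)[OF M(1) eC, of 1] M(2) by auto
      fix a b assume ab: "a \<in> C" "b \<in> C" "a * b \<in> M"
      show "a \<in> M \<or> b \<in> M"
      proof (rule ccontr)
        assume "\<not> ?thesis"
        then obtain j k j' k' where 1: "j \<in> M" "k \<in> C" "e = j + a * k" and 2: "j' \<in> M" "k' \<in> C" "e = j' + b * k'"
          using ext[OF ab(1)] ext[OF ab(2)] by blast
        \<comment> \<open>Multiplying the two expressions for e puts e^2 into M; as e^2 is congruent
          to e, this contradicts the choice of M.\<close>
        have "e * e = e * j + (a * k) * j' + (k * k') * (a * b)"
        proof -
          have "e * e = e * (j + a * k)" using 1(3) by simp
          also have "\<dots> = e * j + (a * k) * e" by (simp add: algebra_simps)
          also have "(a * k) * e = (a * k) * (j' + b * k')" using 2(3) by simp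
          finally show ?thesis by (simp add: algebra_simps)
        qed
        also have "\<dots> \<in> M" by (intro isID(3,4)[OF M(1)] eC 1 2 ab CD(4))
        finally have "e * e - (e * e - e) \<in> M" using isI_diff[OF M(1)] idem isID(2)[OF M(1)] by blast
        then show False using M(2) by simp
      qed
    qed
    then have "x \<in> M" using all by blast
    then show False using power_in[OF M(1) x] M(2) by (simp add: e_def)
  qed
  \<comment> \<open>As in the Chinese remainder theorem, elements congruent to 1 at J and to 0 at
    all other primes: the (q^d - 1)-st power of a separating element.\<close>
  have "\<exists>e. J \<in> JJ \<longrightarrow> e \<in> C \<and> e - 1 \<in> J \<and> (\<forall>J'\<in>JJ - {J}. e \<in> J')" for J
  proof (cases "J \<in> JJ")
    case J: True
    have "\<exists>y\<in>C. y \<notin> J \<and> (\<forall>J'\<in>I. y \<in> J')" if "finite I" "I \<subseteq> JJ - {J}" for I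
      using that
    proof (induction I rule: finite_induct)
      case empty show ?case using CD(1) JJD(2)[OF J] by blast
    next
      case (insert J1 I)
      then obtain y where y: "y \<in> C" "y \<notin> J" "\<forall>J'\<in>I. y \<in> J'" by auto
      have J1: "J1 \<in> JJ" "J1 \<noteq> J" using insert.prems by auto
      then obtain z where z: "z \<in> J1" "z \<notin> J" using incomp[OF J1(1) J] by blast
      have zC: "z \<in> C" using z isID(1)[OF JJD(1)[OF J1(1)]] by blast
      have "z * y \<notin> J" using JJD(3)[OF J zC y(1)] y(2) z(2) by blast
      moreover have "z * y \<in> J'" if "J' \<in> I" for J'
        using isID(4)[of J', OF JJD(1) zC] y(3) that insert.prems by blast
      moreover have "z * y \<in> J1" using isID(4)[OF JJD(1)[OF J1(1)] y(1) z(1)] by (simp add: mult.commute)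
      ultimately show ?case using CD(4)[OF zC y(1)] by (intro bexI[of _ "z * y"]) auto
    qed
    from this[of "JJ - {J}"] obtain y where y: "y \<in> C" "y \<notin> J" "\<forall>J'\<in>JJ - {J}. y \<in> J'" using JJ_fin by auto
    have "y ^ (?Q - 1) - 1 \<in> J" by (rule power_J[OF J y(1,2)])
    moreover have "y ^ (?Q - 1) \<in> J'" if "J' \<in> JJ - {J}" for J'
      using power_in[OF JJD(1) y(1)] y(3) that by blast
    ultimately show ?thesis using CD(7)[OF y(1)] by (intro exI[of _ "y ^ (?Q - 1)"]) blast
  qed simp
  then have "\<exists>e. \<forall>J. J \<in> JJ \<longrightarrow> e J \<in> C \<and> e J - 1 \<in> J \<and> (\<forall>J'\<in>JJ - {J}. e J \<in> J')" by (intro choice allI)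
  then obtain e where e: "\<And>J. J \<in> JJ \<Longrightarrow> e J \<in> C" "\<And>J. J \<in> JJ \<Longrightarrow> e J - 1 \<in> J"
    "\<And>J J'. J \<in> JJ \<Longrightarrow> J' \<in> JJ \<Longrightarrow> J' \<noteq> J \<Longrightarrow> e J \<in> J'" by blast
  let ?E = "e ` JJ"
  \<comment> \<open>The combination v has the same residue as x at every prime of \<open>JJ\<close>,
    so the difference lies in their intersection pC.\<close>
  have decomp: "\<exists>v\<in>Fv.span ?E. \<exists>w\<in>C. x = v + ?P * w" if x: "x \<in> C" for x
  proof -
    have "\<exists>a. \<forall>J. J \<in> JJ \<longrightarrow> x - A_emb (a J) \<in> J" using residue[OF _ x] by (intro choice) blast
    then obtain a where a: "\<And>J. J \<in> JJ \<Longrightarrow> x - A_emb (a J) \<in> J" by blast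
    define v where "v = (\<Sum>J\<in>JJ. A_emb (a J) * e J)"
    have vC: "v \<in> C" unfolding v_def by (intro CD(8,4) AC e)
    have "x - v \<in> pC"
    proof (rule inter[OF CD(6)[OF x vC]])
      fix J assume J: "J \<in> JJ"
      note I = JJD(1)[OF J]
      have "v = A_emb (a J) * e J + (\<Sum>J'\<in>JJ - {J}. A_emb (a J') * e J')"
        unfolding v_def by (rule sum.remove[OF JJ_fin J])
      then have eq: "x - v = (x - A_emb (a J)) - A_emb (a J) * (e J - 1) - (\<Sum>J'\<in>JJ - {J}. A_emb (a J') * e J')"
        by (simp add: algebra_simps)
      have "(\<Sum>J'\<in>I'. A_emb (a J') * e J') \<in> J" if "I' \<subseteq> JJ - {J}" for I'
        using finite_subset[OF that] JJ_fin that
      proof (induction I' rule: infinite_finite_induct)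
        case empty then show ?case using J0[OF I] by simp
      next
        case (insert J1 I')
        then show ?case using isID(3)[OF I isID(4)[OF I AC]] e(3)[of J1 J] J by auto
      qed simp
      then show "x - v \<in> J" unfolding eq by (intro isI_diff[OF I] a J isID(4)[OF I AC] e(2)) auto
    qed
    then obtain w where w: "w \<in> C" "x - v = ?P * w" by (auto simp: pC_def)
    have "v \<in> Fv.span ?E" unfolding v_def
    proof (rule Fv.span_sum)
      fix J assume "J \<in> JJ"
      then show "A_emb (a J) * e J \<in> Fv.span ?E"
        using Fv.span_scale[OF Fv.span_base[of "e J" ?E], of "to_fract (a J)"] by (simp add: emb_to_fract)
    qed
    moreover have "x = v + ?P * w" using w(2) by (simp add: algebra_simps)
    ultimately show ?thesis using w(1) by blast
  qed
  have "S \<subseteq> Fv.span ?E"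
  proof (rule nakayama[OF S(1)])
    fix s assume "s \<in> S"
    then obtain v w where vw: "v \<in> Fv.span ?E" "w \<in> C" "s = v + ?P * w" using decomp SC by blast
    obtain b where "\<forall>t\<in>S. b t \<in> Kp" "w = (\<Sum>t\<in>S. b t * t)" using vw(2) unfolding C_def by (rule kspanE)
    then show "\<exists>v\<in>Fv.span ?E. \<exists>b. (\<forall>t\<in>S. b t \<in> Kp) \<and> s = v + ?P * (\<Sum>t\<in>S. b t * t)"
      using vw(1,3) by (intro bexI[of _ v] exI[of _ b]) simp_all
  qed
  have C_E: "x \<in> Fv.span ?E" if xC: "x \<in> C" for x
  proof -
    obtain b where b: "\<forall>t\<in>S. b t \<in> Kp" "x = (\<Sum>t\<in>S. b t * t)" using xC unfolding C_def by (rule kspanE)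
    have "b t * t \<in> Fv.span ?E" if t: "t \<in> S" for t
    proof -
      obtain z where "b t = emb z" using b(1) t by (auto simp: Kp_def)
      then show ?thesis using Fv.span_scale[of t ?E z] \<open>S \<subseteq> Fv.span ?E\<close> t by auto
    qed
    then show ?thesis unfolding b(2) by (rule Fv.span_sum)
  qed
  have "L \<subseteq> Fv.span ?E"
  proof
    fix x assume "x \<in> L"
    then obtain s where s: "s \<noteq> 0" "A_emb s * x \<in> C" using L_frac by blast
    have "emb (inverse (to_fract s)) * (A_emb s * x) \<in> Fv.span ?E" by (rule Fv.span_scale[OF C_E[OF s(2)]])
    moreover have "emb (inverse (to_fract s)) * (A_emb s * x) = x" using s(1) by (simp add: emb_to_fract flip: mult.assoc)
    ultimately show "x \<in> Fv.span ?E" by (simp only:)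
  qed
  \<comment> \<open>L is spanned by at most as many elements as there are primes above p; the
    opposite inequality is \<open>primes_card_le\<close>.\<close>
  then have "ext_degree L \<le> card ?E"
    using JJ_fin e(1) C_L by (intro ext_degree_le) auto
  also have "\<dots> \<le> card JJ" by (rule card_image_le[OF JJ_fin])
  also note JJ_card
  finally show ?thesis using primes_card_le by simp
qed

end

theorem theorem1p2:
  fixes phiT :: "'a::{finite,field_gcd} poly fract poly" and r :: nat and n p :: "'a poly"
  assumes "drinfeld_module r phiT" and "r \<ge> 2"
    and "n \<noteq> 0"
    and "\<not> CHAR('a) dvd r"
    and "p \<in> good_primes r phiT" and "\<not> p dvd n"
  shows "splits_completely (torsion_field phiT n) p \<longleftrightarrow>
    (n dvd coeff (frob_charpoly p phiT) (r - 1) + of_nat r \<and> n dvd refined_b1 r p phiT)"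
proof -
  have "prime p" using assms(5) by (simp add: good_primes_def)
  then obtain \<theta> where rf: "residue_field p \<theta> (card (UNIV :: 'a set))" using ex_residue_field by blast
  interpret residue_field p \<theta> "card (UNIV :: 'a set)" by (rule rf)
  interpret torsion_setup p \<theta> "card (UNIV :: 'a set)" phiT r n
    using assms by (intro torsion_setup.intro good_reduction.intro) (unfold_locales, auto)
  have r0: "of_nat r \<noteq> (0::'a)" using assms(4) by (simp add: of_nat_eq_0_iff_char_dvd)
  show ?thesis
    unfolding rhs_iff[OF r0 assms(2,3)] splits_completely_def
    using splits_imp_divisor divisor_imp_splits by blast
qed

end
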